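(* Assume $\lambda_0>0$, (H2), (H3), (H8) and (H9). Then, with $\mathrm P^{(-\infty)}=\mathrm P^{(-\infty),\phi_0}_\pi$, for all $x\in E$, $t\ge0$ and every bounded $\sigma(Y_r,r\in[-t,0])$-measurable $f$, $$\mathrm E_x^{(-h)}\big[f(Y_{[-t,0]})\big]\xrightarrow[h\to+\infty]{}\mathrm E^{(-\infty)}\big[f(Y_{[-t,0]})\big].$$
   Context: $C_b$ denotes the bounded continuous real functions on the state space $E$, $\mathcal M_f(E)$ the finite measures on $E$, $\nu(f)=\int f\,d\nu$. $Y$ is the canonical process on $D(\mathbb R_+,E)$ (càdlàg paths), $\mathcal D_t$ its canonical right-continuous filtration, and $(\mathrm P_x)_{x\in E}$ a Borel strong Markov process (expectation $\mathrm E_x$) whose semigroup maps $C_b$ to $C_b$. Its generator $\mathcal L$: $f\in\mathrm{Dom}(\mathcal L)$ iff $f\in C_b$ and there is $g\in C_b$ such that $f(Y_t)-f(x)-\int_0^tg(Y_s)ds$ is a $\mathrm P_x$-martingale for all $x$; then $\mathcal Lf=g$. Moreover $Y$ is either (a) an irreducible continuous-time Markov chain on a finite set $E=\{1,\dots,K\}$, or (b) a diffusion on a domain $E\subset\mathbb R^K$ with generator $\mathcal Lu=\sum_ib_i\partial_{x_i}u+\frac12\sum_{i,j}a_{ij}\partial_{x_ix_j}u$, where $a_{ij},b_i\in C^{1,\mu}(E)$ (first-order derivatives locally Hölder with exponent $\mu\in[0,1)$) and $(a_{ij})$ is positive definite. $\alpha,\beta\in C_b$, $\alpha$ bounded below by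 a positive constant, $\psi(x,\lambda)=\beta(x)\lambda+\alpha(x)\lambda^2$. The $(\mathcal L,\beta,\alpha)$-superprocess is the Markov process $X$ on $\Omega=C(\mathbb R_+,\mathcal M_f(E))$ with laws $\mathbb P_\nu$, $\nu\in\mathcal M_f(E)$, such that for bounded nonnegative measurable $f,\phi$: $\mathbb E_\nu[e^{-X_t(f)-\int_0^tX_s(\phi)ds}]=e^{-\nu(u_t)}$, where $u\ge0$ is the unique jointly measurable solution, bounded on $[0,T]\times E$ for all $T$, of $u_t(x)+\mathrm E_x[\int_0^t\psi(Y_s,u_{t-s}(Y_s))ds]=\mathrm E_x[f(Y_t)+\int_0^t\phi(Y_s)ds]$. Its canonical measures $\mathbb N_x$ are the $\sigma$-finite measures on $\Omega$ (measurable in $x$) such that if $\sum_j\delta_{(x^j,X^j)}$ is Poisson with intensity $\nu(dx)\mathbb N_x[dX]$ then $\sum_jX^j$ has law $\mathbb P_\nu$. $H_{\max}=\inf\{t>0:X_t=0\}$, $v_t(x)=\mathbb N_x[H_{\max}>t]$. $\lambda_0=\sup\{\ell\in\mathbb R:\exists u\in\mathrm{Dom}(\mathcal L),u>0,(\beta-\mathcal L)u=\ell u\}$; the space of positive harmonic functions of $(\beta-\lambda_0)-\mathcal L$ is assumed one-dimensional, generated by $\phi_0>0$, so $(\beta-\mathcal L)\phi_0=\lambda_0\phi_0$. Assumptions: (H2) $1/\alpha\in\mathrm{Dom}(\mathcal L)$; then put $\tilde\beta=\beta-\alpha\mathcal L(1/\alpha)$, let $\tilde{\mathrm P}_x$ be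 given by $\frac{d\tilde{\mathrm P}_x}{d\mathrm P_x}\big|_{\mathcal D_t}=\frac{\alpha(x)}{\alpha(Y_t)}e^{\int_0^t(\tilde\beta-\beta)(Y_s)ds}$ and $\tilde{\mathcal L}$ be the generator of $Y$ under $\tilde{\mathrm P}$. (H3) $\tilde\beta\in\mathrm{Dom}(\tilde{\mathcal L})$. (H8) $\phi_0\in\mathrm{Dom}(\mathcal L)$ and $C_1\le\phi_0\le C_2$ for some positive constants $C_1,C_2$; then $\mathrm P_x^{\phi_0}$ (expectation $\mathrm E_x^{\phi_0}$) is defined by $\frac{d\mathrm P_x^{\phi_0}}{d\mathrm P_x}\big|_{\mathcal D_t}=\frac{\phi_0(Y_t)}{\phi_0(Y_0)}e^{-\int_0^t(\beta(Y_s)-\lambda_0)ds}$, $t\ge0$. (H9) $\mathrm P^{\phi_0}$ admits a stationary probability measure $\pi$, and for every $x\in E$, $\sup_{\|f\|_\infty\le1}|\mathrm E_x^{\phi_0}[f(Y_t)]-\pi(f)|\to0$ as $t\to\infty$ (supremum over bounded measurable $f$). $\mathrm P_\pi^{\phi_0}$ also denotes the law of the stationary version on $D(\mathbb R,E)$. Spine laws: under these assumptions $t\mapsto v_t(x)$ is $C^1$ on $(0,\infty)$ with nonzero derivative; $\mathrm P_x^{(h)}$ has, with respect to $\mathrm P_x$, density $M^{(h)}_t=\frac{\partial_hv_{h-t}(Y_t)}{\partial_hv_h(x)}e^{-\int_0^t\partial_\lambda\psi(Y_s,v_{h-s}(Y_s))ds}$ on $\mathcal D_t$ for $0\le t<h$,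 and density $\lim_{t\uparrow h}M^{(h)}_t$ on $\mathcal D_h$. $\mathrm P_x^{(-h)}$ (expectation $\mathrm E_x^{(-h)}$) is the law of $(Y_{h+s},s\in[-h,0])$ under $\mathrm P_x^{(h)}$, and $\mathrm P_\pi^{(-h)}=\int\pi(dx)\mathrm P_x^{(-h)}$. Let $L^{(-h)}$ be the Radon-Nikodym derivative of $\mathrm P_\pi^{(-h)}$ with respect to $\mathrm P_\pi^{\phi_0}$ on $\sigma(Y_r,r\in[-h,0])$. Under the assumptions of the claim, $L^{(-h)}$ converges as $h\to\infty$, $\mathrm P_\pi^{\phi_0}$-a.s. and in $L^1(\mathrm P_\pi^{\phi_0})$, to a limit $L^{(-\infty)}$; $\mathrm P_\pi^{(-\infty),\phi_0}$ is the probability measure on $D((-\infty,0],E)$ with density $L^{(-\infty)}$ with respect to $\mathrm P_\pi^{\phi_0}$ (restricted to $\sigma(Y_r,r\le0)$). *)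

theory Defs
  imports "HOL-Probability.Probability" "HOL-Probability.Stopping_Time"
begin

section \<open>State space and cadlag paths\<close>

type_synonym 'a path = "real \<Rightarrow> 'a"

abbreviation borel_on :: "'a::topological_space set \<Rightarrow> 'a measure" where
  "borel_on E \<equiv> restrict_space borel E"

text \<open>Functions on \<open>E\<close> are total functions whose values outside \<open>E\<close> are irrelevant.\<close>

definition C_b :: "'a::topological_space set \<Rightarrow> ('a \<Rightarrow> real) set" where
  "C_b E = {f. continuous_on E f \<and> bounded (f ` E)}"

text \<open>\<open>D(T, E)\<close> for a time interval \<open>T\<close>. Left limits must exist inside \<open>E\<close>; at the left end
  point of \<open>T\<close> the filter is trivial and nothing is required.\<close>

definition skorokhod :: "'a::topological_space set \<Rightarrow> real set \<Rightarrow> 'a path set" where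
  "skorokhod E T = {\<omega> \<in> extensional T. \<forall>t\<in>T. \<omega> t \<in> E \<and>
     (\<omega> \<longlongrightarrow> \<omega> t) (at t within T \<inter> {t..}) \<and>
     (\<exists>l\<in>E. (\<omega> \<longlongrightarrow> l) (at t within T \<inter> {..<t}))}"

text \<open>The \<open>\<sigma>\<close>-field \<open>\<sigma>(Y\<^sub>r, r \<in> S)\<close> on \<open>D(T, E)\<close>.\<close>

definition coord_algebra :: "'a::topological_space set \<Rightarrow> real set \<Rightarrow> real set \<Rightarrow> 'a path measure" where
  "coord_algebra E T S = sigma (skorokhod E T)
     {{\<omega> \<in> skorokhod E T. \<omega> r \<in> A} | r A. r \<in> S \<and> A \<in> sets borel}"

abbreviation path_space :: "'a::topological_space set \<Rightarrow> real set \<Rightarrow> 'a path measure" where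
  "path_space E T \<equiv> coord_algebra E T T"

text \<open>The right-continuous canonical filtration on \<open>D([0,\<infinity>), E)\<close>. The index is extended by
  \<open>\<infinity>\<close>, where the intersection over \<open>s\<close> is empty and the full \<open>\<sigma>\<close>-field remains.\<close>

definition filt :: "'a::topological_space set \<Rightarrow> ennreal \<Rightarrow> 'a path measure" where
  "filt E t = sigma (skorokhod E {0..})
     (sets (path_space E {0..}) \<inter> (\<Inter>s\<in>{s. t < ennreal s}. sets (coord_algebra E {0..} {0..s})))"

definition path_shift :: "real \<Rightarrow> 'b path \<Rightarrow> 'b path" where
  "path_shift s \<omega> = (\<lambda>r\<in>{0..}. \<omega> (s + r))"

section \<open>The spatial motion\<close>

definition strong_markov_process ::
  "'a::topological_space set \<Rightarrow> ('a \<Rightarrow> 'a path measure) \<Rightarrow> bool" where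
  "strong_markov_process E P \<longleftrightarrow>
     P \<in> borel_on E \<rightarrow>\<^sub>M prob_algebra (path_space E {0..}) \<and>
     (\<forall>x\<in>E. AE \<omega> in P x. \<omega> 0 = x) \<and>
     (\<forall>x\<in>E. \<forall>T A B. stopping_time (filt E) T \<longrightarrow>
        A \<in> sets (filtration.pre_sigma (skorokhod E {0..}) (filt E) T) \<longrightarrow>
        B \<in> sets (path_space E {0..}) \<longrightarrow>
        emeasure (P x) {\<omega> \<in> A. T \<omega> < \<infinity> \<and> path_shift (enn2real (T \<omega>)) \<omega> \<in> B} =
          (\<integral>\<^sup>+\<omega>\<in>{\<omega> \<in> A. T \<omega> < \<infinity>}. emeasure (P (\<omega> (enn2real (T \<omega>)))) B \<partial>P x))"

definition Cb_semigroup :: "'a::topological_space set \<Rightarrow> ('a \<Rightarrow> 'a path measure) \<Rightarrow> bool" where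
  "Cb_semigroup E P \<longleftrightarrow> (\<forall>f\<in>C_b E. \<forall>t\<ge>0. (\<lambda>x. \<integral>\<omega>. f (\<omega> t) \<partial>P x) \<in> C_b E)"

definition martingale :: "(real \<Rightarrow> 'w measure) \<Rightarrow> 'w measure \<Rightarrow> (real \<Rightarrow> 'w \<Rightarrow> real) \<Rightarrow> bool" where
  "martingale F Q M \<longleftrightarrow>
     (\<forall>t\<ge>0. M t \<in> borel_measurable (F t) \<and> integrable Q (M t)) \<and>
     (\<forall>s\<ge>0. \<forall>t\<ge>s. AE \<omega> in Q. real_cond_exp Q (F s) (M t) \<omega> = M s \<omega>)"

text \<open>\<open>f \<in> Dom(L)\<close> and \<open>L f = g\<close>. On \<open>E\<close> the function \<open>g\<close> is determined by \<open>f\<close>.\<close>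

definition has_generator ::
  "'a::topological_space set \<Rightarrow> ('a \<Rightarrow> 'a path measure) \<Rightarrow> ('a \<Rightarrow> real) \<Rightarrow> ('a \<Rightarrow> real) \<Rightarrow> bool" where
  "has_generator E P f g \<longleftrightarrow> f \<in> C_b E \<and> g \<in> C_b E \<and>
     (\<forall>x\<in>E. martingale (\<lambda>t. filt E (ennreal t)) (P x)
        (\<lambda>t \<omega>. f (\<omega> t) - f x - (\<integral>s\<in>{0..t}. g (\<omega> s) \<partial>lborel)))"

definition gen_dom :: "'a::topological_space set \<Rightarrow> ('a \<Rightarrow> 'a path measure) \<Rightarrow> ('a \<Rightarrow> real) set" where
  "gen_dom E P = {f. \<exists>g. has_generator E P f g}"

definition gen ::
  "'a::topological_space set \<Rightarrow> ('a \<Rightarrow> 'a path measure) \<Rightarrow> ('a \<Rightarrow> real) \<Rightarrow> 'a \<Rightarrow> real" where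
  "gen E P f = (SOME g. has_generator E P f g)"

text \<open>A process with cadlag paths in a finite set, which carries the discrete topology, is a
  continuous-time chain. The set \<open>{1, \<dots>, K}\<close> is replaced by any set of \<open>K\<close> labels in the
  ambient space.\<close>

definition finite_irreducible_chain ::
  "'a::topological_space set \<Rightarrow> ('a \<Rightarrow> 'a path measure) \<Rightarrow> bool" where
  "finite_irreducible_chain E P \<longleftrightarrow> finite E \<and> E \<noteq> {} \<and>
     (\<forall>x\<in>E. \<forall>y\<in>E. \<exists>t\<ge>0. 0 < emeasure (P x) {\<omega> \<in> space (P x). \<omega> t = y})"

definition dpart :: "'a::euclidean_space \<Rightarrow> ('a \<Rightarrow> real) \<Rightarrow> 'a \<Rightarrow> real" where
  "dpart i f x = deriv (\<lambda>s. f (x + s *\<^sub>R i)) 0"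

definition C1_on :: "'a::euclidean_space set \<Rightarrow> ('a \<Rightarrow> real) \<Rightarrow> bool" where
  "C1_on E f \<longleftrightarrow> (\<forall>i\<in>Basis. (\<forall>x\<in>E. (\<lambda>s. f (x + s *\<^sub>R i)) differentiable (at 0)) \<and>
     continuous_on E (dpart i f))"

definition C1_holder_on :: "'a::euclidean_space set \<Rightarrow> real \<Rightarrow> ('a \<Rightarrow> real) \<Rightarrow> bool" where
  "C1_holder_on E \<mu> f \<longleftrightarrow> C1_on E f \<and>
     (\<forall>i\<in>Basis. \<forall>K. compact K \<and> K \<subseteq> E \<longrightarrow>
        (\<exists>C. \<forall>x\<in>K. \<forall>y\<in>K. \<bar>dpart i f x - dpart i f y\<bar> \<le> C * dist x y powr \<mu>))"

definition C2_compact_support :: "'a::euclidean_space set \<Rightarrow> ('a \<Rightarrow> real) \<Rightarrow> bool" where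
  "C2_compact_support E u \<longleftrightarrow> C1_on E u \<and> (\<forall>i\<in>Basis. C1_on E (dpart i u)) \<and>
     (\<exists>K. compact K \<and> K \<subseteq> E \<and> (\<forall>x. x \<notin> K \<longrightarrow> u x = 0))"

definition diff_op ::
  "('a::euclidean_space \<Rightarrow> 'a \<Rightarrow> real) \<Rightarrow> ('a \<Rightarrow> 'a \<Rightarrow> 'a \<Rightarrow> real) \<Rightarrow> ('a \<Rightarrow> real) \<Rightarrow> 'a \<Rightarrow> real" where
  "diff_op b a u x = (\<Sum>i\<in>Basis. b i x * dpart i u x) +
     1/2 * (\<Sum>i\<in>Basis. \<Sum>j\<in>Basis. a i j x * dpart i (dpart j u) x)"

text \<open>The differential expression prescribes the generator on the \<open>C\<^sup>2\<close> functions with compact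
  support in \<open>E\<close> (well-posed martingale problem); the process has continuous paths and never
  leaves \<open>E\<close>. Coordinates are indexed by the standard basis.\<close>

definition diffusion :: "'a::euclidean_space set \<Rightarrow> ('a \<Rightarrow> 'a path measure) \<Rightarrow> bool" where
  "diffusion E P \<longleftrightarrow> open E \<and> connected E \<and> E \<noteq> {} \<and>
     (\<forall>x\<in>E. AE \<omega> in P x. continuous_on {0..} \<omega>) \<and>
     (\<exists>\<mu> b a. 0 \<le> \<mu> \<and> \<mu> < 1 \<and>
        (\<forall>i\<in>Basis. C1_holder_on E \<mu> (b i)) \<and>
        (\<forall>i\<in>Basis. \<forall>j\<in>Basis. C1_holder_on E \<mu> (a i j)) \<and>
        (\<forall>x\<in>E. \<forall>i\<in>Basis. \<forall>j\<in>Basis. a i j x = a j i x) \<and>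
        (\<forall>x\<in>E. \<forall>w. w \<noteq> 0 \<longrightarrow> 0 < (\<Sum>i\<in>Basis. \<Sum>j\<in>Basis. a i j x * (w \<bullet> i) * (w \<bullet> j))) \<and>
        (\<forall>u. C2_compact_support E u \<longrightarrow> has_generator E P u (diff_op b a u)))"

section \<open>The superprocess and its canonical measures\<close>

definition psi :: "('a \<Rightarrow> real) \<Rightarrow> ('a \<Rightarrow> real) \<Rightarrow> 'a \<Rightarrow> real \<Rightarrow> real" where
  "psi \<alpha> \<beta> x l = \<beta> x * l + \<alpha> x * l\<^sup>2"

definition finite_measures :: "'a::topological_space set \<Rightarrow> 'a measure set" where
  "finite_measures E = {\<nu>. sets \<nu> = sets (borel_on E) \<and> finite_measure \<nu>}"

text \<open>Generated by the evaluations; on a separable metric space this is the Borel \<open>\<sigma>\<close>-field of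
  the weak topology.\<close>

definition finite_measures_algebra :: "'a::topological_space set \<Rightarrow> 'a measure measure" where
  "finite_measures_algebra E = sigma (finite_measures E)
     {{\<nu> \<in> finite_measures E. emeasure \<nu> A \<in> C} | A C. A \<in> sets (borel_on E) \<and> C \<in> sets borel}"

text \<open>\<open>C([0,\<infinity>), M\<^sub>f(E))\<close>, continuity being that of the weak topology.\<close>

definition super_paths :: "'a::topological_space set \<Rightarrow> 'a measure path set" where
  "super_paths E = {X \<in> extensional {0..}. (\<forall>t\<ge>0. X t \<in> finite_measures E) \<and>
     (\<forall>f\<in>C_b E. continuous_on {0..} (\<lambda>t. \<integral>y. f y \<partial>X t))}"

definition super_algebra :: "'a::topological_space set \<Rightarrow> real set \<Rightarrow> 'a measure path measure" where
  "super_algebra E S = sigma (super_paths E)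
     {{X \<in> super_paths E. X t \<in> B} | t B. t \<in> S \<and> B \<in> sets (finite_measures_algebra E)}"

definition bounded_nonneg_measurable :: "'a::topological_space set \<Rightarrow> ('a \<Rightarrow> real) \<Rightarrow> bool" where
  "bounded_nonneg_measurable E f \<longleftrightarrow>
     f \<in> borel_measurable (borel_on E) \<and> (\<forall>x\<in>E. 0 \<le> f x) \<and> bounded (f ` E)"

definition log_laplace_solution ::
  "'a::euclidean_space set \<Rightarrow> ('a \<Rightarrow> 'a path measure) \<Rightarrow> ('a \<Rightarrow> real) \<Rightarrow> ('a \<Rightarrow> real) \<Rightarrow>
   ('a \<Rightarrow> real) \<Rightarrow> ('a \<Rightarrow> real) \<Rightarrow> (real \<Rightarrow> 'a \<Rightarrow> real) \<Rightarrow> bool" where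
  "log_laplace_solution E P \<alpha> \<beta> f \<phi> u \<longleftrightarrow>
     (\<lambda>(t, x). u t x) \<in> borel_measurable (restrict_space borel ({0..} \<times> E)) \<and>
     (\<forall>t\<ge>0. \<forall>x\<in>E. 0 \<le> u t x) \<and>
     (\<forall>T. \<exists>C. \<forall>t\<in>{0..T}. \<forall>x\<in>E. u t x \<le> C) \<and>
     (\<forall>t\<ge>0. \<forall>x\<in>E.
        u t x + (\<integral>\<omega>. (\<integral>s\<in>{0..t}. psi \<alpha> \<beta> (\<omega> s) (u (t - s) (\<omega> s)) \<partial>lborel) \<partial>P x) =
        (\<integral>\<omega>. (f (\<omega> t) + (\<integral>s\<in>{0..t}. \<phi> (\<omega> s) \<partial>lborel)) \<partial>P x))"

definition superprocess ::
  "'a::euclidean_space set \<Rightarrow> ('a \<Rightarrow> 'a path measure) \<Rightarrow> ('a \<Rightarrow> real) \<Rightarrow> ('a \<Rightarrow> real) \<Rightarrow>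
   ('a measure \<Rightarrow> 'a measure path measure) \<Rightarrow> bool" where
  "superprocess E P \<alpha> \<beta> PP \<longleftrightarrow>
     PP \<in> finite_measures_algebra E \<rightarrow>\<^sub>M prob_algebra (super_algebra E {0..}) \<and>
     (\<forall>\<nu>\<in>finite_measures E. \<forall>s\<ge>0. \<forall>A\<in>sets (super_algebra E {0..s}). \<forall>B\<in>sets (super_algebra E {0..}).
        emeasure (PP \<nu>) {X \<in> A. path_shift s X \<in> B} = (\<integral>\<^sup>+X\<in>A. emeasure (PP (X s)) B \<partial>PP \<nu>)) \<and>
     (\<forall>f \<phi>. bounded_nonneg_measurable E f \<longrightarrow> bounded_nonneg_measurable E \<phi> \<longrightarrow>
        (\<exists>u. log_laplace_solution E P \<alpha> \<beta> f \<phi> u \<and>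
             (\<forall>w. log_laplace_solution E P \<alpha> \<beta> f \<phi> w \<longrightarrow> (\<forall>t\<ge>0. \<forall>x\<in>E. w t x = u t x)) \<and>
             (\<forall>\<nu>\<in>finite_measures E. \<forall>t\<ge>0.
                (\<integral>X. exp (- (\<integral>y. f y \<partial>X t) - (\<integral>s\<in>{0..t}. (\<integral>y. \<phi> y \<partial>X s) \<partial>lborel)) \<partial>PP \<nu>) =
                exp (- (\<integral>x. u t x \<partial>\<nu>)))))"

text \<open>Countable sums of Dirac masses \<open>\<Sum>\<^sub>j \<delta>(z\<^sub>j)\<close> on the space of \<open>m\<close>.\<close>

definition point_measures :: "'b measure \<Rightarrow> 'b measure set" where
  "point_measures m = {distr (count_space J) m z | (J :: nat set) z. z \<in> J \<rightarrow> space m}"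

text \<open>\<open>Q\<close> is the law of a Poisson point measure with intensity \<open>m\<close>.\<close>

definition poisson_law :: "'b measure \<Rightarrow> 'b measure measure \<Rightarrow> bool" where
  "poisson_law m Q \<longleftrightarrow> prob_space Q \<and> space Q = point_measures m \<and>
     sets Q = sets (sigma (point_measures m)
       {{\<eta> \<in> point_measures m. emeasure \<eta> A \<in> C} | A C. A \<in> sets m \<and> C \<in> sets borel}) \<and>
     (\<forall>A\<in>sets m. emeasure m A < \<infinity> \<longrightarrow>
        (\<forall>k. measure Q {\<eta> \<in> space Q. emeasure \<eta> A = of_nat k} =
             measure m A ^ k / fact k * exp (- measure m A))) \<and>
     (\<forall>(I :: nat set) A. finite I \<longrightarrow> A ` I \<subseteq> sets m \<longrightarrow> disjoint_family_on A I \<longrightarrow>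
        prob_space.indep_vars Q (\<lambda>_. borel) (\<lambda>i \<eta>. emeasure \<eta> (A i)) I)"

definition canonical_intensity ::
  "'a::topological_space set \<Rightarrow> ('a \<Rightarrow> 'a measure path measure) \<Rightarrow> 'a measure \<Rightarrow>
   ('a \<times> 'a measure path) measure" where
  "canonical_intensity E N \<nu> = measure_of (E \<times> super_paths E)
     (sets (borel_on E \<Otimes>\<^sub>M super_algebra E {0..}))
     (\<lambda>A. \<integral>\<^sup>+x. emeasure (N x) (Pair x -` A) \<partial>\<nu>)"

text \<open>The superposition \<open>\<Sum>\<^sub>j X\<^sup>j\<close> is compared with \<open>PP \<nu>\<close> through the joint law of the masses of all
  Borel sets at all times \<open>t > 0\<close>: \<open>\<Sum>\<^sub>j X\<^sup>j\<^sub>t(B)\<close> is the integral of \<open>X\<^sub>t(B)\<close> against the point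
  measure. Time \<open>0\<close> has to be left out: the canonical measures are carried by paths started from
  the zero measure, whereas \<open>X\<^sub>0 = \<nu>\<close> under \<open>PP \<nu>\<close>, and a deterministic \<open>\<nu> \<noteq> 0\<close> is never
  a Poissonian sum. The law \<open>Q\<close> is determined by its intensity.\<close>

definition canonical_measures ::
  "'a::topological_space set \<Rightarrow> ('a measure \<Rightarrow> 'a measure path measure) \<Rightarrow>
   ('a \<Rightarrow> 'a measure path measure) \<Rightarrow> bool" where
  "canonical_measures E PP N \<longleftrightarrow>
     (\<forall>x\<in>E. sets (N x) = sets (super_algebra E {0..}) \<and> sigma_finite_measure (N x)) \<and>
     (\<forall>A\<in>sets (super_algebra E {0..}). (\<lambda>x. emeasure (N x) A) \<in> borel_measurable (borel_on E)) \<and>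
     (\<forall>\<nu>\<in>finite_measures E. \<exists>Q. poisson_law (canonical_intensity E N \<nu>) Q \<and>
        distr Q (PiM ({0<..} \<times> sets (borel_on E)) (\<lambda>_. borel :: ennreal measure))
          (\<lambda>\<eta>. \<lambda>(t, B)\<in>{0<..} \<times> sets (borel_on E). \<integral>\<^sup>+p. emeasure (snd p t) B \<partial>\<eta>) =
        distr (PP \<nu>) (PiM ({0<..} \<times> sets (borel_on E)) (\<lambda>_. borel :: ennreal measure))
          (\<lambda>X. \<lambda>(t, B)\<in>{0<..} \<times> sets (borel_on E). emeasure (X t) B))"

definition H_max :: "'a::topological_space set \<Rightarrow> 'a measure path \<Rightarrow> ereal" where
  "H_max E X = Inf {ereal t | t. 0 < t \<and> X t = null_measure (borel_on E)}"

definition vfun :: "'a::topological_space set \<Rightarrow> ('a \<Rightarrow> 'a measure path measure) \<Rightarrow> real \<Rightarrow> 'a \<Rightarrow> real" where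
  "vfun E N t x = measure (N x) {X \<in> space (N x). ereal t < H_max E X}"

section \<open>Generalized eigenvalue and changes of measure\<close>

definition gen_eigenvalue ::
  "'a::topological_space set \<Rightarrow> ('a \<Rightarrow> 'a path measure) \<Rightarrow> ('a \<Rightarrow> real) \<Rightarrow> ereal" where
  "gen_eigenvalue E P \<beta> = Sup (ereal ` {l. \<exists>u\<in>gen_dom E P. (\<forall>x\<in>E. 0 < u x) \<and>
     (\<forall>x\<in>E. \<beta> x * u x - gen E P u x = l * u x)})"

text \<open>Positive harmonic functions of \<open>q - L\<close>.\<close>

definition positive_harmonic ::
  "'a::topological_space set \<Rightarrow> ('a \<Rightarrow> 'a path measure) \<Rightarrow> ('a \<Rightarrow> real) \<Rightarrow> ('a \<Rightarrow> real) \<Rightarrow> bool" where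
  "positive_harmonic E P q u \<longleftrightarrow> u \<in> gen_dom E P \<and> (\<forall>x\<in>E. 0 < u x) \<and>
     (\<forall>x\<in>E. q x * u x - gen E P u x = 0)"

text \<open>\<open>Z = dQ/dP\<close> on the \<open>\<sigma>\<close>-field \<open>F\<close>.\<close>

definition has_density_on :: "'w measure \<Rightarrow> 'w measure \<Rightarrow> 'w measure \<Rightarrow> ('w \<Rightarrow> real) \<Rightarrow> bool" where
  "has_density_on F P Q Z \<longleftrightarrow> Z \<in> borel_measurable F \<and> (AE \<omega> in P. 0 \<le> Z \<omega>) \<and>
     (\<forall>A\<in>sets F. emeasure Q A = (\<integral>\<^sup>+\<omega>\<in>A. ennreal (Z \<omega>) \<partial>P))"

definition locally_abs_continuous ::
  "'a::topological_space set \<Rightarrow> ('a \<Rightarrow> 'a path measure) \<Rightarrow> ('a \<Rightarrow> 'a path measure) \<Rightarrow>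
   ('a \<Rightarrow> real \<Rightarrow> 'a path \<Rightarrow> real) \<Rightarrow> bool" where
  "locally_abs_continuous E P Q Z \<longleftrightarrow>
     (\<forall>x\<in>E. prob_space (Q x) \<and> sets (Q x) = sets (path_space E {0..}) \<and>
        (\<forall>t\<ge>0. has_density_on (filt E (ennreal t)) (P x) (Q x) (Z x t)))"

definition beta_tilde ::
  "'a::topological_space set \<Rightarrow> ('a \<Rightarrow> 'a path measure) \<Rightarrow> ('a \<Rightarrow> real) \<Rightarrow> ('a \<Rightarrow> real) \<Rightarrow> 'a \<Rightarrow> real" where
  "beta_tilde E P \<alpha> \<beta> x = \<beta> x - \<alpha> x * gen E P (\<lambda>y. 1 / \<alpha> y) x"

definition tilde_density ::
  "'a::topological_space set \<Rightarrow> ('a \<Rightarrow> 'a path measure) \<Rightarrow> ('a \<Rightarrow> real) \<Rightarrow> ('a \<Rightarrow> real) \<Rightarrow>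
   'a \<Rightarrow> real \<Rightarrow> 'a path \<Rightarrow> real" where
  "tilde_density E P \<alpha> \<beta> x t \<omega> =
     \<alpha> x / \<alpha> (\<omega> t) * exp (\<integral>s\<in>{0..t}. (beta_tilde E P \<alpha> \<beta> (\<omega> s) - \<beta> (\<omega> s)) \<partial>lborel)"

definition phi_density :: "('a \<Rightarrow> real) \<Rightarrow> real \<Rightarrow> ('a \<Rightarrow> real) \<Rightarrow> 'a \<Rightarrow> real \<Rightarrow> 'a path \<Rightarrow> real" where
  "phi_density \<beta> l0 \<phi>0 x t \<omega> =
     \<phi>0 (\<omega> t) / \<phi>0 (\<omega> 0) * exp (- (\<integral>s\<in>{0..t}. (\<beta> (\<omega> s) - l0) \<partial>lborel))"

definition stationary_measure ::
  "'a::topological_space set \<Rightarrow> ('a \<Rightarrow> 'a path measure) \<Rightarrow> 'a measure \<Rightarrow> bool" where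
  "stationary_measure E Q \<pi> \<longleftrightarrow> prob_space \<pi> \<and> sets \<pi> = sets (borel_on E) \<and>
     (\<forall>t\<ge>0. \<forall>A\<in>sets (borel_on E).
        (\<integral>\<^sup>+x. emeasure (Q x) {\<omega> \<in> space (Q x). \<omega> t \<in> A} \<partial>\<pi>) = emeasure \<pi> A)"

definition tv_ergodic ::
  "'a::topological_space set \<Rightarrow> ('a \<Rightarrow> 'a path measure) \<Rightarrow> 'a measure \<Rightarrow> bool" where
  "tv_ergodic E Q \<pi> \<longleftrightarrow> (\<forall>x\<in>E. ((\<lambda>t.
     SUP f\<in>{f \<in> borel_measurable (borel_on E). \<forall>y\<in>E. \<bar>f y\<bar> \<le> (1::real)}.
       \<bar>(\<integral>\<omega>. f (\<omega> t) \<partial>Q x) - (\<integral>y. f y \<partial>\<pi>)\<bar>) \<longlongrightarrow> 0) at_top)"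

definition stationary_version ::
  "'a::topological_space set \<Rightarrow> ('a \<Rightarrow> 'a path measure) \<Rightarrow> 'a measure \<Rightarrow> 'a path measure \<Rightarrow> bool" where
  "stationary_version E Q \<pi> R \<longleftrightarrow> prob_space R \<and> sets R = sets (path_space E UNIV) \<and>
     (\<forall>s. distr R (path_space E {0..}) (path_shift s) = \<pi> \<bind> Q)"

section \<open>Spine laws\<close>

definition spine_density ::
  "('a \<Rightarrow> real) \<Rightarrow> ('a \<Rightarrow> real) \<Rightarrow> (real \<Rightarrow> 'a \<Rightarrow> real) \<Rightarrow> real \<Rightarrow> 'a \<Rightarrow> real \<Rightarrow> 'a path \<Rightarrow> real" where
  "spine_density \<alpha> \<beta> v h x t \<omega> =
     deriv (\<lambda>r. v r (\<omega> t)) (h - t) / deriv (\<lambda>r. v r x) h *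
     exp (- (\<integral>s\<in>{0..t}. deriv (psi \<alpha> \<beta> (\<omega> s)) (v (h - s) (\<omega> s)) \<partial>lborel))"

text \<open>\<open>S\<close> is the law \<open>P\<^sub>x\<^sup>(\<^sup>h\<^sup>)\<close>, a probability measure on the \<open>\<sigma>\<close>-field \<open>D\<^sub>h\<close>.\<close>

definition spine_law ::
  "'a::topological_space set \<Rightarrow> ('a \<Rightarrow> 'a path measure) \<Rightarrow> ('a \<Rightarrow> real) \<Rightarrow> ('a \<Rightarrow> real) \<Rightarrow>
   (real \<Rightarrow> 'a \<Rightarrow> real) \<Rightarrow> real \<Rightarrow> 'a \<Rightarrow> 'a path measure \<Rightarrow> bool" where
  "spine_law E P \<alpha> \<beta> v h x S \<longleftrightarrow> prob_space S \<and> sets S = sets (filt E (ennreal h)) \<and>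
     (\<forall>t. 0 \<le> t \<and> t < h \<longrightarrow>
        has_density_on (filt E (ennreal t)) (P x) S (spine_density \<alpha> \<beta> v h x t)) \<and>
     (\<exists>M. (AE \<omega> in P x. ((\<lambda>t. spine_density \<alpha> \<beta> v h x t \<omega>) \<longlongrightarrow> M \<omega>) (at_left h)) \<and>
          has_density_on (filt E (ennreal h)) (P x) S M)"

definition reversed_spine :: "'a::topological_space set \<Rightarrow> real \<Rightarrow> 'a path measure \<Rightarrow> 'a path measure" where
  "reversed_spine E h S = distr S (path_space E {-h..0}) (\<lambda>\<omega>. \<lambda>s\<in>{-h..0}. \<omega> (h + s))"

text \<open>The restriction to \<open>T\<close> of the law \<open>R\<close> on \<open>D(\<real>, E)\<close> reweighted by \<open>L\<close>.\<close>

definition weighted_law ::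
  "'a::topological_space set \<Rightarrow> real set \<Rightarrow> 'a path measure \<Rightarrow> ('a path \<Rightarrow> real) \<Rightarrow> 'a path measure" where
  "weighted_law E T R L =
     distr (density R (\<lambda>\<omega>. ennreal (L \<omega>))) (path_space E T) (\<lambda>\<omega>. restrict \<omega> T)"

definition spine_RN_derivative ::
  "'a::topological_space set \<Rightarrow> 'a path measure \<Rightarrow> real \<Rightarrow> 'a path measure \<Rightarrow> ('a path \<Rightarrow> real) \<Rightarrow> bool" where
  "spine_RN_derivative E R h S L \<longleftrightarrow>
     L \<in> borel_measurable (coord_algebra E UNIV {-h..0}) \<and> (AE \<omega> in R. 0 \<le> L \<omega>) \<and>
     weighted_law E {-h..0} R L = S"

text \<open>\<open>Linf\<close> is the almost sure and \<open>L\<^sup>1\<close> limit of the Radon-Nikodym derivatives of \<open>S h\<close>. Each of these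
  is only determined up to a null set, so the almost sure limit along real \<open>h\<close> refers to suitable
  versions; the \<open>L\<^sup>1\<close> limit does not depend on them.\<close>

definition spine_limit_density ::
  "'a::topological_space set \<Rightarrow> 'a path measure \<Rightarrow> (real \<Rightarrow> 'a path measure) \<Rightarrow> ('a path \<Rightarrow> real) \<Rightarrow> bool" where
  "spine_limit_density E R S Linf \<longleftrightarrow> Linf \<in> borel_measurable (coord_algebra E UNIV {..0}) \<and>
     (\<exists>L. (\<forall>h>0. spine_RN_derivative E R h (S h) (L h)) \<and>
          (AE \<omega> in R. ((\<lambda>h. L h \<omega>) \<longlongrightarrow> Linf \<omega>) at_top) \<and>
          ((\<lambda>h. \<integral>\<^sup>+\<omega>. ennreal \<bar>L h \<omega> - Linf \<omega>\<bar> \<partial>R) \<longlongrightarrow> 0) at_top)"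

end

theory Submission
  imports Defs
begin

text \<open>Fix a functional \<open>f\<close> of the path on \<open>[-t, 0]\<close> with values in \<open>[0, 1]\<close> and write \<open>h = r + T\<close> with \<open>T\<close>
  large and \<open>r\<close> tending to infinity. By the Markov property,
  \<open>|\<partial>v\<^sub>h(x)|\<close> times the mean of \<open>f\<close> under the reversed spine law started at \<open>x\<close> with lifetime \<open>h\<close> is the
  \<open>P\<^sub>x\<close>-expectation of \<open>exp (- \<integral>\<^sub>0\<^sup>r (\<beta> + 2\<alpha>v\<^bsub>h-s\<^esub>)(Y\<^sub>s) ds) |\<partial>v\<^sub>T(Y\<^sub>r)| G\<^sub>T(Y\<^sub>r)\<close>, where \<open>G\<^sub>T(y)\<close> is the mean
  of \<open>f\<close> for a spine started at \<open>y\<close> with lifetime \<open>T\<close>. The h-transform by \<open>\<phi>0\<close> turns this into an expectation of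
  \<open>(\<rho>\<^sub>T G\<^sub>T)(Y\<^sub>r)\<close>, \<open>\<rho>\<^sub>T = |\<partial>v\<^sub>T| / \<phi>0\<close>, under the law \<open>P\<close> transformed by \<open>\<phi>0\<close>, up to a factor between
  \<open>exp (- a(T))\<close> and \<open>1\<close>. Here \<open>a(T)\<close> tends to \<open>0\<close> because \<open>v\<^sub>t \<le> C / (exp (\<lambda>\<^sub>0 t) - 1)\<close>, by comparison with a
  supersolution \<open>y(t) \<phi>0\<close>; and \<open>\<rho>\<^sub>T\<close> is bounded because \<open>v\<close> is Lipschitz in time away from \<open>0\<close>, by comparison with a
  supersolution \<open>y(t) / \<alpha>\<close>, for which \<open>1 / \<alpha>\<close> has to lie in the domain of the generator.
  Ergodicity in total variation therefore makes the means of \<open>f\<close> for large \<open>h\<close> agree for all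
  starting points up to an error of order \<open>exp (a(T)) - 1\<close>, and averaging over \<open>\<pi>\<close> identifies
  the common limit through the convergence in mean of the densities.\<close>

section \<open>Path spaces\<close>

text \<open>Two quantities in the factorisation are known only implicitly, and each shapes a part of
  the proof. The function v is the canonical mass of an event about \<open>H_max\<close>, an infimum
  over uncountably many times. It is identified as the limit of log-Laplace solutions with constant
  initial values, for which mild equations can be compared with bounds uniform in the initial value.
  The identification could fail only on paths that come down to zero and revive; these are null
  under the superprocess by its Markov property, and null under the canonical measures because the
  Poissonian superposition carries null events over. The derivative of v at the large time h, which
  multiplies the mean of f, is removed by division: the same identity for the constant 1 has the
  same prefactors. The bound on \<open>\<rho> T\<close> has to be uniform in the state, since total
  variation convergence says nothing about unbounded functions; this is why the Lipschitz estimate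
  in time rests on a supersolution whose final size does not depend on the initial value.\<close>

lemma space_coord_algebra [simp]: "space (coord_algebra E T S) = skorokhod E T"
  unfolding coord_algebra_def by (rule space_measure_of) auto

lemma sets_coord_algebra:
  "sets (coord_algebra E T S) = sigma_sets (skorokhod E T)
     {{\<omega> \<in> skorokhod E T. \<omega> r \<in> A} | r A. r \<in> S \<and> A \<in> sets borel}"
  unfolding coord_algebra_def by (rule sets_measure_of) auto

lemma sets_coord_algebra_mono: "S \<subseteq> S' \<Longrightarrow> sets (coord_algebra E T S) \<subseteq> sets (coord_algebra E T S')"
  unfolding sets_coord_algebra by (rule sigma_sets_mono') auto

lemma space_borel_on [simp]: "space (borel_on E) = E"
  by (simp add: space_restrict_space)

lemma skorokhod_in: "\<omega> \<in> skorokhod E T \<Longrightarrow> t \<in> T \<Longrightarrow> \<omega> t \<in> E"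
  by (auto simp: skorokhod_def)

lemma coord_measurable:
  assumes "r \<in> S" "r \<in> T"
  shows "(\<lambda>\<omega>. \<omega> r) \<in> coord_algebra E T S \<rightarrow>\<^sub>M borel_on E"
proof (rule measurable_restrict_space2)
  show "(\<lambda>\<omega>. \<omega> r) \<in> space (coord_algebra E T S) \<rightarrow> E"
    using assms by (auto intro: skorokhod_in)
  show "(\<lambda>\<omega>. \<omega> r) \<in> coord_algebra E T S \<rightarrow>\<^sub>M borel"
  proof (rule measurableI)
    fix A :: "'a set" assume "A \<in> sets borel"
    then have "{\<omega> \<in> skorokhod E T. \<omega> r \<in> A} \<in> sets (coord_algebra E T S)"
      unfolding sets_coord_algebra using assms by (intro sigma_sets.Basic) auto
    then show "(\<lambda>\<omega>. \<omega> r) -` A \<inter> space (coord_algebra E T S) \<in> sets (coord_algebra E T S)"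
      by (simp add: vimage_def Int_def conj_commute)
  qed auto
qed

lemma measurable_coord_algebraI:
  assumes "g \<in> space M \<rightarrow> skorokhod E T" "\<And>r. r \<in> S \<Longrightarrow> (\<lambda>x. g x r) \<in> M \<rightarrow>\<^sub>M borel"
  shows "g \<in> M \<rightarrow>\<^sub>M coord_algebra E T S"
  unfolding coord_algebra_def
proof (rule measurable_measure_of)
  fix y assume "y \<in> {{\<omega> \<in> skorokhod E T. \<omega> r \<in> A} | r A. r \<in> S \<and> A \<in> sets borel}"
  then obtain r A where y: "y = {\<omega> \<in> skorokhod E T. \<omega> r \<in> A}" "r \<in> S" "A \<in> sets borel" by auto
  have "g -` y \<inter> space M = (\<lambda>x. g x r) -` A \<inter> space M" using assms(1) y by auto
  also have "\<dots> \<in> sets M" using assms(2)[OF y(2)] y(3) by (rule measurable_sets)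
  finally show "g -` y \<inter> space M \<in> sets M" .
qed (use assms in auto)

lemma filt_basics:
  shows space_filt [simp]: "space (filt E t) = skorokhod E {0..}"
    and sets_filt: "sets (filt E t) = sigma_sets (skorokhod E {0..})
     (sets (path_space E {0..}) \<inter> (\<Inter>s\<in>{s. t < ennreal s}. sets (coord_algebra E {0..} {0..s})))"
  unfolding filt_def using sets.space_closed[of "path_space E {0..}"]
  by (auto intro!: space_measure_of sets_measure_of)

lemma sets_filt_subset: "sets (filt E t) \<subseteq> sets (path_space E {0..})"
  unfolding sets_filt using sets.sigma_sets_subset[of _ "path_space E {0..}"] by simp

lemma coord_algebra_subset_filt: "sets (coord_algebra E {0..} {0..t}) \<subseteq> sets (filt E (ennreal t))"
proof
  fix A assume A: "A \<in> sets (coord_algebra E {0..} {0..t})"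
  have "A \<in> sets (coord_algebra E {0..} {0..s})" if "ennreal t < ennreal s" for s
  proof -
    have "t < s" using that ennreal_leI[of s t] by (cases "s \<le> t") auto
    then show ?thesis using A sets_coord_algebra_mono[of "{0..t}" "{0..s}" E "{0..}"] by auto
  qed
  moreover have "A \<in> sets (path_space E {0..})"
    using A sets_coord_algebra_mono[of "{0..t}" "{0..}" E "{0..}"] by auto
  ultimately show "A \<in> sets (filt E (ennreal t))" unfolding sets_filt by (intro sigma_sets.Basic) auto
qed

lemma sets_filt_mono: "s \<le> t \<Longrightarrow> sets (filt E s) \<subseteq> sets (filt E t)"
  unfolding sets_filt by (intro sigma_sets_mono') auto

lemma filtration_filt: "filtration (skorokhod E {0..}) (filt E)"
  by unfold_locales (auto dest: subsetD[OF sets_filt_mono])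

lemma measurable_filt_path:
  "f \<in> filt E t \<rightarrow>\<^sub>M N \<Longrightarrow> f \<in> path_space E {0..} \<rightarrow>\<^sub>M N"
  using sets_filt_subset[of E t] by (auto simp: measurable_def)

lemma measurable_coord_filt:
  "f \<in> coord_algebra E {0..} {0..t} \<rightarrow>\<^sub>M N \<Longrightarrow> f \<in> filt E (ennreal t) \<rightarrow>\<^sub>M N"
  using coord_algebra_subset_filt[of E t] by (auto simp: measurable_def)

lemma subalgebra_filt: "sets M = sets (path_space E {0..}) \<Longrightarrow> subalgebra M (filt E t)"
  using sets_filt_subset[of E t] sets_eq_imp_space_eq[of M] by (auto simp: subalgebra_def)

lemma skorokhod_right_LIMSEQ:
  assumes "\<omega> \<in> skorokhod E T" "t \<in> T" "\<And>n. q n \<in> T" "\<And>n. t \<le> q n" "q \<longlonglongrightarrow> t"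
  shows "(\<lambda>n. \<omega> (q n)) \<longlonglongrightarrow> \<omega> t"
proof -
  have "continuous (at t within T \<inter> {t..}) \<omega>"
    using assms by (auto simp: skorokhod_def continuous_within)
  then show ?thesis
    unfolding continuous_within_sequentially comp_def using assms by auto
qed

text \<open>Right-continuity makes the value at a random time the limit of values at times from a
  countable grid to its right, and evaluation at a fixed grid time is measurable. Joint
  measurability of path and time is the case of a product space M.\<close>

lemma measurable_path_eval:
  fixes E :: "'a::metric_space set"
  assumes X: "X \<in> M \<rightarrow>\<^sub>M path_space E {0..}" and g: "g \<in> borel_measurable M"
    and g0: "\<And>x. x \<in> space M \<Longrightarrow> 0 \<le> g x"
  shows "(\<lambda>x. X x (g x)) \<in> M \<rightarrow>\<^sub>M borel_on E"
proof (rule measurable_restrict_space2)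
  show "(\<lambda>x. X x (g x)) \<in> space M \<rightarrow> E"
    using g0 measurable_space[OF X] by (auto intro!: skorokhod_in[of _ E "{0..}"])
  \<comment> \<open>The next grid point strictly to the right of s at mesh 1 / (n + 1); rounding
    down would approach s from the side where only left limits exist.\<close>
  define p where "p n s = real (nat \<lfloor>real (Suc n) * s\<rfloor> + 1) / real (Suc n)" for n s
  show "(\<lambda>x. X x (g x)) \<in> M \<rightarrow>\<^sub>M borel"
  proof (rule borel_measurable_LIMSEQ_metric)
    fix n
    have 1: "(\<lambda>x. X x (real (k + 1) / real (Suc n))) \<in> M \<rightarrow>\<^sub>M borel" for k :: nat
      using measurable_compose[OF X coord_measurable[of "real (k + 1) / real (Suc n)" "{0..}" "{0..}" E]]
      by (auto simp: measurable_restrict_space2_iff)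
    have 2: "(\<lambda>x. nat \<lfloor>real (Suc n) * g x\<rfloor>) \<in> M \<rightarrow>\<^sub>M count_space UNIV"
      using g by measurable
    show "(\<lambda>x. X x (p n (g x))) \<in> M \<rightarrow>\<^sub>M borel"
      unfolding p_def by (rule measurable_compose_countable[OF 1 2])
  next
    fix x assume x: "x \<in> space M"
    define s where "s = g x"
    have s: "s \<ge> 0" using g0[OF x] by (simp add: s_def)
    have p: "s \<le> p n s" "p n s \<le> s + 1 / real (Suc n)" for n
    proof -
      have "0 \<le> real (Suc n) * s" using s by simp
      then have *: "real (nat \<lfloor>real (Suc n) * s\<rfloor> + 1) = of_int \<lfloor>real (Suc n) * s\<rfloor> + 1"
        by simp
      have "real (Suc n) * s \<le> of_int \<lfloor>real (Suc n) * s\<rfloor> + 1" by linarith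
      then show "s \<le> p n s" unfolding p_def * by (simp add: field_simps)
      have "p n s \<le> (real (Suc n) * s + 1) / real (Suc n)"
        unfolding p_def * by (intro divide_right_mono) linarith+
      also have "\<dots> = s + 1 / real (Suc n)" by (simp add: add_divide_distrib)
      finally show "p n s \<le> s + 1 / real (Suc n)" .
    qed
    have "(\<lambda>n. s + 1 / real (Suc n)) \<longlonglongrightarrow> s + 0"
      by (intro tendsto_intros LIMSEQ_inverse_real_of_nat[unfolded inverse_eq_divide])
    then have "(\<lambda>n. p n s) \<longlonglongrightarrow> s"
      using p by (intro tendsto_sandwich[of "\<lambda>_. s" "\<lambda>n. p n s" sequentially "\<lambda>n. s + 1 / real (Suc n)" s]) auto
    then have "(\<lambda>n. X x (p n s)) \<longlonglongrightarrow> X x s"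
      using measurable_space[OF X x] s p(1)
      by (intro skorokhod_right_LIMSEQ[of _ E "{0..}"]) (auto intro: order_trans)
    then show "(\<lambda>n. X x (p n (g x))) \<longlonglongrightarrow> X x (g x)" unfolding s_def .
  qed
qed

text \<open>Stated for an arbitrary target interval so that one argument serves the time shift, the
  restriction to a subinterval (s = 0) and the window of the reversed spine that ends at time
  0.\<close>

lemma skorokhod_shift:
  assumes \<omega>: "\<omega> \<in> skorokhod E T" and T': "\<And>r. r \<in> T' \<Longrightarrow> s + r \<in> T"
  shows "(\<lambda>r\<in>T'. \<omega> (s + r)) \<in> skorokhod E T'"
proof -
  let ?\<eta> = "\<lambda>r\<in>T'. \<omega> (s + r)"
  have tr: "(?\<eta> \<longlongrightarrow> l) (at r within T' \<inter> B)"
    if r: "r \<in> T'" and l: "(\<omega> \<longlongrightarrow> l) (at (s + r) within T \<inter> A)" and AB: "\<And>x. x \<in> B \<Longrightarrow> s + x \<in> A" for r l A B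
  proof -
    have "((\<lambda>x. s + x) \<longlongrightarrow> s + r) (at r within T' \<inter> B)" by (intro tendsto_intros)
    moreover have "\<forall>\<^sub>F x in at r within T' \<inter> B. s + x \<in> T \<inter> A \<and> s + x \<noteq> s + r"
      using AB T' by (auto simp: eventually_at_filter)
    ultimately have "filterlim (\<lambda>x. s + x) (at (s + r) within T \<inter> A) (at r within T' \<inter> B)"
      by (auto simp: filterlim_at)
    from filterlim_compose[OF l this]
    show ?thesis
      by (rule Lim_transform_eventually) (auto simp: eventually_at_filter)
  qed
  show ?thesis
    unfolding skorokhod_def
  proof (intro CollectI conjI ballI)
    fix r assume r: "r \<in> T'"
    have sr: "s + r \<in> T" using T'[OF r] .
    show "?\<eta> r \<in> E" using r sr \<omega> by (auto simp: skorokhod_def)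
    have "(\<omega> \<longlongrightarrow> \<omega> (s + r)) (at (s + r) within T \<inter> {s + r..})"
      using \<omega> sr by (auto simp: skorokhod_def)
    from tr[OF r this, of "{r..}"] show "(?\<eta> \<longlongrightarrow> ?\<eta> r) (at r within T' \<inter> {r..})" using r by auto
    obtain l where l: "l \<in> E" "(\<omega> \<longlongrightarrow> l) (at (s + r) within T \<inter> {..<s + r})"
      using \<omega> sr by (auto simp: skorokhod_def)
    from tr[OF r l(2), of "{..<r}"] l(1) show "\<exists>l\<in>E. (?\<eta> \<longlongrightarrow> l) (at r within T' \<inter> {..<r})" by auto
  qed simp
qed

lemma skorokhod_restrict:
  assumes "\<omega> \<in> skorokhod E T" "T' \<subseteq> T"
  shows "restrict \<omega> T' \<in> skorokhod E T'"
  using skorokhod_shift[of \<omega> E T T' 0] assms by (auto simp: subset_eq restrict_def)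

lemma measurable_path_shift_upto:
  assumes "s \<ge> 0" "S' \<subseteq> {0..}" "(\<lambda>r. s + r) ` S' \<subseteq> S" "S \<subseteq> {0..}"
  shows "path_shift s \<in> coord_algebra E {0..} S \<rightarrow>\<^sub>M coord_algebra E {0..} S'"
proof (rule measurable_coord_algebraI)
  show "path_shift s \<in> space (coord_algebra E {0..} S) \<rightarrow> skorokhod E {0..}"
    using assms by (auto simp: path_shift_def intro!: skorokhod_shift)
  fix r assume r: "r \<in> S'"
  have "(\<lambda>\<omega>. \<omega> (s + r)) \<in> coord_algebra E {0..} S \<rightarrow>\<^sub>M borel_on E"
    using assms r by (intro coord_measurable) auto
  moreover have "r \<ge> 0" using r assms by auto
  ultimately show "(\<lambda>\<omega>. path_shift s \<omega> r) \<in> coord_algebra E {0..} S \<rightarrow>\<^sub>M borel"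
    by (simp add: path_shift_def measurable_restrict_space2_iff)
qed

lemma measurable_path_shift:
  "s \<ge> 0 \<Longrightarrow> path_shift s \<in> path_space E {0..} \<rightarrow>\<^sub>M path_space E {0..}"
  by (rule measurable_path_shift_upto) auto

lemma measurable_restrict_path:
  assumes "T' \<subseteq> T" "S' \<subseteq> S" "S' \<subseteq> T'"
  shows "(\<lambda>\<omega>. restrict \<omega> T') \<in> coord_algebra E T S \<rightarrow>\<^sub>M coord_algebra E T' S'"
proof (rule measurable_coord_algebraI)
  show "(\<lambda>\<omega>. restrict \<omega> T') \<in> space (coord_algebra E T S) \<rightarrow> skorokhod E T'"
    using assms by (auto intro!: skorokhod_restrict)
  fix r assume r: "r \<in> S'"
  have "(\<lambda>\<omega>. \<omega> r) \<in> coord_algebra E T S \<rightarrow>\<^sub>M borel_on E"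
    using assms r by (intro coord_measurable) auto
  then show "(\<lambda>\<omega>. restrict \<omega> T' r) \<in> coord_algebra E T S \<rightarrow>\<^sub>M borel"
    using assms r by (auto simp: measurable_restrict_space2_iff subset_eq)
qed

section \<open>The transition semigroup\<close>

text \<open>The parameter is carried along by pushing \<open>L x\<close> forward under
  \<open>y \<mapsto> (x, y)\<close>; afterwards the integrand on the product is fixed and only the
  measure varies with x.\<close>

lemma integral_measurable_kernel:
  fixes f :: "'b \<Rightarrow> 'c \<Rightarrow> real"
  assumes f[measurable]: "(\<lambda>(x, y). f x y) \<in> borel_measurable (M \<Otimes>\<^sub>M N)"
  assumes [measurable]: "L \<in> measurable M (subprob_algebra N)"
  shows "(\<lambda>x. \<integral>y. f x y \<partial>L x) \<in> borel_measurable M"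
proof -
  note integral_measurable_subprob_algebra[measurable]
  note measurable_distr2[measurable]
  have "(\<lambda>x. integral\<^sup>L (distr (L x) (M \<Otimes>\<^sub>M N) (\<lambda>y. (x, y))) (\<lambda>(x, y). f x y)) \<in> borel_measurable M"
    by measurable
  then show ?thesis
    by (rule measurable_cong[THEN iffD1, rotated]) (simp add: integral_distr)
qed

lemma integrable_bounded:
  fixes f :: "'b \<Rightarrow> real"
  assumes "finite_measure M" "f \<in> borel_measurable M" "\<And>x. x \<in> space M \<Longrightarrow> \<bar>f x\<bar> \<le> B"
  shows "integrable M f"
  using assms by (intro finite_measure.integrable_const_bound[where B = B]) auto

lemma Fubini_bounded:
  fixes f :: "'b \<Rightarrow> 'c \<Rightarrow> real"
  assumes M: "finite_measure M" "finite_measure N"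
    and f: "(\<lambda>(x, y). f x y) \<in> borel_measurable (M \<Otimes>\<^sub>M N)"
    and B: "\<And>x y. x \<in> space M \<Longrightarrow> y \<in> space N \<Longrightarrow> \<bar>f x y\<bar> \<le> B"
  shows "(\<integral>x. (\<integral>y. f x y \<partial>N) \<partial>M) = (\<integral>y. (\<integral>x. f x y \<partial>M) \<partial>N)"
proof -
  interpret M: finite_measure M by fact
  interpret N: finite_measure N by fact
  interpret pair_sigma_finite M N ..
  have "finite_measure (M \<Otimes>\<^sub>M N)"
    by (rule finite_measureI)
       (simp add: space_pair_measure N.emeasure_pair_measure_Times ennreal_mult_eq_top_iff)
  then have "integrable (M \<Otimes>\<^sub>M N) (\<lambda>(x, y). f x y)"
    by (rule integrable_bounded[where B = B]) (use f B in \<open>auto simp: space_pair_measure\<close>)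
  then show ?thesis by (simp add: Fubini_integral)
qed

section \<open>Integrals over initial time intervals\<close>

abbreviation leb :: "real \<Rightarrow> real measure" where
  "leb t \<equiv> restrict_space lborel {0..t}"

lemma space_leb [simp]: "space (leb t) = {0..t}"
  by (simp add: space_restrict_space)

lemma finite_leb: "finite_measure (leb t)"
  by (rule finite_measureI) (simp add: emeasure_restrict_space emeasure_lborel_Icc_eq)

lemma integral_leb: "(\<integral>s. f s \<partial>leb t) = (\<integral>s. indicator {0..t} s * (f s :: real) \<partial>lborel)"
  by (subst integral_restrict_space) auto

lemma integral_leb_set: "(\<integral>s. f s \<partial>leb t) = (LINT s:{0..t}|lborel. (f s :: real))"
  by (simp add: integral_leb set_lebesgue_integral_def)

lemma integral_leb_const [simp]: "t \<ge> 0 \<Longrightarrow> (\<integral>s. (c::real) \<partial>leb t) = c * t"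
  by (simp add: measure_restrict_space)

lemma integral_leb_FTC:
  assumes "t \<ge> 0" "\<And>s. 0 \<le> s \<Longrightarrow> s \<le> t \<Longrightarrow> (F has_real_derivative f s) (at s)"
    "\<And>s. 0 \<le> s \<Longrightarrow> s \<le> t \<Longrightarrow> isCont f s"
  shows "(\<integral>s. f s \<partial>leb t) = F t - F 0"
  using integral_FTC_Icc_real[of 0 t F f] assms by (simp add: integral_leb mult.commute)

lemma integral_leb_split:
  fixes f :: "real \<Rightarrow> real"
  assumes st: "0 \<le> s" "s \<le> t" and f: "integrable (leb t) f"
  shows "(\<integral>r. f r \<partial>leb t) = (\<integral>r. f r \<partial>leb s) + (\<integral>r. f (s + r) \<partial>leb (t - s))"
    and "integrable (leb s) f" and "integrable (leb (t - s)) (\<lambda>r. f (s + r))"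
proof -
  have i: "integrable lborel (\<lambda>r. indicator {0..t} r * f r)"
    using f by (subst (asm) integrable_restrict_space) auto
  have "(\<lambda>r. indicator {0..s} r *\<^sub>R (indicator {0..t} r * f r)) = (\<lambda>r. indicator {0..s} r * f r)"
    using st by (auto simp: indicator_def fun_eq_iff)
  then have i1: "integrable lborel (\<lambda>r. indicator {0..s} r * f r)"
    using integrable_mult_indicator[OF _ i, of "{0..s}"] by simp
  then show "integrable (leb s) f" by (subst integrable_restrict_space) auto
  have "(\<lambda>r. indicator {s..t} r *\<^sub>R (indicator {0..t} r * f r)) = (\<lambda>r. indicator {s..t} r * f r)"
    using st by (auto simp: indicator_def fun_eq_iff)
  then have i2: "integrable lborel (\<lambda>r. indicator {s..t} r * f r)"
    using integrable_mult_indicator[OF _ i, of "{s..t}"] by simp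
  from lborel_integrable_real_affine[OF i2, of 1 s]
  have i3: "integrable lborel (\<lambda>r. indicator {0..t - s} r * f (s + r))"
    by (rule Bochner_Integration.integrable_cong[THEN iffD1, OF refl, rotated]) (auto simp: indicator_def)
  then show "integrable (leb (t - s)) (\<lambda>r. f (s + r))" by (subst integrable_restrict_space) auto
  \<comment> \<open>The two closed intervals share the point s, so their indicators add up only
    almost everywhere.\<close>
  have "(\<integral>r. indicator {0..t} r * f r \<partial>lborel) =
      (\<integral>r. indicator {0..s} r * f r + indicator {s..t} r * f r \<partial>lborel)"
    by (rule integral_cong_AE)
       (use i i1 i2 st AE_lborel_singleton[of s] in \<open>auto simp: indicator_def elim!: eventually_mono\<close>)
  also have "\<dots> = (\<integral>r. indicator {0..s} r * f r \<partial>lborel) + (\<integral>r. indicator {s..t} r * f r \<partial>lborel)"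
    by (rule Bochner_Integration.integral_add[OF i1 i2])
  also have "(\<integral>r. indicator {s..t} r * f r \<partial>lborel) = (\<integral>r. indicator {s..t} (s + r) * f (s + r) \<partial>lborel)"
    using lborel_integral_real_affine[of 1 "\<lambda>r. indicator {s..t} r * f r" s] by simp
  also have "\<dots> = (\<integral>r. indicator {0..t - s} r * f (s + r) \<partial>lborel)"
    by (rule Bochner_Integration.integral_cong) (auto simp: indicator_def)
  finally show "(\<integral>r. f r \<partial>leb t) = (\<integral>r. f r \<partial>leb s) + (\<integral>r. f (s + r) \<partial>leb (t - s))"
    by (simp add: integral_leb)
qed

lemma integral_leb_reflect:
  "(\<integral>r. f (t - r) \<partial>leb t) = (\<integral>r. (f r :: real) \<partial>leb t)"
proof -
  have "(\<integral>r. indicator {0..t} r * f r \<partial>lborel) = (\<integral>r. indicator {0..t} (t - r) * f (t - r) \<partial>lborel)"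
    using lborel_integral_real_affine[of "-1" "\<lambda>r. indicator {0..t} r * f r" t] by simp
  also have "\<dots> = (\<integral>r. indicator {0..t} r * f (t - r) \<partial>lborel)"
    by (rule Bochner_Integration.integral_cong) (auto simp: indicator_def)
  finally show ?thesis by (simp add: integral_leb)
qed

text \<open>Fubini on the triangle 0 \<le> r \<le> s \<le> t: for fixed r the integral of
  \<open>k' (t - s)\<close> over s from r to t is evaluated by the fundamental theorem. This is an
  integration by parts in which the primitive of \<Phi> is never differentiated, so \<Phi> may be
  merely bounded and measurable.\<close>

lemma integral_leb_triangle:
  fixes \<Phi> k k' :: "real \<Rightarrow> real"
  assumes t: "t \<ge> 0" and \<Phi>: "\<Phi> \<in> borel_measurable (leb t)" "\<And>s. 0 \<le> s \<Longrightarrow> s \<le> t \<Longrightarrow> \<bar>\<Phi> s\<bar> \<le> B"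
    and k: "\<And>s. 0 \<le> s \<Longrightarrow> s \<le> t \<Longrightarrow> (k has_real_derivative k' s) (at s)" and k': "continuous_on UNIV k'"
  shows "(\<integral>s. k' (t - s) * (\<integral>r. \<Phi> r \<partial>leb s) \<partial>leb t) = (\<integral>r. \<Phi> r * (k (t - r) - k 0) \<partial>leb t)"
proof -
  have [measurable]: "k' \<in> borel_measurable borel" using k' by (rule borel_measurable_continuous_onI)
  have [measurable]: "(\<lambda>r. indicator {0..t} r * \<Phi> r) \<in> borel_measurable borel"
    using \<Phi>(1) by (subst (asm) borel_measurable_restrict_space_iff) (auto simp: mult.commute)
  have "bounded (k' ` {0..t})"
    using k' by (intro compact_imp_bounded compact_continuous_image) (auto intro: continuous_on_subset)
  then obtain K where K: "\<And>s. s \<in> {0..t} \<Longrightarrow> \<bar>k' s\<bar> \<le> K"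
    unfolding bounded_iff by (metis imageI real_norm_def)
  have B: "0 \<le> B" using \<Phi>(2)[of 0] t by auto
  have K0: "0 \<le> K" using K[of 0] t by auto
  define F where "F s r = k' (t - s) * (indicator {0..t} r * \<Phi> r) * (if r \<le> s then 1 else 0)" for s r :: real
  have "(\<integral>s. k' (t - s) * (\<integral>r. \<Phi> r \<partial>leb s) \<partial>leb t) = (\<integral>s. (\<integral>r. F s r \<partial>leb t) \<partial>leb t)"
  proof (rule Bochner_Integration.integral_cong)
    fix s assume s: "s \<in> space (leb t)"
    have "k' (t - s) * (\<integral>r. \<Phi> r \<partial>leb s) = (\<integral>r. k' (t - s) * (indicator {0..s} r * \<Phi> r) \<partial>lborel)"
      by (simp add: integral_leb)
    also have "\<dots> = (\<integral>r. indicator {0..t} r * F s r \<partial>lborel)"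
      by (rule Bochner_Integration.integral_cong) (use s in \<open>auto simp: F_def indicator_def\<close>)
    finally show "k' (t - s) * (\<integral>r. \<Phi> r \<partial>leb s) = (\<integral>r. F s r \<partial>leb t)"
      by (simp add: integral_leb)
  qed simp
  also have "\<dots> = (\<integral>r. (\<integral>s. F s r \<partial>leb t) \<partial>leb t)"
  proof (rule Fubini_bounded[where B = "K * B"])
    have "(\<lambda>(s, r). F s r) \<in> borel_measurable (borel \<Otimes>\<^sub>M borel)" unfolding F_def by measurable
    moreover have "(\<lambda>p. (fst p, snd p)) \<in> leb t \<Otimes>\<^sub>M leb t \<rightarrow>\<^sub>M borel \<Otimes>\<^sub>M borel"
      by (intro measurable_Pair measurable_compose[OF measurable_fst] measurable_compose[OF measurable_snd]
           measurable_restrict_space1) auto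
    ultimately show "(\<lambda>(s, r). F s r) \<in> borel_measurable (leb t \<Otimes>\<^sub>M leb t)"
      by (auto dest: measurable_compose)
    show "\<bar>F s r\<bar> \<le> K * B" if "s \<in> space (leb t)" "r \<in> space (leb t)" for s r
      using that K[of "t - s"] \<Phi>(2)[of r] B K0
      by (auto simp: F_def abs_mult intro!: mult_mono)
  qed (rule finite_leb)+
  also have "\<dots> = (\<integral>r. \<Phi> r * (k (t - r) - k 0) \<partial>leb t)"
  proof (rule Bochner_Integration.integral_cong)
    fix r assume r: "r \<in> space (leb t)"
    have "(\<integral>s. F s r \<partial>leb t) = (\<integral>s. F (t - s) r \<partial>leb t)" by (rule integral_leb_reflect[symmetric])
    also have "\<dots> = (\<integral>s. \<Phi> r * (indicator {0..t - r} s * k' s) \<partial>lborel)"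
      unfolding integral_leb
      by (rule Bochner_Integration.integral_cong) (use r in \<open>auto simp: F_def indicator_def\<close>)
    also have "\<dots> = \<Phi> r * (\<integral>s. k' s \<partial>leb (t - r))" by (simp add: integral_leb)
    also have "(\<integral>s. k' s \<partial>leb (t - r)) = k (t - r) - k 0"
      using r k k' by (intro integral_leb_FTC) (auto simp: continuous_on_eq_continuous_at)
    finally show "(\<integral>s. F s r \<partial>leb t) = \<Phi> r * (k (t - r) - k 0)" .
  qed simp
  finally show ?thesis .
qed


section \<open>The Markov property and the semigroup\<close>

locale markov_motion =
  fixes E :: "'a::euclidean_space set" and P :: "'a \<Rightarrow> 'a path measure"
  assumes markov: "strong_markov_process E P"
begin

lemma P_kernel: "P \<in> borel_on E \<rightarrow>\<^sub>M prob_algebra (path_space E {0..})"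
  using markov by (simp add: strong_markov_process_def)

lemma P_subprob: "P \<in> borel_on E \<rightarrow>\<^sub>M subprob_algebra (path_space E {0..})"
  using P_kernel by (rule measurable_prob_algebraD)

lemma
  assumes "x \<in> E"
  shows prob_space_P: "prob_space (P x)" and sets_P: "sets (P x) = sets (path_space E {0..})"
    and space_P: "space (P x) = skorokhod E {0..}"
  using measurable_space[OF P_kernel, of x] assms sets_eq_imp_space_eq[of "P x" "path_space E {0..}"]
  by (auto simp: space_prob_algebra)

lemma measurable_P: "x \<in> E \<Longrightarrow> f \<in> P x \<rightarrow>\<^sub>M N \<longleftrightarrow> f \<in> path_space E {0..} \<rightarrow>\<^sub>M N"
  using measurable_cong_sets[OF sets_P refl, of x N] by simp

lemma AE_start: "x \<in> E \<Longrightarrow> AE \<omega> in P x. \<omega> 0 = x"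
  using markov by (simp add: strong_markov_process_def)

lemma coord_path: "r \<ge> 0 \<Longrightarrow> (\<lambda>\<omega>. \<omega> r) \<in> path_space E {0..} \<rightarrow>\<^sub>M borel_on E"
  by (rule coord_measurable) auto

lemma kernel_after: "r \<ge> 0 \<Longrightarrow> (\<lambda>\<omega>. P (\<omega> r)) \<in> path_space E {0..} \<rightarrow>\<^sub>M subprob_algebra (path_space E {0..})"
  by (rule measurable_compose[OF coord_path P_subprob])

text \<open>A constant is a stopping time whose pre-\<open>\<sigma>\<close>-field contains
  \<open>filt E (ennreal r)\<close>, so this is an instance of the strong Markov property.\<close>

lemma markov_sets:
  assumes x: "x \<in> E" and r: "r \<ge> 0" and A: "A \<in> sets (filt E (ennreal r))"
    and B: "B \<in> sets (path_space E {0..})"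
  shows "emeasure (P x) {\<omega> \<in> A. path_shift r \<omega> \<in> B} = (\<integral>\<^sup>+\<omega>\<in>A. emeasure (P (\<omega> r)) B \<partial>P x)"
proof -
  have "A \<in> sets (filtration.pre_sigma (skorokhod E {0..}) (filt E) (\<lambda>_. ennreal r))"
    unfolding filtration.sets_pre_sigma[OF filtration_filt stopping_time_const]
  proof (intro CollectI allI)
    fix t show "{\<omega> \<in> A. ennreal r \<le> t} \<in> sets (filt E t)"
      using A subsetD[OF sets_filt_mono[of "ennreal r" t E], of A] by (cases "ennreal r \<le> t") simp_all
  qed
  moreover have "\<forall>x\<in>E. \<forall>T A B. stopping_time (filt E) T \<longrightarrow>
      A \<in> sets (filtration.pre_sigma (skorokhod E {0..}) (filt E) T) \<longrightarrow>
      B \<in> sets (path_space E {0..}) \<longrightarrow>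
      emeasure (P x) {\<omega> \<in> A. T \<omega> < \<infinity> \<and> path_shift (enn2real (T \<omega>)) \<omega> \<in> B} =
        (\<integral>\<^sup>+\<omega>\<in>{\<omega> \<in> A. T \<omega> < \<infinity>}. emeasure (P (\<omega> (enn2real (T \<omega>)))) B \<partial>P x)"
    using markov unfolding strong_markov_process_def by (elim conjE)
  note this[THEN bspec, OF x, THEN spec, of "\<lambda>_. ennreal r", THEN spec, of A, THEN spec, of B]
  ultimately have "emeasure (P x) {\<omega> \<in> A. ennreal r < \<infinity> \<and> path_shift (enn2real (ennreal r)) \<omega> \<in> B} =
      (\<integral>\<^sup>+\<omega>\<in>{\<omega> \<in> A. ennreal r < \<infinity>}. emeasure (P (\<omega> (enn2real (ennreal r)))) B \<partial>P x)"
    using B stopping_time_const[of "filt E" "ennreal r"] by blast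
  then show ?thesis using r by simp
qed

text \<open>The Markov property as an identity of measures: with the event A absorbed into a
  density, integrals of arbitrary functionals of the future follow from the rules for images and
  mixtures.\<close>

lemma markov_bind:
  assumes x: "x \<in> E" and r: "r \<ge> 0" and A: "A \<in> sets (filt E (ennreal r))"
  shows "distr (density (P x) (indicator A)) (path_space E {0..}) (path_shift r) =
    density (P x) (indicator A) \<bind> (\<lambda>\<omega>. P (\<omega> r))"
proof (rule measure_eqI)
  interpret prob_space "P x" by (rule prob_space_P[OF x])
  let ?D = "density (P x) (indicator A)"
  have ne: "space ?D \<noteq> {}" using not_empty by simp
  have m: "(\<lambda>\<omega>. P (\<omega> r)) \<in> ?D \<rightarrow>\<^sub>M subprob_algebra (path_space E {0..})"
    using kernel_after[OF r] by (simp add: measurable_P[OF x])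
  have A': "A \<in> sets (P x)" using A sets_filt_subset sets_P[OF x] by blast
  show "sets (distr ?D (path_space E {0..}) (path_shift r)) = sets (?D \<bind> (\<lambda>\<omega>. P (\<omega> r)))"
    by (subst sets_bind[OF sets_kernel[OF m] ne]) auto
  fix B assume "B \<in> sets (distr ?D (path_space E {0..}) (path_shift r))"
  then have B: "B \<in> sets (path_space E {0..})" by simp
  have s: "path_shift r \<in> P x \<rightarrow>\<^sub>M path_space E {0..}"
    using measurable_path_shift[OF r] measurable_P[OF x] by blast
  have "emeasure (distr ?D (path_space E {0..}) (path_shift r)) B = emeasure ?D (path_shift r -` B \<inter> space (P x))"
    using s B by (subst emeasure_distr) auto
  also have "\<dots> = (\<integral>\<^sup>+\<omega>. indicator A \<omega> * indicator (path_shift r -` B \<inter> space (P x)) \<omega> \<partial>P x)"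
    using A' measurable_sets[OF s B] by (subst emeasure_density) auto
  also have "\<dots> = (\<integral>\<^sup>+\<omega>. indicator {\<omega> \<in> A. path_shift r \<omega> \<in> B} \<omega> \<partial>P x)"
    using sets.sets_into_space[OF A'] by (intro nn_integral_cong) (auto simp: indicator_def)
  also have "\<dots> = emeasure (P x) {\<omega> \<in> A. path_shift r \<omega> \<in> B}"
  proof (rule nn_integral_indicator)
    have "{\<omega> \<in> A. path_shift r \<omega> \<in> B} = A \<inter> (path_shift r -` B \<inter> space (P x))"
      using sets.sets_into_space[OF A'] by auto
    then show "{\<omega> \<in> A. path_shift r \<omega> \<in> B} \<in> sets (P x)"
      using A' measurable_sets[OF s B] by auto
  qed
  also have "\<dots> = (\<integral>\<^sup>+\<omega>. indicator A \<omega> * emeasure (P (\<omega> r)) B \<partial>P x)"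
    unfolding markov_sets[OF x r A B] by (simp add: mult.commute)
  also have "\<dots> = (\<integral>\<^sup>+\<omega>. emeasure (P (\<omega> r)) B \<partial>?D)"
    using A' B measurable_compose[OF kernel_after[OF r] measurable_emeasure_subprob_algebra[OF B]] measurable_P[OF x]
    by (subst nn_integral_density) auto
  also have "\<dots> = emeasure (?D \<bind> (\<lambda>\<omega>. P (\<omega> r))) B"
    by (rule emeasure_bind[OF ne m B, symmetric])
  finally show "emeasure (distr ?D (path_space E {0..}) (path_shift r)) B = emeasure (?D \<bind> (\<lambda>\<omega>. P (\<omega> r))) B" .
qed

text \<open>The two factors are generalised one after the other. \<open>markov_bind\<close> admits
  any H while the first factor is an indicator; then the two sides, as functions of that event, are
  measures on \<open>filt E (ennreal r)\<close> that coincide, which admits any Z.\<close>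

lemma markov_nn_integral:
  assumes x: "x \<in> E" and r: "r \<ge> 0" and Z: "Z \<in> borel_measurable (filt E (ennreal r))"
    and H: "H \<in> borel_measurable (path_space E {0..})"
  shows "(\<integral>\<^sup>+\<omega>. Z \<omega> * H (path_shift r \<omega>) \<partial>P x) = (\<integral>\<^sup>+\<omega>. Z \<omega> * (\<integral>\<^sup>+\<eta>. H \<eta> \<partial>P (\<omega> r)) \<partial>P x)"
proof -
  interpret prob_space "P x" by (rule prob_space_P[OF x])
  define K where "K \<omega> = (\<integral>\<^sup>+\<eta>. H \<eta> \<partial>P (\<omega> r))" for \<omega> :: "'a path"
  define H' where "H' \<omega> = H (path_shift r \<omega>)" for \<omega> :: "'a path"
  have K: "K \<in> borel_measurable (P x)"
    unfolding K_def measurable_P[OF x]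
    by (rule measurable_compose[OF kernel_after[OF r] nn_integral_measurable_subprob_algebra[OF H]])
  have H': "H' \<in> borel_measurable (P x)"
    unfolding H'_def measurable_P[OF x] by (rule measurable_compose[OF measurable_path_shift[OF r] H])
  have s: "path_shift r \<in> P x \<rightarrow>\<^sub>M path_space E {0..}"
    using measurable_path_shift[OF r] measurable_P[OF x] by blast
  have eq: "(\<integral>\<^sup>+\<omega>. indicator A \<omega> * H' \<omega> \<partial>P x) = (\<integral>\<^sup>+\<omega>. indicator A \<omega> * K \<omega> \<partial>P x)"
    if A: "A \<in> sets (filt E (ennreal r))" for A
  proof -
    have A': "A \<in> sets (P x)" using A sets_filt_subset sets_P[OF x] by blast
    let ?D = "density (P x) (indicator A)"
    have m: "(\<lambda>\<omega>. P (\<omega> r)) \<in> ?D \<rightarrow>\<^sub>M subprob_algebra (path_space E {0..})"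
      using kernel_after[OF r] by (simp add: measurable_P[OF x])
    have "(\<integral>\<^sup>+\<omega>. indicator A \<omega> * H' \<omega> \<partial>P x) = (\<integral>\<^sup>+\<omega>. H (path_shift r \<omega>) \<partial>?D)"
      using A' H' unfolding H'_def by (subst nn_integral_density) auto
    also have "\<dots> = (\<integral>\<^sup>+\<omega>. H \<omega> \<partial>distr ?D (path_space E {0..}) (path_shift r))"
      using s H by (subst nn_integral_distr) auto
    also have "\<dots> = (\<integral>\<^sup>+\<omega>. K \<omega> \<partial>?D)"
      unfolding markov_bind[OF x r A] K_def by (rule nn_integral_bind[OF H m])
    also have "\<dots> = (\<integral>\<^sup>+\<omega>. indicator A \<omega> * K \<omega> \<partial>P x)"
      using A' K by (subst nn_integral_density) auto
    finally show ?thesis .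
  qed
  define M1 where "M1 = density (P x) H'"
  define M2 where "M2 = density (P x) K"
  have sub: "subalgebra M1 (filt E (ennreal r))" "subalgebra M2 (filt E (ennreal r))"
    by (rule subalgebra_filt, simp add: M1_def M2_def sets_P[OF x])+
  have "restr_to_subalg M1 (filt E (ennreal r)) = restr_to_subalg M2 (filt E (ennreal r))"
  proof (rule measure_eqI)
    fix A assume "A \<in> sets (restr_to_subalg M1 (filt E (ennreal r)))"
    then have A: "A \<in> sets (filt E (ennreal r))" using sub by (simp add: sets_restr_to_subalg)
    have A': "A \<in> sets (P x)" using A sets_filt_subset sets_P[OF x] by blast
    show "emeasure (restr_to_subalg M1 (filt E (ennreal r))) A = emeasure (restr_to_subalg M2 (filt E (ennreal r))) A"
      using eq[OF A] A' H' K unfolding emeasure_restr_to_subalg[OF sub(1) A] emeasure_restr_to_subalg[OF sub(2) A]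
      by (simp add: M1_def M2_def emeasure_density mult.commute)
  qed (use sub in \<open>simp add: sets_restr_to_subalg\<close>)
  then have "(\<integral>\<^sup>+\<omega>. Z \<omega> \<partial>M1) = (\<integral>\<^sup>+\<omega>. Z \<omega> \<partial>M2)"
    using nn_integral_subalgebra2[OF sub(1) Z] nn_integral_subalgebra2[OF sub(2) Z] by simp
  moreover have "Z \<in> borel_measurable (P x)"
    using measurable_filt_path[OF Z] measurable_P[OF x] by blast
  ultimately show ?thesis
    using H' K by (simp add: M1_def M2_def nn_integral_density mult.commute H'_def K_def)
qed

definition pt :: "real \<Rightarrow> ('a \<Rightarrow> real) \<Rightarrow> 'a \<Rightarrow> real" where
  "pt s F x = (\<integral>\<omega>. F (\<omega> s) \<partial>P x)"

lemma path_in: "x \<in> E \<Longrightarrow> \<omega> \<in> space (P x) \<Longrightarrow> 0 \<le> s \<Longrightarrow> \<omega> s \<in> E"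
  using skorokhod_in[of \<omega> E "{0..}" s] by (simp add: space_P)

lemma pt_cong: "x \<in> E \<Longrightarrow> s \<ge> 0 \<Longrightarrow> (\<And>y. y \<in> E \<Longrightarrow> F y = G y) \<Longrightarrow> pt s F x = pt s G x"
  unfolding pt_def by (rule Bochner_Integration.integral_cong) (use path_in in blast)+

lemma pt_integrable:
  fixes F :: "'a \<Rightarrow> real"
  assumes x: "x \<in> E" and "s \<ge> 0" "F \<in> borel_measurable (borel_on E)" "\<And>y. y \<in> E \<Longrightarrow> \<bar>F y\<bar> \<le> B"
  shows "integrable (P x) (\<lambda>\<omega>. F (\<omega> s))"
proof (rule integrable_bounded)
  show "finite_measure (P x)" using prob_space_P[OF x] by (simp add: prob_space_def)
  show "(\<lambda>\<omega>. F (\<omega> s)) \<in> borel_measurable (P x)"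
    unfolding measurable_P[OF x] by (rule measurable_compose[OF coord_path assms(3)]) fact
  show "\<bar>F (\<omega> s)\<bar> \<le> B" if "\<omega> \<in> space (P x)" for \<omega>
    by (rule assms(4)[OF path_in[OF x that assms(2)]])
qed

lemma pt_mono:
  assumes x: "x \<in> E" "s \<ge> 0" and F: "F \<in> borel_measurable (borel_on E)" "\<And>y. y \<in> E \<Longrightarrow> \<bar>F y\<bar> \<le> B"
    and G: "G \<in> borel_measurable (borel_on E)" "\<And>y. y \<in> E \<Longrightarrow> \<bar>G y\<bar> \<le> C"
    and FG: "\<And>y. y \<in> E \<Longrightarrow> F y \<le> G y"
  shows "pt s F x \<le> pt s G x"
  unfolding pt_def
proof (rule integral_mono)
  show "integrable (P x) (\<lambda>\<omega>. F (\<omega> s))" by (rule pt_integrable[OF x F])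
  show "integrable (P x) (\<lambda>\<omega>. G (\<omega> s))" by (rule pt_integrable[OF x G])
  show "F (\<omega> s) \<le> G (\<omega> s)" if "\<omega> \<in> space (P x)" for \<omega>
    by (rule FG[OF path_in[OF x(1) that x(2)]])
qed

lemma pt_const: "x \<in> E \<Longrightarrow> pt s (\<lambda>_. c) x = c"
  unfolding pt_def using prob_space.prob_space[OF prob_space_P, of x] by simp

lemma pt_bound:
  assumes x: "x \<in> E" "s \<ge> 0" and F: "F \<in> borel_measurable (borel_on E)" "\<And>y. y \<in> E \<Longrightarrow> \<bar>F y\<bar> \<le> B"
  shows "\<bar>pt s F x\<bar> \<le> B"
proof -
  have B: "\<bar>B\<bar> \<le> B" "\<bar>- B\<bar> \<le> B" using F(2)[OF x(1)] by auto
  have "pt s F x \<le> pt s (\<lambda>_. B) x"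
    by (rule pt_mono[OF x F _ B(1)]) (use F(2) in \<open>force simp: abs_le_iff\<close>)+
  moreover have "pt s (\<lambda>_. - B) x \<le> pt s F x"
    by (rule pt_mono[OF x _ B(2) F]) (use F(2) in \<open>force simp: abs_le_iff\<close>)+
  ultimately show ?thesis using x(1) by (simp add: pt_const)
qed

lemma pt_add:
  assumes x: "x \<in> E" "s \<ge> 0" and F: "F \<in> borel_measurable (borel_on E)" "\<And>y. y \<in> E \<Longrightarrow> \<bar>F y\<bar> \<le> B"
    and G: "G \<in> borel_measurable (borel_on E)" "\<And>y. y \<in> E \<Longrightarrow> \<bar>G y\<bar> \<le> C"
  shows "pt s (\<lambda>y. F y + G y) x = pt s F x + pt s G x"
  unfolding pt_def by (rule Bochner_Integration.integral_add[OF pt_integrable[OF x F] pt_integrable[OF x G]])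

lemma pt_cmult: "pt s (\<lambda>y. c * F y) x = c * pt s F x"
  unfolding pt_def by simp

text \<open>Time, integrand and starting point may all depend on the parameter. This joint form is
  what the exchange of path and time integrals in the Duhamel formula requires.\<close>

lemma pt_kernel_measurable:
  assumes F: "(\<lambda>(z, y). F z y) \<in> borel_measurable (M \<Otimes>\<^sub>M borel_on E)"
    and \<tau>: "\<tau> \<in> borel_measurable M" "\<And>z. z \<in> space M \<Longrightarrow> 0 \<le> \<tau> z" and X: "X \<in> M \<rightarrow>\<^sub>M borel_on E"
  shows "(\<lambda>z. pt (\<tau> z) (F z) (X z)) \<in> borel_measurable M"
  unfolding pt_def
proof (rule integral_measurable_kernel[where N = "path_space E {0..}"])
  have "(\<lambda>p. (fst p, snd p (\<tau> (fst p)))) \<in> M \<Otimes>\<^sub>M path_space E {0..} \<rightarrow>\<^sub>M M \<Otimes>\<^sub>M borel_on E"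
    using \<tau> by (intro measurable_Pair measurable_path_eval measurable_compose[OF measurable_fst \<tau>(1)])
      (auto simp: space_pair_measure)
  from measurable_compose[OF this F]
  show "(\<lambda>(z, \<omega>). F z (\<omega> (\<tau> z))) \<in> borel_measurable (M \<Otimes>\<^sub>M path_space E {0..})"
    by (simp add: case_prod_beta)
  show "(\<lambda>z. P (X z)) \<in> M \<rightarrow>\<^sub>M subprob_algebra (path_space E {0..})"
    by (rule measurable_compose[OF X P_subprob])
qed

lemma pt_measurable:
  assumes "F \<in> borel_measurable (borel_on E)" "s \<ge> 0"
  shows "pt s F \<in> borel_measurable (borel_on E)"
proof -
  have "(\<lambda>(z, y). F y) \<in> borel_measurable (borel_on E \<Otimes>\<^sub>M borel_on E)"
    unfolding case_prod_beta by (rule measurable_compose[OF measurable_snd assms(1)])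
  from pt_kernel_measurable[OF this, of "\<lambda>_. s" "\<lambda>x. x"] assms(2)
  show ?thesis by (simp add: measurable_ident_sets)
qed

text \<open>Chapman-Kolmogorov, read off from \<open>markov_bind\<close> with the whole path space
  as event, for which the density is trivial.\<close>

lemma pt_pt:
  assumes x: "x \<in> E" and sr: "s \<ge> 0" "r \<ge> 0"
    and F: "F \<in> borel_measurable (borel_on E)" "\<And>y. y \<in> E \<Longrightarrow> \<bar>F y\<bar> \<le> B"
  shows "pt s (pt r F) x = pt (s + r) F x"
proof -
  interpret prob_space "P x" by (rule prob_space_P[OF x])
  have top: "skorokhod E {0..} \<in> sets (filt E (ennreal s))" using sets.top[of "filt E (ennreal s)"] by simp
  have d: "density (P x) (indicator (skorokhod E {0..})) = P x"
  proof -
    have "density (P x) (indicator (skorokhod E {0..})) = density (P x) (\<lambda>_. 1)"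
      unfolding space_P[OF x, symmetric] by (rule density_cong) auto
    then show ?thesis by (simp add: density_1)
  qed
  have b: "distr (P x) (path_space E {0..}) (path_shift s) = P x \<bind> (\<lambda>\<omega>. P (\<omega> s))"
    using markov_bind[OF x sr(1) top] unfolding d .
  have F': "(\<lambda>\<eta>. F (\<eta> r)) \<in> borel_measurable (path_space E {0..})"
    by (rule measurable_compose[OF coord_path[OF sr(2)] F(1)])
  have "pt (s + r) F x = (\<integral>\<omega>. F (path_shift s \<omega> r) \<partial>P x)"
    using sr by (simp add: pt_def path_shift_def)
  also have "\<dots> = (\<integral>\<omega>. F (\<omega> r) \<partial>distr (P x) (path_space E {0..}) (path_shift s))"
    using measurable_path_shift[OF sr(1)] measurable_P[OF x] F' by (subst integral_distr) auto
  also have "\<dots> = (\<integral>\<omega>. (\<integral>\<eta>. F (\<eta> r) \<partial>P (\<omega> s)) \<partial>P x)"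
    unfolding b
  proof (rule integral_bind[where K = "path_space E {0..}" and B = B and B' = 1])
    show "\<bar>F (\<omega> r)\<bar> \<le> B" if "\<omega> \<in> space (path_space E {0..})" for \<omega>
      using that sr(2) by (intro F(2) path_in[OF x]) (auto simp: space_P[OF x])
    show "(\<lambda>\<omega>. P (\<omega> s)) \<in> P x \<rightarrow>\<^sub>M subprob_algebra (path_space E {0..})"
      unfolding measurable_P[OF x] by (rule kernel_after[OF sr(1)])
    show "AE \<omega> in P x. emeasure (P (\<omega> s)) (space (P (\<omega> s))) \<le> ennreal 1"
      by (intro AE_I2) (simp add: prob_space.emeasure_space_1[OF prob_space_P[OF path_in[OF x _ sr(1)]]])
  qed (fact F' finite_measure_axioms)+
  finally show ?thesis by (simp add: pt_def)
qed

end

section \<open>Mild equations and comparison\<close>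

text \<open>Time is confined to [0, T] because log-Laplace solutions are bounded only locally in
  time. The class is stable under sums, products and time shifts, and boundedness supplies the
  integrability behind each use of Fubini.\<close>

definition jmeas :: "'a::topological_space set \<Rightarrow> real \<Rightarrow> (real \<Rightarrow> 'a \<Rightarrow> real) \<Rightarrow> bool" where
  "jmeas E T G \<longleftrightarrow> (\<lambda>(t, x). G t x) \<in> borel_measurable (restrict_space borel {0..T} \<Otimes>\<^sub>M borel_on E) \<and>
     (\<exists>B. \<forall>t\<in>{0..T}. \<forall>x\<in>E. \<bar>G t x\<bar> \<le> B)"

lemma jmeas_measurable:
  assumes "jmeas E T G" "\<tau> \<in> borel_measurable M" "X \<in> M \<rightarrow>\<^sub>M borel_on E"
    "\<And>z. z \<in> space M \<Longrightarrow> 0 \<le> \<tau> z \<and> \<tau> z \<le> T"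
  shows "(\<lambda>z. G (\<tau> z) (X z)) \<in> borel_measurable M"
proof -
  have "(\<lambda>z. (\<tau> z, X z)) \<in> M \<rightarrow>\<^sub>M restrict_space borel {0..T} \<Otimes>\<^sub>M borel_on E"
    using assms by (intro measurable_Pair[OF measurable_restrict_space2 assms(3)]) auto
  from measurable_compose[OF this, of "\<lambda>(t, x). G t x"] assms(1) show ?thesis
    by (simp add: jmeas_def)
qed

lemma measurable_fst_time:
  "fst \<in> borel_measurable (restrict_space borel {0..S::real} \<Otimes>\<^sub>M N)"
  by (rule measurable_compose[OF measurable_fst, of "\<lambda>x. x"]) (simp add: measurable_restrict_space1)

lemma jmeas_bound:
  assumes "jmeas E T G"
  shows "\<exists>B\<ge>0. \<forall>t\<in>{0..T}. \<forall>x\<in>E. \<bar>G t x\<bar> \<le> B"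
proof -
  obtain B where "\<forall>t\<in>{0..T}. \<forall>x\<in>E. \<bar>G t x\<bar> \<le> B" using assms by (auto simp: jmeas_def)
  then show ?thesis by (intro exI[of _ "max B 0"]) (auto simp: le_max_iff_disj)
qed

lemma jmeas_shift:
  assumes G: "jmeas E T G" and "0 \<le> e" "e + S \<le> T"
  shows "jmeas E S (\<lambda>t. G (e + t))"
proof -
  have "(\<lambda>p. G (e + fst p) (snd p)) \<in> borel_measurable (restrict_space borel {0..S} \<Otimes>\<^sub>M borel_on E)"
    using assms(2,3)
    by (intro jmeas_measurable[OF G] measurable_fst_time measurable_snd borel_measurable_add borel_measurable_const)
      (auto simp: space_pair_measure)
  moreover obtain B where "\<forall>t\<in>{0..T}. \<forall>x\<in>E. \<bar>G t x\<bar> \<le> B" using jmeas_bound[OF G] by auto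
  then have "\<forall>t\<in>{0..S}. \<forall>x\<in>E. \<bar>G (e + t) x\<bar> \<le> B" using assms(2,3) by auto
  ultimately show ?thesis unfolding jmeas_def by (auto simp: case_prod_beta intro!: exI[of _ "B"])
qed

lemma jmeas_add:
  assumes F: "jmeas E T F" and G: "jmeas E T G"
  shows "jmeas E T (\<lambda>t x. F t x + G t x)"
proof -
  obtain B where B: "\<forall>t\<in>{0..T}. \<forall>x\<in>E. \<bar>F t x\<bar> \<le> B" using jmeas_bound[OF F] by auto
  obtain C where C: "\<forall>t\<in>{0..T}. \<forall>x\<in>E. \<bar>G t x\<bar> \<le> C" using jmeas_bound[OF G] by auto
  have "\<bar>F t x + G t x\<bar> \<le> B + C" if "t \<in> {0..T}" "x \<in> E" for t x
    by (rule order_trans[OF abs_triangle_ineq add_mono]) (use B C that in auto)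
  then show ?thesis using assms unfolding jmeas_def by (auto simp: case_prod_beta intro!: exI[of _ "B + C"])
qed

lemma jmeas_mult:
  assumes F: "jmeas E T F" and G: "jmeas E T G"
  shows "jmeas E T (\<lambda>t x. F t x * G t x)"
proof -
  obtain B where B: "B \<ge> 0" "\<forall>t\<in>{0..T}. \<forall>x\<in>E. \<bar>F t x\<bar> \<le> B" using jmeas_bound[OF F] by auto
  obtain C where C: "\<forall>t\<in>{0..T}. \<forall>x\<in>E. \<bar>G t x\<bar> \<le> C" using jmeas_bound[OF G] by auto
  have "\<bar>F t x * G t x\<bar> \<le> B * C" if "t \<in> {0..T}" "x \<in> E" for t x
    unfolding abs_mult by (rule mult_mono) (use B C that in auto)
  then show ?thesis using assms unfolding jmeas_def by (auto simp: case_prod_beta intro!: exI[of _ "B * C"])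
qed

lemma jmeas_space:
  assumes "f \<in> borel_measurable (borel_on E)" "\<And>x. x \<in> E \<Longrightarrow> \<bar>f x\<bar> \<le> B"
  shows "jmeas E T (\<lambda>_. f)"
  using assms measurable_compose[OF measurable_snd assms(1)] unfolding jmeas_def by (auto simp: case_prod_beta intro!: exI[of _ "B"])

lemma jmeas_time:
  assumes "continuous_on {0..T} k"
  shows "jmeas E T (\<lambda>t _. k t)"
proof -
  have "bounded (k ` {0..T})" using assms by (intro compact_imp_bounded compact_continuous_image) auto
  then obtain B where "\<forall>t\<in>{0..T}. \<bar>k t\<bar> \<le> B" unfolding bounded_iff by (metis imageI real_norm_def)
  moreover have "k \<in> borel_measurable (restrict_space borel {0..T})"
    by (rule borel_measurable_continuous_on_restrict[OF assms])
  note measurable_compose[OF measurable_fst this]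
  ultimately show ?thesis unfolding jmeas_def by (auto simp: case_prod_unfold intro!: exI[of _ "B"])
qed

lemma jmeas_cmult: "jmeas E T G \<Longrightarrow> jmeas E T (\<lambda>t x. c * G t x)"
  using jmeas_mult[OF jmeas_time[of T "\<lambda>_. c"]] by simp

lemma jmeas_minus: "jmeas E T G \<Longrightarrow> jmeas E T (\<lambda>t x. - G t x)"
  using jmeas_cmult[of E T G "-1"] by simp

lemma jmeas_at: "jmeas E T G \<Longrightarrow> 0 \<le> t \<Longrightarrow> t \<le> T \<Longrightarrow> G t \<in> borel_measurable (borel_on E)"
  using jmeas_measurable[of E T G "\<lambda>_. t" "borel_on E" "\<lambda>x. x"] by (simp add: measurable_ident_sets)

section \<open>Equations in Duhamel form\<close>

context markov_motion
begin

lemma pt_jmeas_measurable: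
  assumes G: "jmeas E T G" and t: "t \<le> T" and X: "X \<in> M \<rightarrow>\<^sub>M borel_on E"
    and "\<sigma> \<in> borel_measurable M" "\<tau> \<in> borel_measurable M"
    and "\<And>z. z \<in> space M \<Longrightarrow> 0 \<le> \<sigma> z" "\<And>z. z \<in> space M \<Longrightarrow> 0 \<le> \<tau> z \<and> \<tau> z \<le> T"
  shows "(\<lambda>z. pt (\<sigma> z) (G (\<tau> z)) (X z)) \<in> borel_measurable M"
proof (rule pt_kernel_measurable)
  show "(\<lambda>(z, y). G (\<tau> z) y) \<in> borel_measurable (M \<Otimes>\<^sub>M borel_on E)"
    unfolding case_prod_beta using assms
    by (intro jmeas_measurable[OF G] measurable_compose[OF measurable_fst]) (auto simp: space_pair_measure)
qed (use assms in auto)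

lemma pt_leb:
  assumes G: "jmeas E T G" and t: "0 \<le> t" "t \<le> T" and x: "x \<in> E"
  shows "(\<lambda>s. pt s (G (t - s)) x) \<in> borel_measurable (leb t)"
    and "\<forall>t\<in>{0..T}. \<forall>x\<in>E. \<bar>G t x\<bar> \<le> B \<Longrightarrow> 0 \<le> s \<Longrightarrow> s \<le> t \<Longrightarrow> \<bar>pt s (G (t - s)) x\<bar> \<le> B"
    and "integrable (leb t) (\<lambda>s. pt s (G (t - s)) x)"
proof -
  have i: "(\<lambda>s. s) \<in> borel_measurable (leb t)" by (rule measurable_restrict_space1) simp
  show m: "(\<lambda>s. pt s (G (t - s)) x) \<in> borel_measurable (leb t)"
    using t x i by (intro pt_jmeas_measurable[OF G order_refl] borel_measurable_diff) auto
  show b: "\<bar>pt s (G (t - s)) x\<bar> \<le> B" if "\<forall>t\<in>{0..T}. \<forall>x\<in>E. \<bar>G t x\<bar> \<le> B" "0 \<le> s" "s \<le> t" for B s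
    using that t x by (intro pt_bound jmeas_at[OF G]) auto
  obtain B where "\<forall>t\<in>{0..T}. \<forall>x\<in>E. \<bar>G t x\<bar> \<le> B" using jmeas_bound[OF G] by auto
  from b[OF this] show "integrable (leb t) (\<lambda>s. pt s (G (t - s)) x)"
    by (intro integrable_bounded[OF finite_leb m]) auto
qed

text \<open>Duhamel's formula for the evolution equation w' = L w + G with w(0) = f, where L
  generates \<open>pt\<close>. In this integrated form w need not be differentiable in time and w t
  need not lie in the domain of L.\<close>

definition mild :: "real \<Rightarrow> ('a \<Rightarrow> real) \<Rightarrow> (real \<Rightarrow> 'a \<Rightarrow> real) \<Rightarrow> (real \<Rightarrow> 'a \<Rightarrow> real) \<Rightarrow> bool" where
  "mild T f G w \<longleftrightarrow> f \<in> borel_measurable (borel_on E) \<and> (\<exists>B. \<forall>x\<in>E. \<bar>f x\<bar> \<le> B) \<and>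
     jmeas E T G \<and> jmeas E T w \<and>
     (\<forall>t\<in>{0..T}. \<forall>x\<in>E. w t x = pt t f x + (\<integral>s. pt s (G (t - s)) x \<partial>leb t))"

lemma mild_eq:
  "mild T f G w \<Longrightarrow> 0 \<le> t \<Longrightarrow> t \<le> T \<Longrightarrow> x \<in> E \<Longrightarrow>
    w t x = pt t f x + (\<integral>s. pt s (G (t - s)) x \<partial>leb t)"
  by (simp add: mild_def)

lemma mild_add:
  assumes "mild T f G w" "mild T f' G' w'"
  shows "mild T (\<lambda>x. f x + f' x) (\<lambda>t x. G t x + G' t x) (\<lambda>t x. w t x + w' t x)"
proof -
  have f: "f \<in> borel_measurable (borel_on E)" "f' \<in> borel_measurable (borel_on E)"
    and G: "jmeas E T G" "jmeas E T G'" and w: "jmeas E T w" "jmeas E T w'"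
    using assms by (auto simp: mild_def)
  obtain B B' where B: "\<forall>x\<in>E. \<bar>f x\<bar> \<le> B" "\<forall>x\<in>E. \<bar>f' x\<bar> \<le> B'" using assms by (auto simp: mild_def)
  have "\<bar>f x + f' x\<bar> \<le> B + B'" if "x \<in> E" for x
    by (rule order_trans[OF abs_triangle_ineq add_mono]) (use B that in auto)
  then have "\<exists>B. \<forall>x\<in>E. \<bar>f x + f' x\<bar> \<le> B" by auto
  moreover have "w t x + w' t x = pt t (\<lambda>x. f x + f' x) x + (\<integral>s. pt s (\<lambda>x. G (t - s) x + G' (t - s) x) x \<partial>leb t)"
    if t: "t \<in> {0..T}" and x: "x \<in> E" for t x
  proof -
    obtain C where C: "\<forall>t\<in>{0..T}. \<forall>x\<in>E. \<bar>G t x\<bar> \<le> C" using jmeas_bound[OF G(1)] by auto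
    obtain C' where C': "\<forall>t\<in>{0..T}. \<forall>x\<in>E. \<bar>G' t x\<bar> \<le> C'" using jmeas_bound[OF G(2)] by auto
    have t': "0 \<le> t" "t \<le> T" using t by auto
    have "(\<integral>s. pt s (\<lambda>x. G (t - s) x + G' (t - s) x) x \<partial>leb t) =
        (\<integral>s. pt s (G (t - s)) x + pt s (G' (t - s)) x \<partial>leb t)"
      by (rule Bochner_Integration.integral_cong[OF refl], rule pt_add[where B = C and C = C'])
         (use t' x C C' jmeas_at[OF G(1)] jmeas_at[OF G(2)] in auto)
    also have "\<dots> = (\<integral>s. pt s (G (t - s)) x \<partial>leb t) + (\<integral>s. pt s (G' (t - s)) x \<partial>leb t)"
      by (rule Bochner_Integration.integral_add[OF pt_leb(3)[OF G(1) t' x] pt_leb(3)[OF G(2) t' x]])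
    moreover have "pt t (\<lambda>x. f x + f' x) x = pt t f x + pt t f' x"
      by (rule pt_add[where B = B and C = B']) (use t x f B in auto)
    ultimately show ?thesis using mild_eq[OF assms(1) t' x] mild_eq[OF assms(2) t' x] by simp
  qed
  ultimately show ?thesis using f G w jmeas_add[OF G] jmeas_add[OF w] unfolding mild_def by auto
qed

lemma mild_cmult:
  assumes "mild T f G w"
  shows "mild T (\<lambda>x. c * f x) (\<lambda>t x. c * G t x) (\<lambda>t x. c * w t x)"
proof -
  obtain B where B: "\<forall>x\<in>E. \<bar>f x\<bar> \<le> B" using assms by (auto simp: mild_def)
  have "\<forall>x\<in>E. \<bar>c * f x\<bar> \<le> \<bar>c\<bar> * B" using B by (auto simp: abs_mult intro!: mult_left_mono)
  then have "\<exists>B. \<forall>x\<in>E. \<bar>c * f x\<bar> \<le> B" by blast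
  moreover have "jmeas E T (\<lambda>t x. c * G t x)" "jmeas E T (\<lambda>t x. c * w t x)"
    using assms jmeas_cmult[of E T G c] jmeas_cmult[of E T w c] by (auto simp: mild_def)
  ultimately show ?thesis using assms
    unfolding mild_def by (auto simp: pt_cmult distrib_left)
qed

lemma mild_diff:
  assumes "mild T f G w" "mild T f' G' w'"
  shows "mild T (\<lambda>x. f x - f' x) (\<lambda>t x. G t x - G' t x) (\<lambda>t x. w t x - w' t x)"
  using mild_add[OF assms(1) mild_cmult[OF assms(2), of "-1"]] by simp

lemma mild_cong:
  assumes "mild T f G w" "\<And>x. x \<in> E \<Longrightarrow> f x = f' x" "\<And>t x. 0 \<le> t \<Longrightarrow> t \<le> T \<Longrightarrow> x \<in> E \<Longrightarrow> G t x = G' t x"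
    "\<And>t x. 0 \<le> t \<Longrightarrow> t \<le> T \<Longrightarrow> x \<in> E \<Longrightarrow> w t x = w' t x"
  shows "mild T f' G' w'"
proof -
  have c: "jmeas E T H = jmeas E T H'" if "\<And>t x. 0 \<le> t \<Longrightarrow> t \<le> T \<Longrightarrow> x \<in> E \<Longrightarrow> H t x = H' t x" for H H'
  proof -
    have "(\<lambda>(t, x). H t x) \<in> borel_measurable (restrict_space borel {0..T} \<Otimes>\<^sub>M borel_on E) \<longleftrightarrow>
      (\<lambda>(t, x). H' t x) \<in> borel_measurable (restrict_space borel {0..T} \<Otimes>\<^sub>M borel_on E)"
      by (rule measurable_cong) (use that in \<open>auto simp: space_pair_measure\<close>)
    then show ?thesis unfolding jmeas_def using that by simp
  qed
  have f: "f \<in> borel_measurable (borel_on E) \<longleftrightarrow> f' \<in> borel_measurable (borel_on E)"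
    by (rule measurable_cong) (use assms(2) in auto)
  have "pt t f x = pt t f' x" if "0 \<le> t" "x \<in> E" for t x
    by (rule pt_cong) (use that assms(2) in auto)
  moreover have "(\<integral>s. pt s (G (t - s)) x \<partial>leb t) = (\<integral>s. pt s (G' (t - s)) x \<partial>leb t)" if "0 \<le> t" "t \<le> T" "x \<in> E" for t x
    by (rule Bochner_Integration.integral_cong[OF refl], rule pt_cong) (use that assms(3) in auto)
  ultimately show ?thesis
    using assms(1,2,4) f c[of G G', OF assms(3)] c[of w w', OF assms(4)] unfolding mild_def by simp
qed

text \<open>The semigroup law applied to both terms of Duhamel's formula at time t - s: compared
  with w t, only the source over the first s time units is missing. This yields the restart at a
  later time as well as the product rule.\<close>

lemma mild_restart:
  assumes w: "mild T f G w" and s: "0 \<le> s" "s \<le> t" "t \<le> T" and x: "x \<in> E"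
  shows "pt s (w (t - s)) x = w t x - (\<integral>r. pt r (G (t - r)) x \<partial>leb s)"
proof -
  have f: "f \<in> borel_measurable (borel_on E)" and G: "jmeas E T G"
    using w by (auto simp: mild_def)
  obtain B where B: "\<forall>x\<in>E. \<bar>f x\<bar> \<le> B" using w by (auto simp: mild_def)
  obtain C where C: "C \<ge> 0" "\<forall>t\<in>{0..T}. \<forall>x\<in>E. \<bar>G t x\<bar> \<le> C" using jmeas_bound[OF G] by auto
  have ts: "0 \<le> t - s" "t - s \<le> T" and t: "0 \<le> t" using s by auto
  interpret prob_space "P x" by (rule prob_space_P[OF x])
  let ?I = "\<lambda>y. \<integral>r. pt r (G (t - s - r)) y \<partial>leb (t - s)"
  have meas: "(\<lambda>(y, r). pt r (G (t - s - r)) y) \<in> borel_measurable (borel_on E \<Otimes>\<^sub>M leb (t - s))"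
    unfolding case_prod_beta using ts s
    by (intro pt_jmeas_measurable[OF G order_refl] borel_measurable_diff measurable_compose[OF measurable_snd]
        measurable_restrict_space1) (auto simp: space_pair_measure)
  have I: "?I \<in> borel_measurable (borel_on E)"
    using sigma_finite_measure.borel_measurable_lebesgue_integral[OF finite_measure.axioms(1)[OF finite_leb] meas] .
  have Ib: "\<bar>?I y\<bar> \<le> C * (t - s)" if y: "y \<in> E" for y
  proof -
    have "\<bar>?I y\<bar> \<le> (\<integral>r. \<bar>pt r (G (t - s - r)) y\<bar> \<partial>leb (t - s))" by (rule integral_abs_bound)
    also have "\<dots> \<le> (\<integral>r. C \<partial>leb (t - s))"
      using pt_leb[OF G ts y] C finite_measure.integrable_const[OF finite_leb]
      by (intro integral_mono) auto
    finally show ?thesis using ts by (simp add: measure_restrict_space mult.commute)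
  qed
  have "pt s (w (t - s)) x = pt s (\<lambda>y. pt (t - s) f y + ?I y) x"
    by (rule pt_cong) (use mild_eq[OF w ts] s x in auto)
  also have "\<dots> = pt s (pt (t - s) f) x + pt s ?I x"
    using s ts x f B I Ib by (intro pt_add[where B = B and C = "C * (t - s)"] pt_measurable pt_bound) auto
  also have "pt s (pt (t - s) f) x = pt t f x"
    using pt_pt[OF x s(1) ts(1) f, of B] B by simp
  \<comment> \<open>Fubini exchanges path and time, and then Chapman-Kolmogorov applies for each
    fixed r.\<close>
  also have "pt s ?I x = (\<integral>r. pt (s + r) (G (t - (s + r))) x \<partial>leb (t - s))"
  proof -
    have "pt s ?I x = (\<integral>r. (\<integral>\<omega>. pt r (G (t - s - r)) (\<omega> s) \<partial>P x) \<partial>leb (t - s))"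
      unfolding pt_def[of s]
    proof (rule Fubini_bounded[where B = C])
      have "(\<lambda>p. (fst p s, snd p)) \<in> P x \<Otimes>\<^sub>M leb (t - s) \<rightarrow>\<^sub>M borel_on E \<Otimes>\<^sub>M leb (t - s)"
        using coord_path[OF s(1)] unfolding measurable_P[OF x, symmetric]
        by (intro measurable_Pair measurable_compose[OF measurable_fst]) auto
      from measurable_compose[OF this meas]
      show "(\<lambda>(\<omega>, r). pt r (G (t - s - r)) (\<omega> s)) \<in> borel_measurable (P x \<Otimes>\<^sub>M leb (t - s))"
        by (simp add: case_prod_beta)
      show "\<bar>pt r (G (t - s - r)) (\<omega> s)\<bar> \<le> C" if "\<omega> \<in> space (P x)" "r \<in> space (leb (t - s))" for \<omega> r
        using that by (intro pt_leb(2)[OF G ts path_in[OF x that(1) s(1)] C(2)]) auto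
    qed (use finite_leb finite_measure_axioms in auto)
    also have "\<dots> = (\<integral>r. pt (s + r) (G (t - (s + r))) x \<partial>leb (t - s))"
    proof (rule Bochner_Integration.integral_cong[OF refl])
      fix r assume r: "r \<in> space (leb (t - s))"
      have "(\<integral>\<omega>. pt r (G (t - s - r)) (\<omega> s) \<partial>P x) = pt s (pt r (G (t - s - r))) x" by (simp add: pt_def[of s])
      also have "\<dots> = pt (s + r) (G (t - s - r)) x"
        using r s C(2) by (intro pt_pt[where B = C] x jmeas_at[OF G]) auto
      finally show "(\<integral>\<omega>. pt r (G (t - s - r)) (\<omega> s) \<partial>P x) = pt (s + r) (G (t - (s + r))) x"
        by (simp add: diff_diff_eq)
    qed
    finally show ?thesis .
  qed
  finally show ?thesis
    using integral_leb_split(1)[OF s(1,2) pt_leb(3)[OF G t s(3) x]] mild_eq[OF w t s(3) x] by simp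
qed

lemma mild_shift:
  assumes w: "mild T f G w" and e: "0 \<le> e" "0 \<le> S" "e + S \<le> T"
  shows "mild S (w e) (\<lambda>t. G (e + t)) (\<lambda>t. w (e + t))"
proof -
  have G: "jmeas E T G" and w': "jmeas E T w" using w by (auto simp: mild_def)
  obtain B where B: "\<forall>t\<in>{0..T}. \<forall>x\<in>E. \<bar>w t x\<bar> \<le> B" using jmeas_bound[OF w'] by auto
  have "w (e + t) x = pt t (w e) x + (\<integral>s. pt s (G (e + (t - s))) x \<partial>leb t)" if "0 \<le> t" "t \<le> S" "x \<in> E" for t x
    using mild_restart[OF w, of t "e + t" x] that e by (simp add: add_diff_eq)
  then show ?thesis
    using e B jmeas_at[OF w'] jmeas_shift[OF G] jmeas_shift[OF w'] unfolding mild_def by (auto intro!: exI[of _ B])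
qed

text \<open>The product rule (k w)' = k' w + k w' in integrated form. As w has no time derivative,
  the term with k' is expanded by \<open>mild_restart\<close>, and the resulting double integral is
  the one of \<open>integral_leb_triangle\<close>.\<close>

lemma mild_mult_time:
  assumes w: "mild T f G w" and T: "T \<ge> 0"
    and k: "\<And>s. 0 \<le> s \<Longrightarrow> s \<le> T \<Longrightarrow> (k has_real_derivative k' s) (at s)" and k': "continuous_on UNIV k'"
  shows "mild T (\<lambda>x. k 0 * f x) (\<lambda>t x. k' t * w t x + k t * G t x) (\<lambda>t x. k t * w t x)"
proof -
  have f: "f \<in> borel_measurable (borel_on E)" and G: "jmeas E T G" and w': "jmeas E T w"
    using w by (auto simp: mild_def)
  obtain B where B: "\<forall>x\<in>E. \<bar>f x\<bar> \<le> B" using w by (auto simp: mild_def)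
  obtain C where C: "C \<ge> 0" "\<forall>t\<in>{0..T}. \<forall>x\<in>E. \<bar>G t x\<bar> \<le> C" using jmeas_bound[OF G] by auto
  have ck: "continuous_on {0..T} k"
    using k by (intro continuous_at_imp_continuous_on ballI DERIV_isCont) auto
  have jk: "jmeas E T (\<lambda>t _. k t)" and jk': "jmeas E T (\<lambda>t _. k' t)"
    using ck k' by (auto intro!: jmeas_time intro: continuous_on_subset)
  have jw: "jmeas E T (\<lambda>t x. k t * w t x)" and jw': "jmeas E T (\<lambda>t x. k' t * w t x)"
    and jG: "jmeas E T (\<lambda>t x. k t * G t x)"
    using jmeas_mult[OF jk w'] jmeas_mult[OF jk' w'] jmeas_mult[OF jk G] by auto
  have "\<forall>x\<in>E. \<bar>k 0 * f x\<bar> \<le> \<bar>k 0\<bar> * B" using B by (auto simp: abs_mult intro!: mult_left_mono)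
  moreover have "k t * w t x = pt t (\<lambda>x. k 0 * f x) x +
     (\<integral>s. pt s (\<lambda>x. k' (t - s) * w (t - s) x + k (t - s) * G (t - s) x) x \<partial>leb t)"
    if t: "0 \<le> t" "t \<le> T" and x: "x \<in> E" for t x
  proof -
    define \<Phi> where "\<Phi> r = pt r (G (t - r)) x" for r
    define W where "W = w t x"
    have \<Phi>: "\<Phi> \<in> borel_measurable (leb t)" "\<And>s. 0 \<le> s \<Longrightarrow> s \<le> t \<Longrightarrow> \<bar>\<Phi> s\<bar> \<le> C" "integrable (leb t) \<Phi>"
      unfolding \<Phi>_def using pt_leb[OF G t x] C by auto
    have i1: "integrable (leb t) (\<lambda>s. pt s (\<lambda>x. k' (t - s) * w (t - s) x) x)" by (rule pt_leb(3)[OF jw' t x])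
    have i2: "integrable (leb t) (\<lambda>s. pt s (\<lambda>x. k (t - s) * G (t - s) x) x)" by (rule pt_leb(3)[OF jG t x])
    have e1: "pt s (\<lambda>x. k' (t - s) * w (t - s) x) x = k' (t - s) * W - k' (t - s) * (\<integral>r. \<Phi> r \<partial>leb s)"
      if "s \<in> {0..t}" for s
      using mild_restart[OF w, of s t x] that t x by (simp add: pt_cmult W_def \<Phi>_def right_diff_distrib)
    have e2: "pt s (\<lambda>x. k (t - s) * G (t - s) x) x = k (t - s) * \<Phi> s" for s
      by (simp add: pt_cmult \<Phi>_def)
    have k'r: "integrable (leb t) (\<lambda>s. k' (t - s) * W)"
    proof -
      have "continuous_on {0..t} (\<lambda>s. k' (t - s) * W)"
        by (intro continuous_intros continuous_on_compose2[OF k']) auto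
      from borel_integrable_compact[OF _ this] show ?thesis
        by (subst integrable_restrict_space) (auto simp: mult.commute)
    qed
    have i1': "integrable (leb t) (\<lambda>s. k' (t - s) * W - k' (t - s) * (\<integral>r. \<Phi> r \<partial>leb s))"
      using i1 by (rule Bochner_Integration.integrable_cong[THEN iffD1, OF refl, rotated]) (use e1 in auto)
    have i3: "integrable (leb t) (\<lambda>s. k' (t - s) * (\<integral>r. \<Phi> r \<partial>leb s))"
      using Bochner_Integration.integrable_diff[OF k'r i1'] by simp
    have "(\<integral>s. pt s (\<lambda>x. k' (t - s) * w (t - s) x + k (t - s) * G (t - s) x) x \<partial>leb t) =
      (\<integral>s. pt s (\<lambda>x. k' (t - s) * w (t - s) x) x + pt s (\<lambda>x. k (t - s) * G (t - s) x) x \<partial>leb t)"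
    proof (rule Bochner_Integration.integral_cong[OF refl])
      fix s assume s: "s \<in> space (leb t)"
      obtain D1 D2 where D: "\<forall>t\<in>{0..T}. \<forall>x\<in>E. \<bar>k' t * w t x\<bar> \<le> D1" "\<forall>t\<in>{0..T}. \<forall>x\<in>E. \<bar>k t * G t x\<bar> \<le> D2"
        using jmeas_bound[OF jw'] jmeas_bound[OF jG] by auto
      show "pt s (\<lambda>x. k' (t - s) * w (t - s) x + k (t - s) * G (t - s) x) x =
        pt s (\<lambda>x. k' (t - s) * w (t - s) x) x + pt s (\<lambda>x. k (t - s) * G (t - s) x) x"
        using s t x D jmeas_at[OF jw', of "t - s"] jmeas_at[OF jG, of "t - s"]
        by (intro pt_add[where B = D1 and C = D2]) auto
    qed
    also have "\<dots> = (\<integral>s. pt s (\<lambda>x. k' (t - s) * w (t - s) x) x \<partial>leb t) + (\<integral>s. pt s (\<lambda>x. k (t - s) * G (t - s) x) x \<partial>leb t)"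
      by (rule Bochner_Integration.integral_add[OF i1 i2])
    also have "(\<integral>s. pt s (\<lambda>x. k' (t - s) * w (t - s) x) x \<partial>leb t) =
       (\<integral>s. k' (t - s) * W - k' (t - s) * (\<integral>r. \<Phi> r \<partial>leb s) \<partial>leb t)"
      by (rule Bochner_Integration.integral_cong[OF refl]) (use e1 in auto)
    also have "\<dots> = (\<integral>s. k' (t - s) * W \<partial>leb t) - (\<integral>s. k' (t - s) * (\<integral>r. \<Phi> r \<partial>leb s) \<partial>leb t)"
      by (rule Bochner_Integration.integral_diff[OF k'r i3])
    also have "(\<integral>s. k' (t - s) * W \<partial>leb t) = W * (\<integral>s. k' s \<partial>leb t)"
      using integral_leb_reflect[of t k'] by (simp add: mult.commute)
    also have "(\<integral>s. k' s \<partial>leb t) = k t - k 0"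
      using t k k' by (intro integral_leb_FTC) (auto simp: continuous_on_eq_continuous_at)
    also have "(\<integral>s. k' (t - s) * (\<integral>r. \<Phi> r \<partial>leb s) \<partial>leb t) = (\<integral>r. \<Phi> r * (k (t - r) - k 0) \<partial>leb t)"
      by (rule integral_leb_triangle[OF t(1) \<Phi>(1,2) _ k']) (use t k in auto)
    also have "(\<integral>r. \<Phi> r * (k (t - r) - k 0) \<partial>leb t) = (\<integral>r. k (t - r) * \<Phi> r \<partial>leb t) - k 0 * (\<integral>r. \<Phi> r \<partial>leb t)"
    proof -
      have "(\<integral>r. k (t - r) * \<Phi> r - k 0 * \<Phi> r \<partial>leb t) = (\<integral>r. k (t - r) * \<Phi> r \<partial>leb t) - (\<integral>r. k 0 * \<Phi> r \<partial>leb t)"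
        using i2 \<Phi>(3) unfolding e2 by (intro Bochner_Integration.integral_diff) auto
      then show ?thesis by (simp add: algebra_simps)
    qed
    finally show ?thesis
      using mild_eq[OF w t x] unfolding e2 pt_cmult W_def \<Phi>_def by (simp add: algebra_simps)
  qed
  ultimately show ?thesis using f jw jmeas_add[OF jw' jG] unfolding mild_def by auto
qed

text \<open>The functions k in the comparisons explode at a negative time, so k' is continuous only
  on [0, \<infinity>). Freezing it at its value at 0 extends it to the line, and the equation sees
  nonnegative times only.\<close>

lemma mild_mult_time_Icc:
  assumes w: "mild T f G w" and T: "T \<ge> 0"
    and k: "\<And>s. 0 \<le> s \<Longrightarrow> s \<le> T \<Longrightarrow> (k has_real_derivative k' s) (at s)" and k': "continuous_on {0..} k'"
  shows "mild T (\<lambda>x. k 0 * f x) (\<lambda>t x. k' t * w t x + k t * G t x) (\<lambda>t x. k t * w t x)"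
proof -
  have "continuous_on UNIV (\<lambda>s. k' (max s 0))"
    by (intro continuous_on_compose2[OF k'] continuous_intros) auto
  then have "mild T (\<lambda>x. k 0 * f x) (\<lambda>t x. k' (max t 0) * w t x + k t * G t x) (\<lambda>t x. k t * w t x)"
    using k by (intro mild_mult_time[OF w T]) auto
  then show ?thesis by (rule mild_cong) auto
qed

text \<open>After multiplication by \<open>e\<^sup>k\<^sup>t\<close> the source is at most \<open>2k\<close> times the positive part of the
  solution, and Picard iteration of this inequality bounds the solution by \<open>M (2kt)\<^sup>n / n!\<close>.\<close>

lemma mild_comparison:
  assumes w: "mild T f G w" and f: "\<And>x. x \<in> E \<Longrightarrow> f x \<le> 0"
    and \<kappa>: "\<And>t x. 0 \<le> t \<Longrightarrow> t \<le> T \<Longrightarrow> x \<in> E \<Longrightarrow> \<bar>\<kappa> t x\<bar> \<le> k"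
    and G: "\<And>t x. 0 \<le> t \<Longrightarrow> t \<le> T \<Longrightarrow> x \<in> E \<Longrightarrow> G t x \<le> - \<kappa> t x * w t x"
    and t: "0 \<le> t" "t \<le> T" and x: "x \<in> E"
  shows "w t x \<le> 0"
proof -
  have T: "0 \<le> T" using t by simp
  have k0: "0 \<le> k" using \<kappa>[OF t x] by simp
  define W where "W t x = exp (k * t) * w t x" for t x
  define H where "H t x = k * exp (k * t) * w t x + exp (k * t) * G t x" for t x
  have W: "mild T f H W"
  proof -
    have "mild T (\<lambda>x. exp (k * 0) * f x) (\<lambda>t x. (k * exp (k * t)) * w t x + exp (k * t) * G t x) (\<lambda>t x. exp (k * t) * w t x)"
      by (rule mild_mult_time[OF w T]) (auto intro!: derivative_eq_intros continuous_intros)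
    then show ?thesis by (simp add: W_def[abs_def] H_def[abs_def])
  qed
  have jH: "jmeas E T H" and jW: "jmeas E T W" and fm: "f \<in> borel_measurable (borel_on E)"
    using W by (auto simp: mild_def)
  obtain M where M: "M \<ge> 0" "\<forall>t\<in>{0..T}. \<forall>x\<in>E. \<bar>W t x\<bar> \<le> M" using jmeas_bound[OF jW] by auto
  obtain C where C: "\<forall>t\<in>{0..T}. \<forall>x\<in>E. \<bar>H t x\<bar> \<le> C" using jmeas_bound[OF jH] by auto
  obtain B where B: "\<forall>x\<in>E. \<bar>f x\<bar> \<le> B" using W by (auto simp: mild_def)
  have H: "H t x \<le> 2 * k * max 0 (W t x)" if "0 \<le> t" "t \<le> T" "x \<in> E" for t x
  proof -
    have "H t x \<le> exp (k * t) * ((k - \<kappa> t x) * w t x)"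
      using mult_left_mono[OF G[OF that], of "exp (k * t)"] by (simp add: H_def algebra_simps)
    \<comment> \<open>The coefficient k - \<kappa> lies between 0 and 2 k. Being nonnegative, it
      lets negative values of w contribute nothing positive; this is the purpose of the exponential
      weight.\<close>
    also have "(k - \<kappa> t x) * w t x \<le> 2 * k * max 0 (w t x)"
    proof (cases "w t x \<ge> 0")
      case True
      then show ?thesis using \<kappa>[OF that] by (auto intro!: mult_right_mono)
    next
      case False
      then show ?thesis using \<kappa>[OF that] by (auto simp: mult_nonneg_nonpos)
    qed
    finally show ?thesis
      by (auto simp: W_def max_def mult.left_commute zero_le_mult_iff split: if_splits)
  qed
  have it: "\<forall>t\<in>{0..T}. \<forall>x\<in>E. W t x \<le> M * ((2 * k * t) ^ n / fact n)" for n
  proof (induction n)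
    case 0
    then show ?case using M(2) by (fastforce simp: abs_le_iff)
  next
    case (Suc n)
    show ?case
    proof (intro ballI)
      fix t x assume t: "t \<in> {0..T}" and x: "x \<in> E"
      then have t': "0 \<le> t" "t \<le> T" by auto
      let ?c = "\<lambda>s. 2 * k * (M * ((2 * k * s) ^ n / fact n))"
      have le: "pt s (H (t - s)) x \<le> ?c (t - s)" if s: "s \<in> {0..t}" for s
      proof -
        have r: "0 \<le> t - s" "t - s \<le> T" using s t' by auto
        have "H (t - s) y \<le> ?c (t - s)" if y: "y \<in> E" for y
        proof (rule order_trans[OF H[OF r y]])
          have "W (t - s) y \<le> M * ((2 * k * (t - s)) ^ n / fact n)" using Suc r y by auto
          then have "max 0 (W (t - s) y) \<le> M * ((2 * k * (t - s)) ^ n / fact n)" using M(1) k0 r by simp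
          then show "2 * k * max 0 (W (t - s) y) \<le> ?c (t - s)" using k0 by (intro mult_left_mono) auto
        qed
        then have "pt s (H (t - s)) x \<le> pt s (\<lambda>_. ?c (t - s)) x"
          using s x C r jmeas_at[OF jH r] by (intro pt_mono[where B = C and C = "\<bar>?c (t - s)\<bar>"]) auto
        then show ?thesis using x by (simp add: pt_const)
      qed
      have cc: "continuous_on UNIV ?c" by (intro continuous_intros) auto
      have ic: "integrable (leb t) (\<lambda>s. ?c (t - s))"
      proof -
        have "continuous_on {0..t} (\<lambda>s. ?c (t - s))" by (intro continuous_intros) auto
        from borel_integrable_compact[OF _ this] show ?thesis
          by (subst integrable_restrict_space) (auto simp: mult.commute)
      qed
      have "(\<integral>s. pt s (H (t - s)) x \<partial>leb t) \<le> (\<integral>s. ?c (t - s) \<partial>leb t)"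
        by (rule integral_mono[OF pt_leb(3)[OF jH t' x] ic]) (use le in auto)
      also have "\<dots> = (\<integral>s. ?c s \<partial>leb t)" by (rule integral_leb_reflect)
      also have "\<dots> = M * ((2 * k * t) ^ Suc n / fact (Suc n)) - M * ((2 * k * 0) ^ Suc n / fact (Suc n))"
      proof (rule integral_leb_FTC[OF t'(1)])
        fix s
        have "((\<lambda>s. (2 * k * s) ^ Suc n) has_real_derivative real (Suc n) * (2 * k * s) ^ n * (2 * k)) (at s)"
          using DERIV_power_Suc[OF DERIV_cmult_Id[of "2 * k" s], of n]
          by (simp only: of_nat_Suc mult_ac add_ac)
        from DERIV_cmult[OF this, of "M / fact (Suc n)"]
        have "((\<lambda>s. M * ((2 * k * s) ^ Suc n / fact (Suc n))) has_real_derivative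
            M / fact (Suc n) * (real (Suc n) * (2 * k * s) ^ n * (2 * k))) (at s)" by simp
        moreover have "M / (q * fact n) * (q * p * (2 * k)) = 2 * k * (M * (p / fact n))" if "q \<noteq> 0" for q p :: real
          using that by (simp add: field_simps)
        from this[of "real (Suc n)" "(2 * k * s) ^ n"]
        have "M / fact (Suc n) * (real (Suc n) * (2 * k * s) ^ n * (2 * k)) = ?c s" by (simp only: fact_Suc)
        ultimately show "((\<lambda>s. M * ((2 * k * s) ^ Suc n / fact (Suc n))) has_real_derivative ?c s) (at s)"
          by (simp only:)
        show "isCont ?c s" using cc by (simp add: continuous_on_eq_continuous_at)
      qed
      finally have I: "(\<integral>s. pt s (H (t - s)) x \<partial>leb t) \<le> M * ((2 * k * t) ^ Suc n / fact (Suc n))" by simp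
      have "pt t f x \<le> pt t (\<lambda>_. 0) x"
        using t' x B f fm by (intro pt_mono[where B = B and C = 0]) auto
      then show "W t x \<le> M * ((2 * k * t) ^ Suc n / fact (Suc n))"
        using I mild_eq[OF W t' x] x by (simp add: pt_const)
    qed
  qed
  have "(\<lambda>n. M * ((2 * k * t) ^ n / fact n)) \<longlonglongrightarrow> M * 0"
    using summable_LIMSEQ_zero[OF summable_exp[of "2 * k * t"]]
    by (intro tendsto_intros) (simp add: divide_inverse mult.commute)
  then have "W t x \<le> 0"
    using it t x by (intro LIMSEQ_le_const[where X = "\<lambda>n. M * ((2 * k * t) ^ n / fact n)"]) auto
  then show ?thesis by (simp add: W_def mult_le_0_iff)
qed

end

section \<open>Bounds for the log-Laplace functional\<close>

lemma C_b_measurable: "f \<in> C_b E \<Longrightarrow> f \<in> borel_measurable (borel_on E)"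
  by (auto simp: C_b_def intro: borel_measurable_continuous_on_restrict)

lemma C_b_bounded: "f \<in> C_b E \<Longrightarrow> \<exists>B>0. \<forall>x\<in>E. \<bar>f x\<bar> \<le> B"
  by (auto simp: C_b_def bounded_pos)

lemma set_integral_singleton: "(LINT s:{c::real}|lborel. (f s :: real)) = 0"
  unfolding set_lebesgue_integral_def
  by (rule integral_eq_zero_AE) (use AE_lborel_singleton[of c] in \<open>auto elim!: eventually_mono\<close>)

text \<open>The explicit solution of the Bernoulli equation y' = - l y - q y^2 that explodes at time
  - \<delta>. The parameter \<delta> adjusts the initial value, and \<delta> = 0 corresponds to an
  infinite one.\<close>

lemma logistic_derivative:
  fixes l q s :: real
  assumes "l > 0" "q > 0" "s + \<delta> > 0"
  defines "y \<equiv> \<lambda>s. (l / q) / (exp (l * (s + \<delta>)) - 1)"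
  shows "(y has_real_derivative - y s * (l + q * y s)) (at s)" and "y s > 0"
proof -
  define e where "e = exp (l * (s + \<delta>))"
  have e: "e > 1" using assms by (simp add: e_def)
  have "((\<lambda>s. exp (l * (s + \<delta>)) - 1) has_real_derivative l * e) (at s)"
    by (auto intro!: derivative_eq_intros simp: e_def)
  moreover have "exp (l * (s + \<delta>)) - 1 \<noteq> 0" using e unfolding e_def by linarith
  ultimately have "((\<lambda>s. l / q * inverse (exp (l * (s + \<delta>)) - 1)) has_real_derivative
      l / q * - (inverse (exp (l * (s + \<delta>)) - 1) * (l * e) * inverse (exp (l * (s + \<delta>)) - 1))) (at s)"
    by (intro DERIV_cmult DERIV_inverse')
  then
  have "(y has_real_derivative l / q * - (inverse (e - 1) * (l * e) * inverse (e - 1))) (at s)"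
    by (simp add: y_def e_def divide_inverse)
  moreover have "l / q * - (inverse (e - 1) * (l * e) * inverse (e - 1)) =
      - ((l / q) / (e - 1)) * (l + q * ((l / q) / (e - 1)))"
  proof -
    have "l + q * ((l / q) / (e - 1)) = l * e / (e - 1)" using e assms(2) by (simp add: field_simps)
    then show ?thesis by (simp add: divide_inverse)
  qed
  ultimately show "(y has_real_derivative - y s * (l + q * y s)) (at s)" by (simp add: y_def e_def)
  show "y s > 0" using e assms by (simp add: y_def e_def)
qed

context markov_motion
begin

text \<open>Translates the path integrals in the definitions of generator and log-Laplace solution
  into the semigroup form of the mild equation.\<close>

lemma path_Fubini:
  assumes G: "jmeas E T G" and t: "0 \<le> t" "t \<le> T" and x: "x \<in> E"
  shows "(\<integral>\<omega>. (\<integral>s. G (t - s) (\<omega> s) \<partial>leb t) \<partial>P x) = (\<integral>s. pt s (G (t - s)) x \<partial>leb t)"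
    and "integrable (P x) (\<lambda>\<omega>. \<integral>s. G (t - s) (\<omega> s) \<partial>leb t)"
proof -
  interpret prob_space "P x" by (rule prob_space_P[OF x])
  obtain B where B: "B \<ge> 0" "\<forall>t\<in>{0..T}. \<forall>x\<in>E. \<bar>G t x\<bar> \<le> B" using jmeas_bound[OF G] by auto
  have s: "snd \<in> borel_measurable (P x \<Otimes>\<^sub>M leb t)"
    by (rule measurable_compose[OF measurable_snd, of "\<lambda>x. x"]) (simp add: measurable_restrict_space1)
  have f: "fst \<in> P x \<Otimes>\<^sub>M leb t \<rightarrow>\<^sub>M path_space E {0..}"
    by (rule measurable_compose[OF measurable_fst, of "\<lambda>x. x"]) (simp add: measurable_ident_sets sets_P[OF x])
  have m: "(\<lambda>(\<omega>, s). G (t - s) (\<omega> s)) \<in> borel_measurable (P x \<Otimes>\<^sub>M leb t)"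
    unfolding case_prod_beta using t
    by (intro jmeas_measurable[OF G] measurable_path_eval[OF f s] borel_measurable_diff borel_measurable_const s)
       (auto simp: space_pair_measure)
  have b: "\<bar>G (t - s) (\<omega> s)\<bar> \<le> B" if "\<omega> \<in> space (P x)" "s \<in> space (leb t)" for \<omega> s
    using that t B path_in[OF x that(1), of s] by auto
  show "(\<integral>\<omega>. (\<integral>s. G (t - s) (\<omega> s) \<partial>leb t) \<partial>P x) = (\<integral>s. pt s (G (t - s)) x \<partial>leb t)"
    unfolding pt_def by (rule Fubini_bounded[OF finite_measure_axioms finite_leb m, where B = B]) (rule b)
  show "integrable (P x) (\<lambda>\<omega>. \<integral>s. G (t - s) (\<omega> s) \<partial>leb t)"
  proof (rule integrable_bounded[OF finite_measure_axioms, where B = "B * t"])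
    show "(\<lambda>\<omega>. \<integral>s. G (t - s) (\<omega> s) \<partial>leb t) \<in> borel_measurable (P x)"
      using sigma_finite_measure.borel_measurable_lebesgue_integral[OF finite_measure.axioms(1)[OF finite_leb] m] .
    fix \<omega> assume \<omega>: "\<omega> \<in> space (P x)"
    have "(\<lambda>s. G (t - s) (\<omega> s)) \<in> borel_measurable (leb t)"
      using measurable_compose[OF measurable_Pair1'[OF \<omega>] m] by simp
    then have "integrable (leb t) (\<lambda>s. G (t - s) (\<omega> s))"
      by (rule integrable_bounded[OF finite_leb]) (rule b[OF \<omega>])
    then have "(\<integral>s. \<bar>G (t - s) (\<omega> s)\<bar> \<partial>leb t) \<le> (\<integral>s. B \<partial>leb t)"
      using b[OF \<omega>] finite_measure.integrable_const[OF finite_leb]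
      by (intro integral_mono) auto
    then have "(\<integral>s. \<bar>G (t - s) (\<omega> s)\<bar> \<partial>leb t) \<le> B * t" using t by (simp add: measure_restrict_space mult.commute)
    then show "\<bar>\<integral>s. G (t - s) (\<omega> s) \<partial>leb t\<bar> \<le> B * t"
      using integral_abs_bound[of "leb t" "\<lambda>s. G (t - s) (\<omega> s)"] by linarith
  qed
qed

text \<open>Dynkin's formula: the martingale in the definition of the generator has mean zero. A
  function in the domain is thus a time-independent solution with source minus its generator, which
  is how it enters the comparison arguments.\<close>

lemma mild_generator:
  assumes gen: "has_generator E P \<phi> g"
  shows "mild T \<phi> (\<lambda>_ x. - g x) (\<lambda>_. \<phi>)"
proof -
  have C: "\<phi> \<in> C_b E" "g \<in> C_b E" using gen by (auto simp: has_generator_def)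
  obtain B where B: "\<forall>x\<in>E. \<bar>\<phi> x\<bar> \<le> B" using C_b_bounded[OF C(1)] by auto
  obtain B' where B': "\<forall>x\<in>E. \<bar>g x\<bar> \<le> B'" using C_b_bounded[OF C(2)] by auto
  have jg: "jmeas E T (\<lambda>_. g)" for T using C_b_measurable[OF C(2)] B' by (intro jmeas_space) auto
  have "\<phi> x = pt t \<phi> x + (\<integral>s. pt s (\<lambda>x. - g x) x \<partial>leb t)" if t: "0 \<le> t" and x: "x \<in> E" for t x
  proof -
    interpret prob_space "P x" by (rule prob_space_P[OF x])
    define M where "M t \<omega> = \<phi> (\<omega> t) - \<phi> x - (LINT s:{0..t}|lborel. g (\<omega> s))" for t :: real and \<omega> :: "'a path"
    have mart: "martingale (\<lambda>t. filt E (ennreal t)) (P x) M"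
      using gen x unfolding has_generator_def M_def by auto
    have sub: "subalgebra (P x) (filt E (ennreal 0))" by (rule subalgebra_filt[OF sets_P[OF x]])
    have "finite_measure_subalgebra (P x) (filt E (ennreal 0))"
      using sub by unfold_locales
    then interpret finite_measure_subalgebra "P x" "filt E (ennreal 0)" .
    have Mt: "integrable (P x) (M t)" "AE \<omega> in P x. real_cond_exp (P x) (filt E (ennreal 0)) (M t) \<omega> = M 0 \<omega>"
      using mart t unfolding martingale_def by auto
    \<comment> \<open>The martingale starts from 0, because the path starts at x almost surely and
      the time integral is over a single point.\<close>
    have "AE \<omega> in P x. M 0 \<omega> = 0"
      using AE_start[OF x] by eventually_elim (simp add: M_def set_integral_singleton)
    then have "(\<integral>\<omega>. real_cond_exp (P x) (filt E (ennreal 0)) (M t) \<omega> \<partial>P x) = (\<integral>\<omega>. 0 \<partial>P x)"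
      using Mt(2) by (intro integral_cong_AE) (auto intro: borel_measurable_cond_exp2)
    then have 0: "(\<integral>\<omega>. M t \<omega> \<partial>P x) = 0" using real_cond_exp_int(2)[OF Mt(1)] by simp
    have i1: "integrable (P x) (\<lambda>\<omega>. \<phi> (\<omega> t))"
      using t x B C_b_measurable[OF C(1)] by (intro pt_integrable[where B = B]) auto
    note i2 = path_Fubini[OF jg t order_refl x]
    have "(\<integral>\<omega>. M t \<omega> \<partial>P x) = (\<integral>\<omega>. \<phi> (\<omega> t) - \<phi> x \<partial>P x) - (\<integral>\<omega>. (\<integral>s. g (\<omega> s) \<partial>leb t) \<partial>P x)"
      unfolding M_def integral_leb_set[symmetric] using i1 i2(2) by (intro Bochner_Integration.integral_diff) auto
    also have "(\<integral>\<omega>. \<phi> (\<omega> t) - \<phi> x \<partial>P x) = pt t \<phi> x - \<phi> x"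
      using i1 by (simp add: pt_def prob_space)
    finally show ?thesis using 0 i2(1) pt_cmult[of _ "-1" g x] by simp
  qed
  moreover have "jmeas E T (\<lambda>_. \<phi>)" using C_b_measurable[OF C(1)] B by (intro jmeas_space) auto
  ultimately show ?thesis
    using C_b_measurable[OF C(1)] B jmeas_minus[OF jg] unfolding mild_def by auto
qed

end

text \<open>The hypotheses in quantitative form. Substituting u = y / \<alpha> with y depending on
  time only into the log-Laplace equation leaves the equation y' = - (\<beta> - \<alpha> L(1 /
  \<alpha>)) y - y^2; K bounds its linear coefficient.\<close>

locale branching = markov_motion E P
  for E :: "'a::euclidean_space set" and P +
  fixes \<alpha> \<beta> \<phi>0 L\<phi> L\<alpha> :: "'a \<Rightarrow> real" and lam0 a A Bb C1 C2 K :: real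
  assumes \<alpha>_C: "\<alpha> \<in> C_b E" and \<beta>_C: "\<beta> \<in> C_b E" and lam0: "lam0 > 0"
    and a: "0 < a" "\<And>x. x \<in> E \<Longrightarrow> a \<le> \<alpha> x" and A: "\<And>x. x \<in> E \<Longrightarrow> \<alpha> x \<le> A"
    and Bb: "\<And>x. x \<in> E \<Longrightarrow> \<bar>\<beta> x\<bar> \<le> Bb"
    and C1: "0 < C1" "\<And>x. x \<in> E \<Longrightarrow> C1 \<le> \<phi>0 x" and C2: "\<And>x. x \<in> E \<Longrightarrow> \<phi>0 x \<le> C2"
    and L\<phi>: "has_generator E P \<phi>0 L\<phi>" "\<And>x. x \<in> E \<Longrightarrow> L\<phi> x = (\<beta> x - lam0) * \<phi>0 x"
    and L\<alpha>: "has_generator E P (\<lambda>x. 1 / \<alpha> x) L\<alpha>"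
    and K: "0 < K" "\<And>x. x \<in> E \<Longrightarrow> \<bar>\<beta> x - \<alpha> x * L\<alpha> x\<bar> \<le> K"
begin

lemma \<alpha>_pos: "x \<in> E \<Longrightarrow> 0 < \<alpha> x"
  using a by force

lemma \<phi>0_pos: "x \<in> E \<Longrightarrow> 0 < \<phi>0 x"
  using C1 by force

lemma jmeas_\<alpha>: "jmeas E T (\<lambda>_. \<alpha>)"
  using C_b_measurable[OF \<alpha>_C] C_b_bounded[OF \<alpha>_C] by (auto intro: jmeas_space)

lemma jmeas_\<beta>: "jmeas E T (\<lambda>_. \<beta>)"
  using C_b_measurable[OF \<beta>_C] Bb by (auto intro: jmeas_space)

text \<open>The factorisation psi(u) - psi(z) = (\<beta> + \<alpha> (u + z)) (u - z) makes
  differences of log-Laplace solutions solve linear equations. The function p stands for the sum u +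
  z, and its bound yields the constant for \<open>mild_comparison\<close>.\<close>

lemma branching_comparison:
  assumes w: "mild T f G w" and f: "\<And>x. x \<in> E \<Longrightarrow> f x \<le> 0" and p: "jmeas E T p"
    and G: "\<And>t x. 0 \<le> t \<Longrightarrow> t \<le> T \<Longrightarrow> x \<in> E \<Longrightarrow> G t x \<le> - (\<beta> x + \<alpha> x * p t x) * w t x"
    and t: "0 \<le> t" "t \<le> T" and x: "x \<in> E"
  shows "w t x \<le> 0"
proof -
  have "jmeas E T (\<lambda>t x. \<beta> x + \<alpha> x * p t x)"
    by (rule jmeas_add[OF jmeas_\<beta> jmeas_mult[OF jmeas_\<alpha> p]])
  then obtain k where "\<forall>t\<in>{0..T}. \<forall>x\<in>E. \<bar>\<beta> x + \<alpha> x * p t x\<bar> \<le> k" using jmeas_bound by blast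
  then show ?thesis using t x G by (intro mild_comparison[OF w f, where k = k and \<kappa> = "\<lambda>t x. \<beta> x + \<alpha> x * p t x"]) auto
qed

abbreviation log_laplace :: "real \<Rightarrow> (real \<Rightarrow> 'a \<Rightarrow> real) \<Rightarrow> bool" where
  "log_laplace n u \<equiv> log_laplace_solution E P \<alpha> \<beta> (\<lambda>_. n) (\<lambda>_. 0) u"

lemma log_laplace_mild:
  assumes u: "log_laplace n u" and T: "0 \<le> T"
  shows "mild T (\<lambda>_. n) (\<lambda>t x. - psi \<alpha> \<beta> x (u t x)) u"
proof -
  have ju: "jmeas E T u" for T
  proof -
    have "snd \<in> restrict_space borel {0..T} \<Otimes>\<^sub>M borel_on E \<rightarrow>\<^sub>M borel"
      by (rule measurable_compose[OF measurable_snd, of "\<lambda>x. x"]) (simp add: measurable_restrict_space1)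
    then have "(\<lambda>p. (fst p, snd p)) \<in> restrict_space borel {0..T} \<Otimes>\<^sub>M borel_on E \<rightarrow>\<^sub>M borel \<Otimes>\<^sub>M borel"
      by (intro measurable_Pair measurable_fst_time)
    then have "(\<lambda>p. p) \<in> restrict_space borel {0..T} \<Otimes>\<^sub>M borel_on E \<rightarrow>\<^sub>M restrict_space borel ({0..} \<times> E)"
      by (intro measurable_restrict_space2) (auto simp: space_pair_measure borel_prod)
    moreover have "(\<lambda>(t, x). u t x) \<in> borel_measurable (restrict_space borel ({0..} \<times> E))"
      using u by (simp add: log_laplace_solution_def)
    ultimately have "(\<lambda>(t, x). u t x) \<in> borel_measurable (restrict_space borel {0..T} \<Otimes>\<^sub>M borel_on E)"
      by (rule measurable_compose)
    moreover have "\<forall>T. \<exists>C. \<forall>t\<in>{0..T}. \<forall>x\<in>E. u t x \<le> C" using u by (simp add: log_laplace_solution_def)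
    then obtain C where "\<forall>t\<in>{0..T}. \<forall>x\<in>E. u t x \<le> C" by blast
    moreover have "\<forall>t\<ge>0. \<forall>x\<in>E. 0 \<le> u t x" using u by (simp add: log_laplace_solution_def)
    ultimately show ?thesis unfolding jmeas_def by (auto intro!: exI[of _ C])
  qed
  have jp: "jmeas E T (\<lambda>t x. psi \<alpha> \<beta> x (u t x))" for T
    unfolding psi_def power2_eq_square
    by (intro jmeas_add jmeas_mult jmeas_\<alpha> jmeas_\<beta> ju)
  have "u t x = pt t (\<lambda>_. n) x + (\<integral>s. pt s (\<lambda>x. - psi \<alpha> \<beta> x (u (t - s) x)) x \<partial>leb t)" if t: "0 \<le> t" and x: "x \<in> E" for t x
  proof -
    interpret prob_space "P x" by (rule prob_space_P[OF x])
    have "u t x + (\<integral>\<omega>. (\<integral>s\<in>{0..t}. psi \<alpha> \<beta> (\<omega> s) (u (t - s) (\<omega> s)) \<partial>lborel) \<partial>P x) =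
        (\<integral>\<omega>. (n + (\<integral>s\<in>{0..t}. 0 \<partial>lborel)) \<partial>P x)"
      using u t x unfolding log_laplace_solution_def by blast
    then have "u t x + (\<integral>\<omega>. (\<integral>s. psi \<alpha> \<beta> (\<omega> s) (u (t - s) (\<omega> s)) \<partial>leb t) \<partial>P x) = n"
      by (simp add: integral_leb_set[symmetric] prob_space)
    also have "(\<integral>\<omega>. (\<integral>s. psi \<alpha> \<beta> (\<omega> s) (u (t - s) (\<omega> s)) \<partial>leb t) \<partial>P x) = (\<integral>s. pt s (\<lambda>x. psi \<alpha> \<beta> x (u (t - s) x)) x \<partial>leb t)"
      by (rule path_Fubini(1)[OF jp t order_refl x])
    finally show ?thesis using pt_cmult[of _ "-1" _ x] x by (simp add: pt_const)
  qed
  then show ?thesis using ju jmeas_minus[OF jp] unfolding mild_def by auto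
qed

lemma log_laplace_nonneg: "log_laplace n u \<Longrightarrow> 0 \<le> t \<Longrightarrow> x \<in> E \<Longrightarrow> 0 \<le> u t x"
  by (simp add: log_laplace_solution_def)

text \<open>The solution of y' = - lam0 y - a C1 y^2 with infinite initial value, times the upper
  bound C2 of \<phi>0.\<close>

definition ubound :: "real \<Rightarrow> real" where
  "ubound t = C2 * (lam0 / (a * C1)) / (exp (lam0 * t) - 1)"

text \<open>The supersolution is y(t) \<phi>0 with y logistic. Since L \<phi>0 = (\<beta> - lam0)
  \<phi>0, the potential \<beta> is replaced by the constant lam0, and the quadratic coefficient
  \<alpha> \<phi>0 is at least q = a C1.\<close>

lemma log_laplace_upper:
  assumes u: "log_laplace n u" and n: "n > 0" and t: "t > 0" and x: "x \<in> E"
  shows "u t x \<le> ubound t"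
proof -
  define q where "q = a * C1"
  have q: "q > 0" using a C1 by (simp add: q_def)
  \<comment> \<open>Chosen such that y 0 = n / C1, hence y 0 * \<phi>0 \<ge> n; \<delta> is then the
    shift with exp (lam0 \<delta>) - 1 = r.\<close>
  define r where "r = lam0 * C1 / (q * n)"
  have r: "r > 0" using lam0 C1 q n by (simp add: r_def)
  define \<delta> where "\<delta> = ln (1 + r) / lam0"
  have \<delta>: "\<delta> > 0" "exp (lam0 * \<delta>) - 1 = r" using r lam0 by (auto simp: \<delta>_def)
  define y where "y s = (lam0 / q) / (exp (lam0 * (s + \<delta>)) - 1)" for s
  define y' where "y' s = - y s * (lam0 + q * y s)" for s
  have d: "(y has_real_derivative y' s) (at s)" and y: "y s > 0" if "s \<ge> 0" for s
    using logistic_derivative[of lam0 q s \<delta>] lam0 q \<delta> that unfolding y_def y'_def by auto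
  have cy: "continuous_on {0..} y"
    using d by (intro continuous_at_imp_continuous_on ballI DERIV_isCont) auto
  have cy': "continuous_on {0..} y'" unfolding y'_def by (intro continuous_intros cy)
  define z where "z s x = y s * \<phi>0 x" for s x
  have z: "mild t (\<lambda>x. y 0 * \<phi>0 x) (\<lambda>s x. y' s * \<phi>0 x + y s * - L\<phi> x) z"
    unfolding z_def using t d by (intro mild_mult_time_Icc mild_generator[OF L\<phi>(1)] cy') auto
  have um: "mild t (\<lambda>_. n) (\<lambda>s x. - psi \<alpha> \<beta> x (u s x)) u" using t by (intro log_laplace_mild[OF u]) auto
  have p: "jmeas E t (\<lambda>s x. u s x + z s x)" using um z by (auto simp: mild_def intro!: jmeas_add)
  have "u t x - z t x \<le> 0"
  proof (rule branching_comparison[OF mild_diff[OF um z] _ p])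
    show "n - y 0 * \<phi>0 x \<le> 0" if x: "x \<in> E" for x
    proof -
      have "y 0 = n / C1" using q r n C1(1) \<delta>(2) lam0 by (simp add: y_def r_def)
      then have "n = C1 * y 0" using C1(1) by simp
      also have "\<dots> \<le> \<phi>0 x * y 0" using C1(2)[OF x] y[of 0] by (intro mult_right_mono) auto
      finally show ?thesis by (simp add: mult.commute)
    qed
    fix s :: real and x assume s: "0 \<le> s" and x: "x \<in> E"
    \<comment> \<open>The only inequality involved: y(t) \<phi>0 exceeds an exact solution by the
      source (\<alpha> \<phi>0 - q) y^2 \<phi>0 \<ge> 0; the rest is algebra.\<close>
    have "q * ((y s)\<^sup>2 * \<phi>0 x) \<le> (\<alpha> x * \<phi>0 x) * ((y s)\<^sup>2 * \<phi>0 x)"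
      using a(1) a(2)[OF x] C1(1) C1(2)[OF x] unfolding q_def
      by (intro mult_right_mono mult_mono) auto
    then show "- psi \<alpha> \<beta> x (u s x) - (y' s * \<phi>0 x + y s * - L\<phi> x)
        \<le> - (\<beta> x + \<alpha> x * (u s x + z s x)) * (u s x - z s x)"
      unfolding L\<phi>(2)[OF x] psi_def y'_def z_def by (simp add: algebra_simps power2_eq_square)
  qed (use t x in auto)
  then have "u t x \<le> y t * \<phi>0 x" by (simp add: z_def)
  also have "\<dots> \<le> y t * C2" using y[of t] t C2[OF x] by (intro mult_left_mono) auto
  \<comment> \<open>Dropping \<delta>, which depends on n, makes the bound uniform in the initial
    value.\<close>
  also have "y t \<le> (lam0 / q) / (exp (lam0 * t) - 1)"
    unfolding y_def using lam0 q t \<delta> by (intro divide_left_mono mult_pos_pos) auto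
  finally show ?thesis
    using C2[OF x] \<phi>0_pos[OF x] by (simp add: ubound_def q_def mult_right_mono mult.commute)
qed

text \<open>The subsolution is y / \<alpha> with y' = - K y - y^2, because K \<ge> \<beta> -
  \<alpha> L(1 / \<alpha>). The estimate is needed for the Lipschitz bound, where \<alpha> u acts as
  a killing rate and has to be large at small times.\<close>

lemma log_laplace_lower:
  assumes u: "log_laplace n u" and n: "n > 0" and t: "t \<ge> 0" and x: "x \<in> E"
  shows "K / (exp (K * (t + 1 / (n * a))) - 1) \<le> \<alpha> x * u t x"
proof -
  \<comment> \<open>With exp (K \<delta>) - 1 \<ge> K \<delta> this gives y 0 \<le> 1 / \<delta> = n
    a \<le> n \<alpha>, so the subsolution starts below n.\<close>
  define \<delta> where "\<delta> = 1 / (n * a)"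
  have \<delta>: "\<delta> > 0" using n a by (simp add: \<delta>_def)
  define y where "y s = (K / 1) / (exp (K * (s + \<delta>)) - 1)" for s
  define y' where "y' s = - y s * (K + 1 * y s)" for s
  have d: "(y has_real_derivative y' s) (at s)" and y: "y s > 0" if "s \<ge> 0" for s
    using logistic_derivative[of K 1 s \<delta>] K(1) \<delta> that unfolding y_def y'_def by auto
  have cy: "continuous_on {0..} y"
    using d by (intro continuous_at_imp_continuous_on ballI DERIV_isCont) auto
  have cy': "continuous_on {0..} y'" unfolding y'_def by (intro continuous_intros cy)
  define z where "z s x = y s * (1 / \<alpha> x)" for s x
  have z: "mild t (\<lambda>x. y 0 * (1 / \<alpha> x)) (\<lambda>s x. y' s * (1 / \<alpha> x) + y s * - L\<alpha> x) z"
    unfolding z_def using t d by (intro mild_mult_time_Icc mild_generator[OF L\<alpha>] cy') auto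
  have um: "mild t (\<lambda>_. n) (\<lambda>s x. - psi \<alpha> \<beta> x (u s x)) u" using t by (intro log_laplace_mild[OF u]) auto
  have p: "jmeas E t (\<lambda>s x. u s x + z s x)" using um z by (auto simp: mild_def intro!: jmeas_add)
  have "z t x - u t x \<le> 0"
  proof (rule branching_comparison[OF mild_diff[OF z um] _ p])
    show "y 0 * (1 / \<alpha> x) - n \<le> 0" if x: "x \<in> E" for x
    proof -
      have "K * \<delta> \<le> exp (K * \<delta>) - 1" using exp_ge_add_one_self[of "K * \<delta>"] by linarith
      then have "K / (exp (K * \<delta>) - 1) \<le> K / (K * \<delta>)"
        using K(1) \<delta> by (intro divide_left_mono mult_pos_pos) auto
      then have "y 0 \<le> K / (K * \<delta>)" by (simp add: y_def)
      also have "\<dots> = n * a" using K(1) n a by (simp add: \<delta>_def)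
      also have "\<dots> \<le> n * \<alpha> x" using a(2)[OF x] n by simp
      finally show ?thesis using \<alpha>_pos[OF x] by (simp add: field_simps)
    qed
    fix s :: real and x assume s: "0 \<le> s" and x: "x \<in> E"
    have "L\<alpha> x * \<alpha> x \<ge> \<beta> x - K" using K(2)[OF x] by (simp add: mult.commute abs_le_iff)
    then have "y s * (\<beta> x - K) \<le> y s * (L\<alpha> x * \<alpha> x)" using y[OF s] by (intro mult_left_mono) auto
    then have "(y s * (\<beta> x - K)) / \<alpha> x \<le> (y s * (L\<alpha> x * \<alpha> x)) / \<alpha> x" using \<alpha>_pos[OF x] by (intro divide_right_mono) auto
    then have "(y s * (\<beta> x - K)) / \<alpha> x \<le> y s * L\<alpha> x" using \<alpha>_pos[OF x] by simp
    moreover have "y' s * (1 / \<alpha> x) + \<beta> x * z s x + \<alpha> x * (z s x)\<^sup>2 = (y s * (\<beta> x - K)) / \<alpha> x"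
      unfolding y'_def z_def using \<alpha>_pos[OF x] by (simp add: field_simps power2_eq_square)
    ultimately show "y' s * (1 / \<alpha> x) + y s * - L\<alpha> x - - psi \<alpha> \<beta> x (u s x)
        \<le> - (\<beta> x + \<alpha> x * (u s x + z s x)) * (z s x - u s x)"
      unfolding psi_def by (simp add: algebra_simps power2_eq_square)
  qed (use t x in auto)
  then have "y t / \<alpha> x \<le> u t x" by (simp add: z_def)
  then have "y t \<le> \<alpha> x * u t x" using \<alpha>_pos[OF x] by (simp add: pos_divide_le_eq mult.commute)
  then show ?thesis by (simp add: y_def \<delta>_def)
qed

text \<open>The difference of u and its shift by e solves a linear equation with potential \<beta> +
  \<alpha> (u(s) + u(e + s)). It starts with size up to n, but by \<open>log_laplace_lower\<close>
  the potential near time 0 is so strong that a supersolution m / \<alpha> decays to order e + 1 /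
  (n a). Division by \<alpha> again leaves K as the only trace of L.\<close>

lemma log_laplace_Lipschitz:
  assumes u: "log_laplace n u" and n: "n > 0" and t: "t > 0" and e: "e \<ge> 0" and x: "x \<in> E"
  shows "u t x - u (t + e) x \<le> A * K\<^sup>2 / a\<^sup>2 * (e + 1 / (n * a)) * exp (K * t) / (1 - exp (- K * t))\<^sup>2"
proof -
  define \<delta> where "\<delta> = 1 / (n * a)"
  have \<delta>: "\<delta> > 0" using n a by (simp add: \<delta>_def)
  \<comment> \<open>The integrating factor of the lower bound: p' = yy p. Hence a division by p(s +
    \<delta>) p(s + e + \<delta>) produces exactly the two killing rates in m'.\<close>
  define p where "p s = 1 - exp (- K * s)" for s
  have p: "0 < p s" "p s \<le> K * s" if "s > 0" for s
    using that K(1) exp_ge_add_one_self[of "- K * s"] by (auto simp: p_def)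
  have pmono: "p r \<le> p s" if "r \<le> s" for r s using that K(1) by (simp add: p_def)
  define yy where "yy s = K / (exp (K * s) - 1)" for s
  have dp: "(p has_real_derivative yy s * p s) (at s)" if "s > 0" for s
  proof -
    define e where "e = exp (K * s)"
    have e: "e > 1" using that K(1) by (simp add: e_def)
    have "yy s * p s = K / (e - 1) * ((e - 1) / e)"
      using e by (simp add: yy_def p_def e_def exp_minus diff_divide_distrib inverse_eq_divide)
    also have "\<dots> = K / e" using e by simp
    also have "\<dots> = K * exp (- K * s)" by (simp add: e_def exp_minus divide_inverse)
    finally have "yy s * p s = K * exp (- K * s)" .
    moreover have "(p has_real_derivative K * exp (- K * s)) (at s)"
      unfolding p_def by (auto intro!: derivative_eq_intros)
    ultimately show ?thesis by simp
  qed
  \<comment> \<open>Normalised to m 0 = A n, which after division by \<alpha> \<le> A still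
    dominates n. The factor p \<delta> \<le> K \<delta> = K / (n a) cancels the n.\<close>
  define m0 where "m0 = A * n * p \<delta> * p (e + \<delta>)"
  define m where "m s = m0 * exp (K * s) / (p (s + \<delta>) * p (s + e + \<delta>))" for s
  define m' where "m' s = m s * (K - yy (s + \<delta>) - yy (s + e + \<delta>))" for s
  have A0: "A > 0" using \<alpha>_pos[OF x] A[OF x] by linarith
  have m0: "m0 > 0" using A0 n p[of \<delta>] p[of "e + \<delta>"] \<delta> e by (simp add: m0_def)
  have m: "m s > 0" if "s \<ge> 0" for s using m0 p[of "s + \<delta>"] p[of "s + e + \<delta>"] that \<delta> e by (simp add: m_def)
  have d: "(m has_real_derivative m' s) (at s)" if s: "s \<ge> 0" for s
  proof -
    have 1: "((\<lambda>s. p (s + \<delta>)) has_real_derivative yy (s + \<delta>) * p (s + \<delta>)) (at s)"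
      using DERIV_shift[THEN iffD1, OF dp[of "s + \<delta>"]] s \<delta> by auto
    have 2: "((\<lambda>s. p (s + e + \<delta>)) has_real_derivative yy (s + e + \<delta>) * p (s + e + \<delta>)) (at s)"
    proof -
      have "((\<lambda>s. p (s + (e + \<delta>))) has_real_derivative yy (s + (e + \<delta>)) * p (s + (e + \<delta>))) (at s)"
        using DERIV_shift[THEN iffD1, OF dp[of "s + (e + \<delta>)"]] s \<delta> e by auto
      then show ?thesis by (simp add: add.assoc)
    qed
    have 3: "((\<lambda>s. m0 * exp (K * s)) has_real_derivative m0 * (exp (K * s) * K)) (at s)"
      by (auto intro!: derivative_eq_intros)
    have pos: "p (s + \<delta>) > 0" "p (s + e + \<delta>) > 0" using s \<delta> e p by auto
    have X: "(M * (x * K) * (X * Y) - M * x * (y1 * X * Y + y2 * Y * X)) / (X * Y * (X * Y)) =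
        M * x / (X * Y) * (K - y1 - y2)" if "X > 0" "Y > 0" for M x X Y y1 y2 :: real
      using that by (simp add: field_simps)
    show ?thesis
      unfolding m_def[abs_def] m'_def
      by (rule DERIV_cong[OF DERIV_divide[OF 3 DERIV_mult[OF 1 2]]]) (use pos X[OF pos] in auto)
  qed
  have cyy: "continuous_on {0..} (\<lambda>s. yy (s + c))" if "c > 0" for c
    unfolding yy_def using that K(1) by (intro continuous_intros) auto
  have cm: "continuous_on {0..} m"
    using d by (intro continuous_at_imp_continuous_on ballI DERIV_isCont) auto
  have cm': "continuous_on {0..} m'"
    unfolding m'_def using cyy[of \<delta>] cyy[of "e + \<delta>"] \<delta> e by (intro continuous_intros cm) (auto simp: add.assoc)
  define z where "z s x = m s * (1 / \<alpha> x)" for s x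
  have z: "mild t (\<lambda>x. m 0 * (1 / \<alpha> x)) (\<lambda>s x. m' s * (1 / \<alpha> x) + m s * - L\<alpha> x) z"
    unfolding z_def using t d by (intro mild_mult_time_Icc mild_generator[OF L\<alpha>] cm') auto
  have um: "mild t (\<lambda>_. n) (\<lambda>s x. - psi \<alpha> \<beta> x (u s x)) u" using t by (intro log_laplace_mild[OF u]) auto
  have ue: "mild t (u e) (\<lambda>s x. - psi \<alpha> \<beta> x (u (e + s) x)) (\<lambda>s. u (e + s))"
    using t e by (intro mild_shift[OF log_laplace_mild[OF u, of "e + t"]]) auto
  have j: "jmeas E t (\<lambda>s x. u s x + u (e + s) x)" using um ue by (auto simp: mild_def intro!: jmeas_add)
  have "(u t x - u (e + t) x) - z t x \<le> 0"
  proof (rule branching_comparison[OF mild_diff[OF mild_diff[OF um ue] z] _ j])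
    show "n - u e x - m 0 * (1 / \<alpha> x) \<le> 0" if x: "x \<in> E" for x
    proof -
      have "m 0 = A * n" using p[of \<delta>] p[of "e + \<delta>"] \<delta> e by (simp add: m_def m0_def)
      then have "n \<le> m 0 * (1 / \<alpha> x)" using A[OF x] \<alpha>_pos[OF x] n by (simp add: field_simps)
      then show ?thesis using log_laplace_nonneg[OF u e x] by simp
    qed
    fix s :: real and x assume s: "0 \<le> s" and x: "x \<in> E"
    have lo: "yy (s + \<delta>) \<le> \<alpha> x * u s x" "yy (s + e + \<delta>) \<le> \<alpha> x * u (e + s) x"
      using log_laplace_lower[OF u n s x] log_laplace_lower[OF u n _ x, of "e + s"] s e
      by (auto simp: yy_def \<delta>_def add.assoc add.commute add.left_commute)
    have zp: "z s x > 0" using m[OF s] \<alpha>_pos[OF x] by (simp add: z_def)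
    define b where "b = \<beta> x - \<alpha> x * L\<alpha> x"
    have b: "K + b \<ge> 0" using K(2)[OF x] by (simp add: b_def abs_le_iff)
    have e1: "m' s * (1 / \<alpha> x) = z s x * (K - yy (s + \<delta>) - yy (s + e + \<delta>))" by (simp add: m'_def z_def)
    have e2: "m s * L\<alpha> x = z s x * (\<beta> x - b)" using \<alpha>_pos[OF x] by (simp add: z_def b_def)
    \<comment> \<open>The defect of the supersolution; its three summands are nonnegative by the
      lower bounds at times s and e + s and by the choice of K.\<close>
    have "0 \<le> z s x * ((\<alpha> x * u s x - yy (s + \<delta>)) + (\<alpha> x * u (e + s) x - yy (s + e + \<delta>)) + (K + b))"
      using zp lo b by (intro mult_nonneg_nonneg) auto
    then show "- psi \<alpha> \<beta> x (u s x) - - psi \<alpha> \<beta> x (u (e + s) x) - (m' s * (1 / \<alpha> x) + m s * - L\<alpha> x)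
       \<le> - (\<beta> x + \<alpha> x * (u s x + u (e + s) x)) * (u s x - u (e + s) x - z s x)"
      unfolding psi_def e1 mult_minus_right e2 by (simp add: algebra_simps power2_eq_square)
  qed (use t x in auto)
  then have "u t x - u (t + e) x \<le> m t * (1 / \<alpha> x)" by (simp add: z_def add.commute)
  also have "\<dots> \<le> m t * (1 / a)" using m[of t] t a(1) a(2)[OF x] by (intro mult_left_mono divide_left_mono) auto
  also have "m t \<le> m0 * exp (K * t) / (p t * p t)"
    unfolding m_def using m0 p[of t] t \<delta> e pmono[of t "t + \<delta>"] pmono[of t "t + e + \<delta>"]
    by (intro divide_left_mono mult_mono mult_pos_pos) auto
  also have "m0 \<le> A * n * (K * \<delta>) * (K * (e + \<delta>))"
    unfolding m0_def using A0 n p[of \<delta>] p[of "e + \<delta>"] \<delta> e K(1) by (intro mult_mono) auto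
  also have "A * n * (K * \<delta>) * (K * (e + \<delta>)) = A * K\<^sup>2 / a * (e + \<delta>)"
    using n by (simp add: \<delta>_def power2_eq_square)
  finally have "u t x - u (t + e) x \<le> A * K\<^sup>2 / a * (e + \<delta>) * exp (K * t) / (p t * p t) * (1 / a)"
    using a(1) p[of t] t by (simp add: divide_right_mono)
  then show ?thesis by (simp add: p_def \<delta>_def power2_eq_square mult.commute mult.left_commute)
qed

end

section \<open>Extinction of the superprocess\<close>

abbreviation mass :: "real \<Rightarrow> 'a::topological_space measure path \<Rightarrow> ennreal" where
  "mass t X \<equiv> emeasure (X t) (space (X t))"

lemma space_super_algebra [simp]: "space (super_algebra E S) = super_paths E"
  unfolding super_algebra_def by (rule space_measure_of) auto

lemma sets_super_algebra:
  "sets (super_algebra E S) = sigma_sets (super_paths E)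
     {{X \<in> super_paths E. X t \<in> B} | t B. t \<in> S \<and> B \<in> sets (finite_measures_algebra E)}"
  unfolding super_algebra_def by (rule sets_measure_of) auto

lemma space_finite_measures_algebra [simp]: "space (finite_measures_algebra E) = finite_measures E"
  unfolding finite_measures_algebra_def by (rule space_measure_of) auto

lemma
  assumes "X \<in> super_paths E" "t \<ge> 0"
  shows super_paths_finite_measures: "X t \<in> finite_measures E"
    and super_paths_space: "space (X t) = E" and super_paths_finite: "finite_measure (X t)"
    and super_paths_sets: "sets (X t) = sets (borel_on E)"
  using assms sets_eq_imp_space_eq[of "X t" "borel_on E"] by (auto simp: super_paths_def finite_measures_def)

lemma measurable_eval_super:
  assumes t: "t \<in> S" "t \<ge> 0" and A: "A \<in> sets (borel_on E)"
  shows "(\<lambda>X. emeasure (X t) A) \<in> borel_measurable (super_algebra E S)"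
proof (rule measurableI)
  fix C :: "ennreal set" assume C: "C \<in> sets borel"
  have "{\<nu> \<in> finite_measures E. emeasure \<nu> A \<in> C} \<in> sets (finite_measures_algebra E)"
    unfolding finite_measures_algebra_def using A C by (subst sets_measure_of) (auto intro!: sigma_sets.Basic)
  then have "{X \<in> super_paths E. X t \<in> {\<nu> \<in> finite_measures E. emeasure \<nu> A \<in> C}} \<in> sets (super_algebra E S)"
    unfolding sets_super_algebra using t
    by (intro sigma_sets.Basic CollectI exI[of _ t] exI[of _ "{\<nu> \<in> finite_measures E. emeasure \<nu> A \<in> C}"]) simp
  also have "{X \<in> super_paths E. X t \<in> {\<nu> \<in> finite_measures E. emeasure \<nu> A \<in> C}} =
    (\<lambda>X. emeasure (X t) A) -` C \<inter> space (super_algebra E S)"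
    using super_paths_finite_measures[OF _ t(2)] by auto
  finally show "(\<lambda>X. emeasure (X t) A) -` C \<inter> space (super_algebra E S) \<in> sets (super_algebra E S)" .
qed simp

lemma measurable_mass:
  assumes "t \<in> S" "t \<ge> 0"
  shows "mass t \<in> borel_measurable (super_algebra E S)"
proof -
  have "E \<in> sets (borel_on E)" using sets.top[of "borel_on E"] by simp
  from measurable_eval_super[OF assms this] show ?thesis
    by (rule measurable_cong[THEN iffD1, rotated]) (use super_paths_space[OF _ assms(2)] in auto)
qed

lemma mass_sets:
  assumes "t \<in> S" "t \<ge> 0" and C: "C \<in> sets borel"
  shows "{X \<in> super_paths E. mass t X \<in> C} \<in> sets (super_algebra E S)"
proof -
  have "mass t -` C \<inter> space (super_algebra E S) \<in> sets (super_algebra E S)"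
    using measurable_mass[OF assms(1,2)] C by (rule measurable_sets)
  moreover have "mass t -` C \<inter> space (super_algebra E S) = {X \<in> super_paths E. mass t X \<in> C}" by auto
  ultimately show ?thesis by simp
qed

lemma mass_sets':
  assumes "t \<ge> 0"
  shows "{X \<in> super_paths E. mass t X = 0} \<in> sets (super_algebra E {0..})"
    and "{X \<in> super_paths E. mass t X \<noteq> 0} \<in> sets (super_algebra E {0..})"
    and "{X \<in> super_paths E. mass t X < c} \<in> sets (super_algebra E {0..})"
  using mass_sets[of t "{0..}" "{0}" E] assms apply simp
  using mass_sets[of t "{0..}" "- {0}" E] assms apply simp
  using mass_sets[of t "{0..}" "{..<c}" E] assms apply simp
  done

lemma shift_in_super_paths:
  assumes X: "X \<in> super_paths E" and s: "s \<ge> 0"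
  shows "path_shift s X \<in> super_paths E"
proof -
  have "continuous_on {0..} (\<lambda>t. \<integral>y. f y \<partial>path_shift s X t)" if "f \<in> C_b E" for f
  proof -
    have "continuous_on {0..} (\<lambda>t. \<integral>y. f y \<partial>X t)" using X that by (simp add: super_paths_def)
    then have "continuous_on {0..} (\<lambda>t. \<integral>y. f y \<partial>X (s + t))"
      by (rule continuous_on_compose2) (use s in \<open>auto intro!: continuous_intros\<close>)
    then show ?thesis by (rule continuous_on_eq) (simp add: path_shift_def)
  qed
  then show ?thesis using X s by (auto simp: super_paths_def path_shift_def)
qed

lemma measurable_shift_super:
  assumes s: "s \<ge> 0"
  shows "path_shift s \<in> super_algebra E {0..} \<rightarrow>\<^sub>M super_algebra E {0..}"
  unfolding super_algebra_def[of E "{0..}"]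
proof (rule measurable_measure_of)
  fix y assume "y \<in> {{X \<in> super_paths E. X t \<in> B} | t B. t \<in> {0..} \<and> B \<in> sets (finite_measures_algebra E)}"
  then obtain t B where y: "y = {X \<in> super_paths E. X t \<in> B}" and t: "t \<ge> 0"
    and B: "B \<in> sets (finite_measures_algebra E)" by auto
  have "{X \<in> super_paths E. X (s + t) \<in> B} \<in> sets (super_algebra E {0..})"
    unfolding sets_super_algebra using s t B by (intro sigma_sets.Basic CollectI exI[of _ "s + t"] exI[of _ B]) simp
  moreover have "path_shift s -` y \<inter> super_paths E = {X \<in> super_paths E. X (s + t) \<in> B}"
    using t shift_in_super_paths[OF _ s] by (auto simp: y path_shift_def)
  ultimately show "path_shift s -` y \<inter> space (sigma (super_paths E)
     {{X \<in> super_paths E. X t \<in> B} | t B. t \<in> {0..} \<and> B \<in> sets (finite_measures_algebra E)})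
     \<in> sets (sigma (super_paths E)
     {{X \<in> super_paths E. X t \<in> B} | t B. t \<in> {0..} \<and> B \<in> sets (finite_measures_algebra E)})"
    unfolding super_algebra_def[of E "{0..}", symmetric] by simp
next
  show "path_shift s \<in> space (sigma (super_paths E)
     {{X \<in> super_paths E. X t \<in> B} | t B. t \<in> {0..} \<and> B \<in> sets (finite_measures_algebra E)}) \<rightarrow> super_paths E"
    unfolding super_algebra_def[of E "{0..}", symmetric] using shift_in_super_paths[OF _ s, where E = E] by auto
qed auto

lemma shift_super_sets:
  assumes "s \<ge> 0" "B1 \<in> sets (super_algebra E {0..})" "B2 \<in> sets (super_algebra E {0..})"
  shows "{X \<in> B1. path_shift s X \<in> B2} \<in> sets (super_algebra E {0..})"
proof -
  have "B1 \<inter> (path_shift s -` B2 \<inter> space (super_algebra E {0..})) \<in> sets (super_algebra E {0..})"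
    using measurable_sets[OF measurable_shift_super[OF assms(1)] assms(3)] assms(2) by auto
  moreover have "B1 \<inter> (path_shift s -` B2 \<inter> space (super_algebra E {0..})) = {X \<in> B1. path_shift s X \<in> B2}"
    using sets.sets_into_space[OF assms(2)] by auto
  ultimately show ?thesis by simp
qed

lemma path_shift_super: "s \<ge> 0 \<Longrightarrow> t \<ge> 0 \<Longrightarrow> mass t (path_shift s X) = mass (s + t) X"
  by (simp add: path_shift_def)

lemma return_finite_measures: "x \<in> E \<Longrightarrow> return (borel_on E) x \<in> finite_measures E"
  using prob_space.finite_measure[OF prob_space_return[of x "borel_on E"]] by (simp add: finite_measures_def)

section \<open>Extinction probabilities\<close>

locale superprocess_motion = branching E P \<alpha> \<beta> \<phi>0 L\<phi> L\<alpha> lam0 a A Bb C1 C2 K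
  for E :: "'a::euclidean_space set" and P \<alpha> \<beta> \<phi>0 L\<phi> L\<alpha> lam0 a A Bb C1 C2 K +
  fixes PP :: "'a measure \<Rightarrow> 'a measure path measure" and N :: "'a \<Rightarrow> 'a measure path measure"
  assumes super: "superprocess E P \<alpha> \<beta> PP" and canon: "canonical_measures E PP N"
begin

abbreviation SA :: "'a measure path measure" where "SA \<equiv> super_algebra E {0..}"

lemma
  assumes "\<nu> \<in> finite_measures E"
  shows prob_space_PP: "prob_space (PP \<nu>)" and sets_PP: "sets (PP \<nu>) = sets SA"
    and space_PP: "space (PP \<nu>) = super_paths E"
proof -
  have "PP \<nu> \<in> space (prob_algebra SA)"
    using super assms by (auto simp: superprocess_def intro: measurable_space)
  then show "prob_space (PP \<nu>)" "sets (PP \<nu>) = sets SA" by (auto simp: space_prob_algebra)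
  then show "space (PP \<nu>) = super_paths E" using sets_eq_imp_space_eq[of "PP \<nu>" SA] by simp
qed

text \<open>The Laplace identity is part of the description, so a single choice provides both the
  equation and its probabilistic meaning. The successor keeps the initial value positive, as the
  comparison estimates demand.\<close>

definition un :: "nat \<Rightarrow> real \<Rightarrow> 'a \<Rightarrow> real" where
  "un n = (SOME u. log_laplace (real (Suc n)) u \<and> (\<forall>\<nu>\<in>finite_measures E. \<forall>t\<ge>0.
     (\<integral>X. exp (- (real (Suc n) * measure (X t) (space (X t)))) \<partial>PP \<nu>) = exp (- (\<integral>x. u t x \<partial>\<nu>))))"

lemma un: "log_laplace (real (Suc n)) (un n)"
  and un_Laplace: "\<nu> \<in> finite_measures E \<Longrightarrow> t \<ge> 0 \<Longrightarrow>
    (\<integral>X. exp (- (real (Suc n) * measure (X t) (space (X t)))) \<partial>PP \<nu>) = exp (- (\<integral>x. un n t x \<partial>\<nu>))"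
proof -
  have bnm: "bounded_nonneg_measurable E (\<lambda>_. real (Suc n))" "bounded_nonneg_measurable E (\<lambda>_. 0)"
    by (auto simp: bounded_nonneg_measurable_def bounded_iff)
  obtain u where u: "log_laplace (real (Suc n)) u" and L: "\<forall>\<nu>\<in>finite_measures E. \<forall>t\<ge>0.
      (\<integral>X. exp (- (\<integral>y. real (Suc n) \<partial>X t) - (\<integral>s\<in>{0..t}. (\<integral>y. 0 \<partial>X s) \<partial>lborel)) \<partial>PP \<nu>) =
      exp (- (\<integral>x. u t x \<partial>\<nu>))"
    using super[unfolded superprocess_def, THEN conjunct2, THEN conjunct2, THEN spec, of "\<lambda>_. real (Suc n)",
        THEN spec, of "\<lambda>_. 0", THEN mp, OF bnm(1), THEN mp, OF bnm(2)]
    by (elim exE conjE) (rule that)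
  have "\<exists>u. log_laplace (real (Suc n)) u \<and> (\<forall>\<nu>\<in>finite_measures E. \<forall>t\<ge>0.
     (\<integral>X. exp (- (real (Suc n) * measure (X t) (space (X t)))) \<partial>PP \<nu>) = exp (- (\<integral>x. u t x \<partial>\<nu>)))"
    using u L by (intro exI[of _ u]) (simp add: mult.commute)
  from someI_ex[OF this]
  show "log_laplace (real (Suc n)) (un n)" and "\<nu> \<in> finite_measures E \<Longrightarrow> t \<ge> 0 \<Longrightarrow>
    (\<integral>X. exp (- (real (Suc n) * measure (X t) (space (X t)))) \<partial>PP \<nu>) = exp (- (\<integral>x. un n t x \<partial>\<nu>))"
    unfolding un_def[symmetric] by auto
qed

lemma un_bounds:
  assumes "t > 0" "x \<in> E"
  shows "0 \<le> un n t x" "un n t x \<le> ubound t"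
  using log_laplace_nonneg[OF un less_imp_le[OF assms(1)] assms(2)] log_laplace_upper[OF un _ assms] by simp_all

lemma C2_pos:
  assumes "E \<noteq> {}"
  shows "C2 > 0"
proof -
  obtain x where "x \<in> E" using assms by auto
  from \<phi>0_pos[OF this] C2[OF this] show ?thesis by linarith
qed

lemma ubound_nonneg: "x \<in> E \<Longrightarrow> t > 0 \<Longrightarrow> 0 \<le> ubound t"
  using un_bounds[of t x 0] by linarith

lemma ubound_mono: "E \<noteq> {} \<Longrightarrow> 0 < s \<Longrightarrow> s \<le> t \<Longrightarrow> ubound t \<le> ubound s"
  unfolding ubound_def using lam0 a C1 C2_pos by (intro divide_left_mono mult_pos_pos) auto

lemma un_measurable: "t \<ge> 0 \<Longrightarrow> un n t \<in> borel_measurable (borel_on E)"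
  using log_laplace_mild[OF un[of n], of t] jmeas_at[of E t "un n" t] by (auto simp: mild_def)

text \<open>exp (- n m) tends to 1 if m = 0 and to 0 if m > 0, so dominated convergence turns the
  Laplace functionals into an extinction probability.\<close>

lemma extinction_limit:
  assumes \<nu>: "\<nu> \<in> finite_measures E" and t: "t \<ge> 0"
  shows "(\<lambda>n. exp (- (\<integral>x. un n t x \<partial>\<nu>))) \<longlonglongrightarrow> measure (PP \<nu>) {X \<in> super_paths E. mass t X = 0}"
proof -
  interpret prob_space "PP \<nu>" by (rule prob_space_PP[OF \<nu>])
  have mm: "mass t \<in> borel_measurable (PP \<nu>)"
    using measurable_mass[of t "{0..}" E] t by (simp cong: measurable_cong_sets add: sets_PP[OF \<nu>])
  have m: "(\<lambda>X. measure (X t) (space (X t))) \<in> borel_measurable (PP \<nu>)"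
    using mm unfolding measure_def by measurable
  let ?Z = "{X \<in> super_paths E. mass t X = 0}"
  have Z: "?Z \<in> sets (PP \<nu>)" using mass_sets'(1)[OF t] by (simp add: sets_PP[OF \<nu>])
  have "(\<lambda>n. \<integral>X. exp (- (real (Suc n) * measure (X t) (space (X t)))) \<partial>PP \<nu>) \<longlonglongrightarrow> (\<integral>X. indicator ?Z X \<partial>PP \<nu>)"
  proof (rule integral_dominated_convergence[where w = "\<lambda>_. 1"])
    show "AE X in PP \<nu>. (\<lambda>n. exp (- (real (Suc n) * measure (X t) (space (X t))))) \<longlonglongrightarrow> indicator ?Z X"
    proof (rule AE_I2)
      fix X assume X: "X \<in> space (PP \<nu>)"
      then have X': "X \<in> super_paths E" by (simp add: space_PP[OF \<nu>])
      interpret X: finite_measure "X t" by (rule super_paths_finite[OF X' t])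
      show "(\<lambda>n. exp (- (real (Suc n) * measure (X t) (space (X t))))) \<longlonglongrightarrow> indicator ?Z X"
      proof (cases "mass t X = 0")
        case True
        then show ?thesis using X' by (simp add: measure_def)
      next
        case False
        then have p: "measure (X t) (space (X t)) > 0"
          by (simp add: X.emeasure_eq_measure zero_less_measure_iff)
        have "(\<lambda>n. exp (- measure (X t) (space (X t))) ^ Suc n) \<longlonglongrightarrow> 0"
          using p by (intro LIMSEQ_Suc LIMSEQ_realpow_zero) auto
        then have "(\<lambda>n. exp (- (real (Suc n) * measure (X t) (space (X t))))) \<longlonglongrightarrow> 0"
          by (simp only: exp_of_nat_mult[symmetric] mult_minus_right)
        then show ?thesis using False by simp
      qed
    qed
  qed (use m Z in auto)
  also have "(\<integral>X. indicator ?Z X \<partial>PP \<nu>) = measure (PP \<nu>) ?Z" using Z by simp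
  finally show ?thesis using un_Laplace[OF \<nu> t] by simp
qed

lemma extinction_lower:
  assumes \<nu>: "\<nu> \<in> finite_measures E" and t: "t > 0" and E: "E \<noteq> {}"
  shows "exp (- (ubound t * measure \<nu> (space \<nu>))) \<le> measure (PP \<nu>) {X \<in> super_paths E. mass t X = 0}"
proof -
  interpret \<nu>: finite_measure \<nu> using \<nu> by (simp add: finite_measures_def)
  have sp: "space \<nu> = E" and sets: "sets \<nu> = sets (borel_on E)"
    using \<nu> sets_eq_imp_space_eq[of \<nu> "borel_on E"] by (auto simp: finite_measures_def)
  have "exp (- (ubound t * measure \<nu> (space \<nu>))) \<le> exp (- (\<integral>x. un n t x \<partial>\<nu>))" for n
  proof -
    have "integrable \<nu> (un n t)"
      using un_measurable[of t n] t un_bounds[OF t] sets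
      by (intro integrable_bounded[OF \<nu>.finite_measure_axioms, where B = "ubound t"])
         (auto cong: measurable_cong_sets simp: sp)
    then have "(\<integral>x. un n t x \<partial>\<nu>) \<le> (\<integral>x. ubound t \<partial>\<nu>)"
      using un_bounds[OF t] by (intro integral_mono) (auto simp: sp)
    then show ?thesis by (simp add: mult.commute)
  qed
  then show ?thesis
    using t by (intro LIMSEQ_le_const[OF extinction_limit[OF \<nu>]]) auto
qed

text \<open>From 1 - exp (- c) \<le> c. Being linear in the initial mass, the bound can be inserted
  under the Markov property, where that mass is random.\<close>

lemma survival_bound:
  assumes \<nu>: "\<nu> \<in> finite_measures E" and t: "t > 0" and E: "E \<noteq> {}"
  shows "emeasure (PP \<nu>) {X \<in> super_paths E. mass t X \<noteq> 0} \<le> ennreal (ubound t) * emeasure \<nu> (space \<nu>)"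
proof -
  interpret prob_space "PP \<nu>" by (rule prob_space_PP[OF \<nu>])
  interpret \<nu>: finite_measure \<nu> using \<nu> by (simp add: finite_measures_def)
  let ?Z = "{X \<in> super_paths E. mass t X = 0}"
  let ?c = "ubound t * measure \<nu> (space \<nu>)"
  have Z: "?Z \<in> sets (PP \<nu>)" using mass_sets'(1)[of t E] t by (simp add: sets_PP[OF \<nu>])
  obtain x where "x \<in> E" using E by auto
  then have ub: "ubound t \<ge> 0" using ubound_nonneg t by simp
  have "1 - prob ?Z \<le> ?c"
    using extinction_lower[OF \<nu> t E] exp_ge_add_one_self[of "- ?c"] by linarith
  moreover have "{X \<in> super_paths E. mass t X \<noteq> 0} = space (PP \<nu>) - ?Z"
    by (auto simp: space_PP[OF \<nu>])
  ultimately have "prob {X \<in> super_paths E. mass t X \<noteq> 0} \<le> ?c"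
    using prob_compl[OF Z] by simp
  then show ?thesis
    using ub by (simp add: emeasure_eq_measure \<nu>.emeasure_eq_measure ennreal_mult[symmetric] ennreal_leI)
qed

lemma super_markov:
  assumes "\<nu> \<in> finite_measures E" "s \<ge> 0" "B1 \<in> sets (super_algebra E {0..s})" "B2 \<in> sets SA"
  shows "emeasure (PP \<nu>) {X \<in> B1. path_shift s X \<in> B2} = (\<integral>\<^sup>+X\<in>B1. emeasure (PP (X s)) B2 \<partial>PP \<nu>)"
  by (rule super[unfolded superprocess_def, THEN conjunct2, THEN conjunct1, THEN bspec, OF assms(1), THEN spec,
        THEN mp, OF assms(2), THEN bspec, OF assms(3), THEN bspec, OF assms(4)])

lemma finite_exists_mass_sets:
  assumes "\<And>q. q \<in> D \<Longrightarrow> 0 \<le> q" "countable D"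
  shows "{X \<in> super_paths E. \<exists>q\<in>D. mass q X < c} \<in> sets SA"
proof -
  have "(\<Union>q\<in>D. {X \<in> super_paths E. mass q X < c}) \<in> sets SA"
    using assms mass_sets'(3) by (intro sets.countable_UN'') auto
  also have "(\<Union>q\<in>D. {X \<in> super_paths E. mass q X < c}) = {X \<in> super_paths E. \<exists>q\<in>D. mass q X < c}" by auto
  finally show ?thesis .
qed

text \<open>The mass is a nonnegative supermartingale up to an exponential factor, so that after falling below
  \<open>c\<close> at some time the process survives a further time \<open>\<delta>\<close> with probability of order \<open>c\<close> only.\<close>

lemma survival_after_small_mass:
  assumes E: "E \<noteq> {}" and \<delta>: "\<delta> > 0"
  shows "\<nu> \<in> finite_measures E \<Longrightarrow> sorted qs \<Longrightarrow> (\<And>q. q \<in> set qs \<Longrightarrow> 0 \<le> q \<and> q + \<delta> \<le> T) \<Longrightarrow>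
    emeasure (PP \<nu>) {X \<in> super_paths E. mass T X \<noteq> 0 \<and> (\<exists>q\<in>set qs. mass q X < c)} \<le> ennreal (ubound \<delta>) * c"
proof (induction "length qs" arbitrary: qs \<nu> T)
  case 0
  then show ?case by simp
next
  case (Suc n)
  from Suc.hyps(2) obtain q qs' where qs: "qs = q # qs'" by (cases qs) auto
  have q: "0 \<le> q" "q + \<delta> \<le> T" using Suc.prems(3) qs by auto
  have T: "T > 0" using q \<delta> by simp
  note \<nu> = Suc.prems(1)
  interpret prob_space "PP \<nu>" by (rule prob_space_PP[OF \<nu>])
  let ?rs = "map (\<lambda>r. r - q) qs'"
  \<comment> \<open>Split at the first time q of the list. On A1 the mass is below c at q and
    \<open>survival_bound\<close> applies from there; on A2 the process restarts at q and the
    induction hypothesis covers the remaining times. Both conditional bounds are the same constant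
    and A1, A2 are disjoint, so the bound does not grow with the list.\<close>
  define A1 where "A1 = {X \<in> super_paths E. mass q X < c}"
  define A2 where "A2 = {X \<in> super_paths E. c \<le> mass q X}"
  define B1 where "B1 = {X \<in> super_paths E. mass (T - q) X \<noteq> 0}"
  define B2 where "B2 = {X \<in> super_paths E. mass (T - q) X \<noteq> 0 \<and> (\<exists>r\<in>set ?rs. mass r X < c)}"
  have rs: "sorted ?rs" "\<And>r. r \<in> set ?rs \<Longrightarrow> 0 \<le> r \<and> r + \<delta> \<le> T - q" "length ?rs = n"
    using Suc.prems(2,3) Suc.hyps(2) qs by (auto simp: sorted_map)
  have A: "A1 \<in> sets (super_algebra E {0..q})" "A2 \<in> sets (super_algebra E {0..q})"
    using mass_sets[of q "{0..q}" "{..<c}" E] mass_sets[of q "{0..q}" "{c..}" E] q by (auto simp: A1_def A2_def)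
  have sub: "sets (super_algebra E {0..q}) \<subseteq> sets SA"
    unfolding sets_super_algebra by (rule sigma_sets_mono') auto
  have B1: "B1 \<in> sets SA" unfolding B1_def using q \<delta> by (intro mass_sets') auto
  have "B2 = B1 \<inter> {X \<in> super_paths E. \<exists>r\<in>set ?rs. mass r X < c}" by (auto simp: B1_def B2_def)
  then have B2: "B2 \<in> sets SA"
    using B1 finite_exists_mass_sets[of "set ?rs" c] rs(2) by (auto simp: countable_finite)
  note shift = shift_in_super_paths[OF _ q(1)]
  have "{X \<in> super_paths E. mass T X \<noteq> 0 \<and> (\<exists>q\<in>set qs. mass q X < c)} \<subseteq>
      {X \<in> A1. path_shift q X \<in> B1} \<union> {X \<in> A2. path_shift q X \<in> B2}"
  proof
    fix X assume X: "X \<in> {X \<in> super_paths E. mass T X \<noteq> 0 \<and> (\<exists>q\<in>set qs. mass q X < c)}"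
    then have X': "X \<in> super_paths E" by simp
    have T': "mass (T - q) (path_shift q X) \<noteq> 0" using X q \<delta> by (simp add: path_shift_super)
    show "X \<in> {X \<in> A1. path_shift q X \<in> B1} \<union> {X \<in> A2. path_shift q X \<in> B2}"
    proof (cases "mass q X < c")
      case True
      then show ?thesis using X' T' shift[OF X'] by (auto simp: A1_def B1_def)
    next
      case False
      then obtain r where r: "r \<in> set qs'" "mass r X < c" using X qs by auto
      have "q \<le> r" using r Suc.prems(2) qs by auto
      then have "mass (r - q) (path_shift q X) < c" using r(2) q(1) by (simp add: path_shift_super)
      then show ?thesis using False X' T' shift[OF X'] r(1) by (auto simp: A2_def B2_def not_less)
    qed
  qed
  moreover have m: "{X \<in> A1. path_shift q X \<in> B1} \<in> sets (PP \<nu>)" "{X \<in> A2. path_shift q X \<in> B2} \<in> sets (PP \<nu>)"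
    using A B1 B2 sub q(1) by (auto simp: sets_PP[OF \<nu>] intro!: shift_super_sets)
  ultimately have "emeasure (PP \<nu>) {X \<in> super_paths E. mass T X \<noteq> 0 \<and> (\<exists>q\<in>set qs. mass q X < c)} \<le>
     emeasure (PP \<nu>) {X \<in> A1. path_shift q X \<in> B1} + emeasure (PP \<nu>) {X \<in> A2. path_shift q X \<in> B2}"
    by (intro order_trans[OF emeasure_mono emeasure_subadditive]) auto
  also have "\<dots> = (\<integral>\<^sup>+X\<in>A1. emeasure (PP (X q)) B1 \<partial>PP \<nu>) + (\<integral>\<^sup>+X\<in>A2. emeasure (PP (X q)) B2 \<partial>PP \<nu>)"
    unfolding super_markov[OF \<nu> q(1) A(1) B1] super_markov[OF \<nu> q(1) A(2) B2] ..
  also have "\<dots> \<le> (\<integral>\<^sup>+X\<in>A1. ennreal (ubound \<delta>) * c \<partial>PP \<nu>) + (\<integral>\<^sup>+X\<in>A2. ennreal (ubound \<delta>) * c \<partial>PP \<nu>)"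
  proof (intro add_mono nn_integral_mono)
    fix X assume "X \<in> space (PP \<nu>)"
    then have X: "X \<in> super_paths E" by (simp add: space_PP[OF \<nu>])
    note Xq = super_paths_finite_measures[OF X q(1)]
    have "emeasure (PP (X q)) B1 \<le> ennreal (ubound \<delta>) * c" if "X \<in> A1"
    proof -
      have "emeasure (PP (X q)) B1 \<le> ennreal (ubound (T - q)) * mass q X"
        unfolding B1_def using q \<delta> by (intro survival_bound[OF Xq _ E]) auto
      also have "\<dots> \<le> ennreal (ubound \<delta>) * c"
        using that q \<delta> ubound_mono[OF E \<delta>, of "T - q"] by (intro mult_mono ennreal_leI) (auto simp: A1_def)
      finally show ?thesis .
    qed
    then show "emeasure (PP (X q)) B1 * indicator A1 X \<le> ennreal (ubound \<delta>) * c * indicator A1 X"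
      by (auto simp: indicator_def)
    have "emeasure (PP (X q)) B2 \<le> ennreal (ubound \<delta>) * c"
      unfolding B2_def by (rule Suc.hyps(1)[OF rs(3)[symmetric] Xq rs(1,2)])
    then show "emeasure (PP (X q)) B2 * indicator A2 X \<le> ennreal (ubound \<delta>) * c * indicator A2 X"
      by (auto simp: indicator_def)
  qed
  also have "\<dots> = ennreal (ubound \<delta>) * c * (emeasure (PP \<nu>) A1 + emeasure (PP \<nu>) A2)"
    using A sub by (subst (1 2) nn_integral_cmult_indicator) (auto simp: sets_PP[OF \<nu>] distrib_left)
  also have "emeasure (PP \<nu>) A1 + emeasure (PP \<nu>) A2 = emeasure (PP \<nu>) (A1 \<union> A2)"
    using A sub by (intro plus_emeasure) (auto simp: sets_PP[OF \<nu>] A1_def A2_def)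
  also have "ennreal (ubound \<delta>) * c * \<dots> \<le> ennreal (ubound \<delta>) * c * 1"
    by (intro mult_left_mono measure_le_1) auto
  finally show ?case by simp
qed

end

section \<open>Poisson point measures and the canonical measures\<close>

lemma point_measures_sets: "\<eta> \<in> point_measures m \<Longrightarrow> sets \<eta> = sets m"
  by (auto simp: point_measures_def)

lemma point_measures_space: "\<eta> \<in> point_measures m \<Longrightarrow> space \<eta> = space m"
  using sets_eq_imp_space_eq[OF point_measures_sets] .

lemma poisson_law_measurable:
  assumes Q: "poisson_law m Q" and A: "A \<in> sets m"
  shows "(\<lambda>\<eta>. emeasure \<eta> A) \<in> borel_measurable Q"
proof (rule measurableI)
  fix C :: "ennreal set" assume C: "C \<in> sets borel"
  let ?G = "{{\<eta> \<in> point_measures m. emeasure \<eta> A \<in> C} | A C. A \<in> sets m \<and> C \<in> sets borel}"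
  have sp: "space Q = point_measures m" and se: "sets Q = sets (sigma (point_measures m) ?G)"
    using Q by (auto simp: poisson_law_def)
  have "{\<eta> \<in> point_measures m. emeasure \<eta> A \<in> C} \<in> sigma_sets (point_measures m) ?G"
    using A C by (intro sigma_sets.Basic CollectI exI[of _ A] exI[of _ C]) simp
  moreover have "sets (sigma (point_measures m) ?G) = sigma_sets (point_measures m) ?G"
    by (rule sets_measure_of) auto
  ultimately show "(\<lambda>\<eta>. emeasure \<eta> A) -` C \<inter> space Q \<in> sets Q"
    unfolding se sp by (simp add: vimage_def Int_def conj_commute)
qed simp

text \<open>The \<open>\<sigma>\<close>-field of Q is generated by the masses of measurable sets;
  the usual induction over measurable functions extends this to integrals, in particular to the mass
  of the superposition.\<close>

lemma poisson_integral_measurable: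
  assumes Q: "poisson_law m Q" and g: "g \<in> borel_measurable m"
  shows "(\<lambda>\<eta>. \<integral>\<^sup>+p. g p \<partial>\<eta>) \<in> borel_measurable Q" (is "_ \<in> ?B")
  using g
proof induct
  case (cong f g)
  have sp: "space \<eta> = space m" if "\<eta> \<in> space Q" for \<eta>
    using that Q point_measures_space[of \<eta> m] by (simp add: poisson_law_def)
  have "(\<lambda>\<eta>. \<integral>\<^sup>+p. f p \<partial>\<eta>) \<in> ?B \<longleftrightarrow> (\<lambda>\<eta>. \<integral>\<^sup>+p. g p \<partial>\<eta>) \<in> ?B"
    by (intro measurable_cong nn_integral_cong) (use sp cong in simp)
  with cong show ?case by simp
next
  case (set A)
  have se: "sets \<eta> = sets m" if "\<eta> \<in> space Q" for \<eta>
    using that Q point_measures_sets[of \<eta> m] by (simp add: poisson_law_def)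
  have "(\<lambda>\<eta>. \<integral>\<^sup>+p. indicator A p \<partial>\<eta>) \<in> ?B \<longleftrightarrow> (\<lambda>\<eta>. emeasure \<eta> A) \<in> ?B"
    by (intro measurable_cong nn_integral_indicator) (use se set in simp)
  then show ?case using poisson_law_measurable[OF Q set] by simp
next
  case (mult f c)
  have se: "f \<in> borel_measurable \<eta>" if "\<eta> \<in> space Q" for \<eta>
    using that Q point_measures_sets[of \<eta> m] mult(2) by (simp add: poisson_law_def cong: measurable_cong_sets)
  have "(\<lambda>\<eta>. \<integral>\<^sup>+p. c * f p \<partial>\<eta>) \<in> ?B \<longleftrightarrow> (\<lambda>\<eta>. c * (\<integral>\<^sup>+p. f p \<partial>\<eta>)) \<in> ?B"
    by (intro measurable_cong nn_integral_cmult) (use se in simp)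
  with mult show ?case by simp
next
  case (add f g)
  have se: "f \<in> borel_measurable \<eta>" "g \<in> borel_measurable \<eta>" if "\<eta> \<in> space Q" for \<eta>
    using that Q point_measures_sets[of \<eta> m] add by (simp_all add: poisson_law_def cong: measurable_cong_sets)
  have "(\<lambda>\<eta>. \<integral>\<^sup>+p. g p + f p \<partial>\<eta>) \<in> ?B \<longleftrightarrow> (\<lambda>\<eta>. (\<integral>\<^sup>+p. g p \<partial>\<eta>) + (\<integral>\<^sup>+p. f p \<partial>\<eta>)) \<in> ?B"
    by (intro measurable_cong nn_integral_add) (use se in simp_all)
  with add show ?case by (simp add: ac_simps)
next
  case (seq F)
  have se: "F i \<in> borel_measurable \<eta>" if "\<eta> \<in> space Q" for \<eta> i
    using that Q point_measures_sets[of \<eta> m] seq(1) by (simp add: poisson_law_def cong: measurable_cong_sets)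
  have "(\<lambda>\<eta>. \<integral>\<^sup>+p. (SUP i. F i) p \<partial>\<eta>) \<in> ?B \<longleftrightarrow> (\<lambda>\<eta>. SUP i. (\<integral>\<^sup>+p. F i p \<partial>\<eta>)) \<in> ?B"
    unfolding SUP_apply
    by (intro measurable_cong nn_integral_monotone_convergence_SUP) (use se seq in simp_all)
  with seq show ?case by (simp add: image_comp)
qed

lemma poisson_void:
  assumes Q: "poisson_law m Q" and A: "A \<in> sets m" "emeasure m A < \<infinity>"
  shows "measure Q {\<eta> \<in> space Q. emeasure \<eta> A = 0} = exp (- measure m A)"
    and "measure Q {\<eta> \<in> space Q. emeasure \<eta> A = 1} = measure m A * exp (- measure m A)"
proof -
  have "\<forall>k. measure Q {\<eta> \<in> space Q. emeasure \<eta> A = of_nat k} = measure m A ^ k / fact k * exp (- measure m A)"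
    using Q A unfolding poisson_law_def by blast
  from spec[OF this, of 0] spec[OF this, of 1]
  show "measure Q {\<eta> \<in> space Q. emeasure \<eta> A = 0} = exp (- measure m A)"
    "measure Q {\<eta> \<in> space Q. emeasure \<eta> A = 1} = measure m A * exp (- measure m A)" by simp_all
qed

lemma poisson_one_zero:
  assumes Q: "poisson_law m Q" and A: "A \<in> sets m" "emeasure m A < \<infinity>"
    and B: "B \<in> sets m" "emeasure m B < \<infinity>" and AB: "A \<inter> B = {}"
  shows "measure Q {\<eta> \<in> space Q. emeasure \<eta> A = 1 \<and> emeasure \<eta> B = 0} =
    measure m A * exp (- measure m A) * exp (- measure m B)"
proof -
  interpret prob_space Q using Q by (simp add: poisson_law_def)
  \<comment> \<open>Independence is available for families of disjoint sets indexed by natural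
    numbers; the pair A, B becomes a family over {0, 1}.\<close>
  define D where "D i = (if i = (0::nat) then A else B)" for i
  define V where "V i = (if i = (0::nat) then {1} else {0 :: ennreal})" for i
  have "indep_vars (\<lambda>_. borel) (\<lambda>i \<eta>. emeasure \<eta> (D i)) {0, 1}"
  proof -
    have "\<forall>(I :: nat set) A. finite I \<longrightarrow> A ` I \<subseteq> sets m \<longrightarrow> disjoint_family_on A I \<longrightarrow>
        indep_vars (\<lambda>_. borel) (\<lambda>i \<eta>. emeasure \<eta> (A i)) I" using Q by (simp add: poisson_law_def)
    from this[THEN spec, of "{0, 1}", THEN spec, of D] show ?thesis
      using A B AB by (auto simp: D_def disjoint_family_on_def)
  qed
  from indep_varsD[OF this, of "{0, 1}" V]
  have "prob (\<Inter>i\<in>{0,1}. (\<lambda>\<eta>. emeasure \<eta> (D i)) -` V i \<inter> space Q) =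
      (\<Prod>i\<in>{0,1}. prob ((\<lambda>\<eta>. emeasure \<eta> (D i)) -` V i \<inter> space Q))"
    by (auto simp: V_def)
  moreover have "(\<lambda>\<eta>. emeasure \<eta> (D 0)) -` V 0 \<inter> space Q = {\<eta> \<in> space Q. emeasure \<eta> A = 1}"
    "(\<lambda>\<eta>. emeasure \<eta> (D 1)) -` V 1 \<inter> space Q = {\<eta> \<in> space Q. emeasure \<eta> B = 0}"
    by (auto simp: D_def V_def)
  moreover have "{\<eta> \<in> space Q. emeasure \<eta> A = 1} \<inter> {\<eta> \<in> space Q. emeasure \<eta> B = 0} =
      {\<eta> \<in> space Q. emeasure \<eta> A = 1 \<and> emeasure \<eta> B = 0}" by auto
  ultimately show ?thesis using poisson_void[OF Q A] poisson_void[OF Q B] by simp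
qed

text \<open>A point measure is the image of a counting measure, so mass one on A means that a single
  index is mapped into A, and integration over A is evaluation at its image. The atom p does not
  depend on g, which allows one p to serve all times at once.\<close>

lemma point_measure_single_atom:
  assumes \<eta>: "\<eta> \<in> point_measures m" and A: "A \<in> sets m" and one: "emeasure \<eta> A = 1"
  shows "\<exists>p\<in>A. \<forall>g\<in>borel_measurable m. (\<integral>\<^sup>+q. g q * indicator A q \<partial>\<eta>) = g p"
proof -
  obtain J z where \<eta>: "\<eta> = distr (count_space (J :: nat set)) m z" and z: "z \<in> J \<rightarrow> space m"
    using \<eta> unfolding point_measures_def by auto
  have zm: "z \<in> count_space J \<rightarrow>\<^sub>M m" using z by (auto simp: measurable_def)
  have e: "emeasure (count_space J) (z -` A \<inter> J) = 1"
    using one A zm unfolding \<eta> by (simp add: emeasure_distr)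
  have "card (z -` A \<inter> J) = 1"
  proof (cases "finite (z -` A \<inter> J)")
    case True
    then have "of_nat (card (z -` A \<inter> J)) = (of_nat 1 :: ennreal)" using e by simp
    then show ?thesis by (simp only: of_nat_eq_iff)
  next
    case False
    then show ?thesis using e by simp
  qed
  then obtain j where j: "z -` A \<inter> J = {j}" by (auto simp: card_1_singleton_iff)
  have "(\<integral>\<^sup>+q. g q * indicator A q \<partial>\<eta>) = g (z j)" if g: "g \<in> borel_measurable m" for g
  proof -
    have "(\<integral>\<^sup>+q. g q * indicator A q \<partial>\<eta>) = (\<integral>\<^sup>+i. g (z i) * indicator A (z i) \<partial>count_space J)"
      unfolding \<eta> using zm g A by (subst nn_integral_distr) auto
    also have "\<dots> = (\<Sum>i\<in>{j}. g (z i) * indicator A (z i))"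
      using j by (intro nn_integral_count_space') (auto simp: indicator_def)
    also have "\<dots> = g (z j)"
    proof -
      have "z j \<in> A" using j by auto
      then show ?thesis by simp
    qed
    finally show ?thesis .
  qed
  then show ?thesis using j by (intro bexI[of _ "z j"]) auto
qed

lemma PiM_coord_sets:
  assumes "t \<in> I" "C \<in> sets borel"
  shows "{f \<in> space (PiM I (\<lambda>_. borel)). f t \<in> C} \<in> sets (PiM I (\<lambda>_. borel))"
proof -
  have "(\<lambda>f. f t) -` C \<inter> space (PiM I (\<lambda>_. borel)) \<in> sets (PiM I (\<lambda>_. borel))"
    using measurable_component_singleton[OF assms(1)] assms(2) by (rule measurable_sets)
  then show ?thesis by (simp add: vimage_def Int_def conj_commute)
qed

section \<open>Void probabilities of the canonical measures\<close>

context superprocess_motion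
begin

abbreviation mI :: "'a \<Rightarrow> ('a \<times> 'a measure path) measure" where
  "mI x \<equiv> canonical_intensity E N (return (borel_on E) x)"

lemma space_pair [simp]: "space (borel_on E \<Otimes>\<^sub>M SA) = E \<times> super_paths E"
  by (simp add: space_pair_measure)

lemma sets_N: "x \<in> E \<Longrightarrow> sets (N x) = sets SA"
  using canon by (simp add: canonical_measures_def)

lemma space_N: "x \<in> E \<Longrightarrow> space (N x) = super_paths E"
  using sets_eq_imp_space_eq[OF sets_N] by simp

lemma sigma_finite_N: "x \<in> E \<Longrightarrow> sigma_finite_measure (N x)"
  using canon by (simp add: canonical_measures_def)

lemma
  shows sets_mI: "sets (mI x) = sets (borel_on E \<Otimes>\<^sub>M SA)"
    and space_mI: "space (mI x) = E \<times> super_paths E"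
proof -
  show *: "sets (mI x) = sets (borel_on E \<Otimes>\<^sub>M SA)"
    unfolding canonical_intensity_def
    using sets.space_closed[of "borel_on E \<Otimes>\<^sub>M SA"] sets.sigma_sets_eq[of "borel_on E \<Otimes>\<^sub>M SA"]
    by (simp add: sets_measure_of)
  show "space (mI x) = E \<times> super_paths E" using sets_eq_imp_space_eq[OF *] by simp
qed

text \<open>\<open>canonical_intensity\<close> is introduced through \<open>measure_of\<close>,
  whose values are meaningful only once the set function is known to be countably additive. For a
  Dirac start it is the section at x measured by \<open>N x\<close>.\<close>

lemma emeasure_mI:
  assumes x: "x \<in> E" and D: "D \<in> sets (borel_on E \<Otimes>\<^sub>M SA)"
  shows "emeasure (mI x) D = emeasure (N x) (Pair x -` D)"
proof -
  \<comment> \<open>Here g is an arbitrary function, so the value is obtained from y = x almost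
    surely rather than from a rule for measurable integrands.\<close>
  have ret: "(\<integral>\<^sup>+y. g y \<partial>return (borel_on E) x) = g x" for g :: "'a \<Rightarrow> ennreal"
  proof -
    interpret prob_space "return (borel_on E) x" using x by (intro prob_space_return) simp
    have "{x} \<inter> E \<in> sets (borel_on E)" by (subst Int_commute) (rule sets_restrict_space[THEN eqset_imp_iff, THEN iffD2]; simp)
    then have "Measurable.pred (borel_on E) (\<lambda>y. y = x)"
      by (simp add: pred_def Int_def conj_commute)
    then have "AE y in return (borel_on E) x. y = x"
      using x by (subst AE_return) auto
    then have "(\<integral>\<^sup>+y. g y \<partial>return (borel_on E) x) = (\<integral>\<^sup>+y. g x \<partial>return (borel_on E) x)"
      by (intro nn_integral_cong_AE) (auto elim!: eventually_mono)
    then show ?thesis using emeasure_space_1 by simp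
  qed
  show ?thesis
  proof (rule emeasure_measure_of)
    show "mI x = measure_of (E \<times> super_paths E) (sets (borel_on E \<Otimes>\<^sub>M SA)) (\<lambda>D. emeasure (N x) (Pair x -` D))"
      unfolding canonical_intensity_def ret ..
    show "sets (borel_on E \<Otimes>\<^sub>M SA) \<subseteq> Pow (E \<times> super_paths E)"
      using sets.space_closed[of "borel_on E \<Otimes>\<^sub>M SA"] by simp
    show "D \<in> sets (mI x)" using D by (simp add: sets_mI)
    show "positive (sets (mI x)) (\<lambda>D. emeasure (N x) (Pair x -` D))" by (simp add: positive_def)
    show "countably_additive (sets (mI x)) (\<lambda>D. emeasure (N x) (Pair x -` D))"
    proof (rule countably_additiveI)
      fix F :: "nat \<Rightarrow> ('a \<times> 'a measure path) set"
      assume F: "range F \<subseteq> sets (mI x)" "disjoint_family F"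
      have "range (\<lambda>i. Pair x -` F i) \<subseteq> sets (N x)"
        using F(1) sets_Pair1[of _ "borel_on E" SA x] by (auto simp: sets_mI sets_N[OF x])
      moreover have "disjoint_family (\<lambda>i. Pair x -` F i)" using F(2) by (auto simp: disjoint_family_on_def)
      ultimately have "(\<Sum>i. emeasure (N x) (Pair x -` F i)) = emeasure (N x) (\<Union>i. Pair x -` F i)"
        by (rule suminf_emeasure)
      then show "(\<Sum>i. emeasure (N x) (Pair x -` F i)) = emeasure (N x) (Pair x -` (\<Union>i. F i))"
        by (simp add: vimage_UN)
    qed
  qed
qed

lemma cyl_sets: "B \<in> sets SA \<Longrightarrow> E \<times> B \<in> sets (mI x)"
  unfolding sets_mI using sets.top[of "borel_on E"] by (intro pair_measureI) auto

lemma emeasure_cyl: "x \<in> E \<Longrightarrow> B \<in> sets SA \<Longrightarrow> emeasure (mI x) (E \<times> B) = emeasure (N x) B"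
  using emeasure_mI[of x "E \<times> B"] cyl_sets[of B x] by (simp add: sets_mI vimage_def)

lemma measure_cyl: "x \<in> E \<Longrightarrow> B \<in> sets SA \<Longrightarrow> measure (mI x) (E \<times> B) = measure (N x) B"
  by (simp add: measure_def emeasure_cyl)

definition tmass :: "real \<Rightarrow> ('a \<times> 'a measure path) measure \<Rightarrow> ennreal" where
  "tmass t \<eta> = (\<integral>\<^sup>+p. emeasure (snd p t) E \<partial>\<eta>)"

lemma emass_measurable: "t \<ge> 0 \<Longrightarrow> (\<lambda>p. emeasure (snd p t) E) \<in> borel_measurable (mI x)"
  using measurable_compose[OF measurable_snd measurable_eval_super[of t "{0..}" E E], of "borel_on E"]
    sets.top[of "borel_on E"] by (simp cong: measurable_cong_sets add: sets_mI)

text \<open>Only total masses matter from here on, so the joint law of the masses of all Borel sets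
  is projected to the coordinates with B = E. Events may involve all positive times
  simultaneously.\<close>

lemma poisson_superposition:
  assumes x: "x \<in> E"
  obtains Q where "poisson_law (mI x) Q"
    "\<And>\<Phi>. \<Phi> \<in> sets (PiM {0<..} (\<lambda>_. borel)) \<Longrightarrow>
      emeasure Q {\<eta> \<in> space Q. (\<lambda>t\<in>{0<..}. tmass t \<eta>) \<in> \<Phi>} =
      emeasure (PP (return (borel_on E) x)) {X \<in> super_paths E. (\<lambda>t\<in>{0<..}. mass t X) \<in> \<Phi>}"
proof -
  let ?\<nu> = "return (borel_on E) x"
  let ?I = "{0<..} \<times> sets (borel_on E) :: (real \<times> 'a set) set"
  let ?W = "PiM ?I (\<lambda>_. borel :: ennreal measure)"
  let ?f = "\<lambda>\<eta>. \<lambda>(t, B)\<in>?I. \<integral>\<^sup>+p. emeasure (snd p t) B \<partial>\<eta>"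
  let ?g = "\<lambda>X. \<lambda>(t, B)\<in>?I. emeasure (X t) B"
  let ?r = "\<lambda>w. \<lambda>t\<in>{0<..}. w (t, E)"
  have \<nu>: "?\<nu> \<in> finite_measures E" by (rule return_finite_measures[OF x])
  have "\<forall>\<nu>\<in>finite_measures E. \<exists>Q. poisson_law (canonical_intensity E N \<nu>) Q \<and> distr Q ?W ?f = distr (PP \<nu>) ?W ?g"
    using canon by (simp add: canonical_measures_def)
  then obtain Q where Q: "poisson_law (mI x) Q" and eq: "distr Q ?W ?f = distr (PP ?\<nu>) ?W ?g"
    using \<nu> by blast
  have f: "?f \<in> Q \<rightarrow>\<^sub>M ?W"
  proof (rule measurable_restrict)
    fix i :: "real \<times> 'a set" assume i: "i \<in> ?I"
    have "(\<lambda>p. emeasure (snd p (fst i)) (snd i)) \<in> borel_measurable (borel_on E \<Otimes>\<^sub>M SA)"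
      using i by (intro measurable_compose[OF measurable_snd measurable_eval_super]) auto
    then have "(\<lambda>p. emeasure (snd p (fst i)) (snd i)) \<in> borel_measurable (mI x)"
      by (simp cong: measurable_cong_sets add: sets_mI)
    from poisson_integral_measurable[OF Q this]
    show "(\<lambda>\<eta>. case i of (t, B) \<Rightarrow> \<integral>\<^sup>+p. emeasure (snd p t) B \<partial>\<eta>) \<in> borel_measurable Q"
      by (simp add: case_prod_beta)
  qed
  have g: "?g \<in> PP ?\<nu> \<rightarrow>\<^sub>M ?W"
  proof (rule measurable_restrict)
    fix i :: "real \<times> 'a set" assume i: "i \<in> ?I"
    have "(\<lambda>X. emeasure (X (fst i)) (snd i)) \<in> borel_measurable SA"
      using i by (intro measurable_eval_super) auto
    then show "(\<lambda>X. case i of (t, B) \<Rightarrow> emeasure (X t) B) \<in> borel_measurable (PP ?\<nu>)"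
      by (simp cong: measurable_cong_sets add: sets_PP[OF \<nu>] case_prod_beta)
  qed
  have Et: "E \<in> sets (borel_on E)" using sets.top[of "borel_on E"] by simp
  have r: "?r \<in> ?W \<rightarrow>\<^sub>M PiM {0<..} (\<lambda>_. borel)"
    by (intro measurable_restrict measurable_component_singleton) (use Et in auto)
  have "emeasure Q {\<eta> \<in> space Q. (\<lambda>t\<in>{0<..}. tmass t \<eta>) \<in> \<Phi>} =
      emeasure (PP ?\<nu>) {X \<in> super_paths E. (\<lambda>t\<in>{0<..}. mass t X) \<in> \<Phi>}"
    if \<Phi>: "\<Phi> \<in> sets (PiM {0<..} (\<lambda>_. borel))" for \<Phi>
  proof -
    have R: "?r -` \<Phi> \<inter> space ?W \<in> sets ?W" using r \<Phi> by (rule measurable_sets)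
    have 1: "{\<eta> \<in> space Q. (\<lambda>t\<in>{0<..}. tmass t \<eta>) \<in> \<Phi>} = ?f -` (?r -` \<Phi> \<inter> space ?W) \<inter> space Q"
    proof -
      have "?r (?f \<eta>) = (\<lambda>t\<in>{0<..}. tmass t \<eta>)" for \<eta>
        using Et by (auto simp: tmass_def restrict_def fun_eq_iff)
      moreover have "?f \<eta> \<in> space ?W" if "\<eta> \<in> space Q" for \<eta> using measurable_space[OF f that] .
      ultimately show ?thesis by auto
    qed
    have 2: "{X \<in> super_paths E. (\<lambda>t\<in>{0<..}. mass t X) \<in> \<Phi>} = ?g -` (?r -` \<Phi> \<inter> space ?W) \<inter> space (PP ?\<nu>)"
    proof -
      have "?r (?g X) = (\<lambda>t\<in>{0<..}. mass t X)" if "X \<in> super_paths E" for X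
        using Et super_paths_space[OF that] by (auto simp: restrict_def fun_eq_iff)
      moreover have "?g X \<in> space ?W" if "X \<in> super_paths E" for X
        using measurable_space[OF g, of X] that by (simp add: space_PP[OF \<nu>])
      ultimately show ?thesis by (auto simp: space_PP[OF \<nu>])
    qed
    show ?thesis
      unfolding 1 2 using emeasure_distr[OF f R] emeasure_distr[OF g R] by (simp add: eq)
  qed
  with Q show ?thesis by (rule that)
qed

lemma tmass_zero_iff:
  assumes Q: "poisson_law (mI x) Q" and \<eta>: "\<eta> \<in> space Q" and t: "t \<ge> 0"
  shows "tmass t \<eta> = 0 \<longleftrightarrow> emeasure \<eta> (E \<times> {X \<in> super_paths E. mass t X \<noteq> 0}) = 0"
proof -
  have \<eta>': "\<eta> \<in> point_measures (mI x)" using Q \<eta> by (simp add: poisson_law_def)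
  have "tmass t \<eta> = 0 \<longleftrightarrow> emeasure \<eta> {p \<in> space \<eta>. emeasure (snd p t) E \<noteq> 0} = 0"
    unfolding tmass_def using emass_measurable[OF t, of x]
    by (intro nn_integral_0_iff) (simp cong: measurable_cong_sets add: point_measures_sets[OF \<eta>'])
  also have "{p \<in> space \<eta>. emeasure (snd p t) E \<noteq> 0} = E \<times> {X \<in> super_paths E. mass t X \<noteq> 0}"
  proof -
    have "emeasure (X t) E = mass t X" if "X \<in> super_paths E" for X
      using super_paths_space[OF that t] by simp
    then show ?thesis by (auto simp: point_measures_space[OF \<eta>'] space_mI)
  qed
  finally show ?thesis .
qed

text \<open>The Poissonian superposition vanishes on \<open>R\<close> iff none of its paths is alive at a time in \<open>R\<close>, so
  the probability of extinction on \<open>R\<close> is the void probability of the set on the left below.\<close>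

lemma canonical_void:
  assumes x: "x \<in> E" and R: "finite R" "R \<subseteq> {0<..}" "R \<noteq> {}"
    and p: "measure (PP (return (borel_on E) x)) {X \<in> super_paths E. \<forall>t\<in>R. mass t X = 0} > 0"
  shows "emeasure (N x) {X \<in> super_paths E. \<exists>t\<in>R. mass t X \<noteq> 0} < \<infinity>"
    and "measure (PP (return (borel_on E) x)) {X \<in> super_paths E. \<forall>t\<in>R. mass t X = 0} =
      exp (- measure (N x) {X \<in> super_paths E. \<exists>t\<in>R. mass t X \<noteq> 0})"
proof -
  obtain Q where Q: "poisson_law (mI x) Q" and law: "\<And>\<Phi>. \<Phi> \<in> sets (PiM {0<..} (\<lambda>_. borel)) \<Longrightarrow>
      emeasure Q {\<eta> \<in> space Q. (\<lambda>t\<in>{0<..}. tmass t \<eta>) \<in> \<Phi>} =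
      emeasure (PP (return (borel_on E) x)) {X \<in> super_paths E. (\<lambda>t\<in>{0<..}. mass t X) \<in> \<Phi>}"
    by (rule poisson_superposition[OF x]) (rule that, assumption)
  interpret Q: prob_space Q using Q by (simp add: poisson_law_def)
  define AR where "AR = {X \<in> super_paths E. \<exists>t\<in>R. mass t X \<noteq> 0}"
  define p where "p = measure (PP (return (borel_on E) x)) {X \<in> super_paths E. \<forall>t\<in>R. mass t X = 0}"
  have AR_eq: "AR = (\<Union>t\<in>R. {X \<in> super_paths E. mass t X \<noteq> 0})" by (auto simp: AR_def)
  have AR: "AR \<in> sets SA"
    unfolding AR_eq using R by (intro sets.finite_UN mass_sets') auto
  let ?\<Phi> = "{f \<in> space (PiM {0<..} (\<lambda>_. borel :: ennreal measure)). \<forall>t\<in>R. f t \<in> {0}}"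
  have \<Phi>: "?\<Phi> \<in> sets (PiM {0<..} (\<lambda>_. borel))"
    using R by (intro sets.sets_Collect_finite_All' PiM_coord_sets) auto
  have "{\<eta> \<in> space Q. (\<lambda>t\<in>{0<..}. tmass t \<eta>) \<in> ?\<Phi>} = {\<eta> \<in> space Q. emeasure \<eta> (E \<times> AR) = 0}"
  proof -
    have "(\<forall>t\<in>R. tmass t \<eta> = 0) \<longleftrightarrow> emeasure \<eta> (E \<times> AR) = 0" if \<eta>: "\<eta> \<in> space Q" for \<eta>
    proof -
      have sets: "sets \<eta> = sets (mI x)"
        using Q \<eta> point_measures_sets[of \<eta> "mI x"] by (simp add: poisson_law_def)
      have B: "E \<times> {X \<in> super_paths E. mass t X \<noteq> 0} \<in> sets \<eta>" if "t \<in> R" for t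
        using R that unfolding sets by (intro cyl_sets mass_sets') auto
      have "(\<forall>t\<in>R. tmass t \<eta> = 0) \<longleftrightarrow> (\<forall>t\<in>R. emeasure \<eta> (E \<times> {X \<in> super_paths E. mass t X \<noteq> 0}) = 0)"
        using tmass_zero_iff[OF Q \<eta>] R by (intro ball_cong refl) auto
      also have "\<dots> \<longleftrightarrow> emeasure \<eta> (E \<times> AR) = 0"
      proof
        assume 0: "\<forall>t\<in>R. emeasure \<eta> (E \<times> {X \<in> super_paths E. mass t X \<noteq> 0}) = 0"
        have "(\<Union>t\<in>R. E \<times> {X \<in> super_paths E. mass t X \<noteq> 0}) \<in> null_sets \<eta>"
          using R(1) 0 B by (intro null_sets.finite_UN) (auto intro: null_setsI)
        also have "(\<Union>t\<in>R. E \<times> {X \<in> super_paths E. mass t X \<noteq> 0}) = E \<times> AR" by (auto simp: AR_def)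
        finally show "emeasure \<eta> (E \<times> AR) = 0" by (rule null_setsD1)
      next
        assume 0: "emeasure \<eta> (E \<times> AR) = 0"
        have "emeasure \<eta> (E \<times> {X \<in> super_paths E. mass t X \<noteq> 0}) \<le> emeasure \<eta> (E \<times> AR)" if "t \<in> R" for t
          using cyl_sets[OF AR] that by (intro emeasure_mono) (auto simp: AR_def sets)
        then show "\<forall>t\<in>R. emeasure \<eta> (E \<times> {X \<in> super_paths E. mass t X \<noteq> 0}) = 0" using 0 by simp
      qed
      finally show ?thesis .
    qed
    then show ?thesis using R by (auto simp: space_PiM)
  qed
  moreover have "{X \<in> super_paths E. (\<lambda>t\<in>{0<..}. mass t X) \<in> ?\<Phi>} = {X \<in> super_paths E. \<forall>t\<in>R. mass t X = 0}"
    using R by (auto simp: space_PiM)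
  ultimately have Qp: "measure Q {\<eta> \<in> space Q. emeasure \<eta> (E \<times> AR) = 0} = p"
    using law[OF \<Phi>] by (simp add: measure_def p_def)
  \<comment> \<open>The void formula presupposes a finite intensity, which is not yet known for AR.
    It is applied to pieces of finite measure, with a bound free of the piece; exhaustion by
    \<sigma>-finiteness then gives finiteness of AR.\<close>
  have le: "measure (N x) (AR \<inter> F) \<le> - ln p" if F: "F \<in> sets SA" "emeasure (N x) F < \<infinity>" for F
  proof -
    have AF: "AR \<inter> F \<in> sets SA" using AR F by auto
    have fin: "emeasure (N x) (AR \<inter> F) < \<infinity>"
      using F emeasure_mono[of "AR \<inter> F" F "N x"] by (auto simp: sets_N[OF x] intro: le_less_trans)
    have "p \<le> measure Q {\<eta> \<in> space Q. emeasure \<eta> (E \<times> (AR \<inter> F)) = 0}"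
      unfolding Qp[symmetric]
    proof (rule Q.finite_measure_mono)
      show "{\<eta> \<in> space Q. emeasure \<eta> (E \<times> AR) = 0} \<subseteq> {\<eta> \<in> space Q. emeasure \<eta> (E \<times> (AR \<inter> F)) = 0}"
      proof safe
        fix \<eta> assume \<eta>: "\<eta> \<in> space Q" and 0: "emeasure \<eta> (E \<times> AR) = 0"
        have "sets \<eta> = sets (mI x)"
          using Q \<eta> point_measures_sets[of \<eta> "mI x"] by (simp add: poisson_law_def)
        then have "emeasure \<eta> (E \<times> (AR \<inter> F)) \<le> emeasure \<eta> (E \<times> AR)"
          using cyl_sets[OF AR] by (intro emeasure_mono) auto
        then show "emeasure \<eta> (E \<times> (AR \<inter> F)) = 0" using 0 by simp
      qed
      have "(\<lambda>\<eta>. emeasure \<eta> (E \<times> (AR \<inter> F))) -` {0} \<inter> space Q \<in> sets Q"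
        by (rule measurable_sets[OF poisson_law_measurable[OF Q cyl_sets[OF AF]]]) simp
      then show "{\<eta> \<in> space Q. emeasure \<eta> (E \<times> (AR \<inter> F)) = 0} \<in> sets Q"
        by (simp add: vimage_def Int_def conj_commute)
    qed
    also have "\<dots> = exp (- measure (N x) (AR \<inter> F))"
      using poisson_void(1)[OF Q cyl_sets[OF AF]] fin by (simp add: emeasure_cyl[OF x AF] measure_cyl[OF x AF])
    finally have "ln p \<le> ln (exp (- measure (N x) (AR \<inter> F)))"
      using p by (subst ln_le_cancel_iff) (simp_all add: p_def)
    then show ?thesis by simp
  qed
  interpret Nx: sigma_finite_measure "N x" by (rule sigma_finite_N[OF x])
  obtain F :: "nat \<Rightarrow> 'a measure path set" where F: "range F \<subseteq> sets (N x)" "(\<Union>i. F i) = space (N x)"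
      "\<And>i. emeasure (N x) (F i) \<noteq> \<infinity>" "incseq F"
    by (rule Nx.sigma_finite_incseq) blast
  have "(SUP n. emeasure (N x) (AR \<inter> F n)) = emeasure (N x) (\<Union>n. AR \<inter> F n)"
  proof (rule SUP_emeasure_incseq)
    show "range (\<lambda>n. AR \<inter> F n) \<subseteq> sets (N x)" using F(1) AR by (auto simp: sets_N[OF x])
    show "incseq (\<lambda>n. AR \<inter> F n)" using F(4) unfolding incseq_def by blast
  qed
  also have "(\<Union>n. AR \<inter> F n) = AR" using F(2) by (auto simp: space_N[OF x] AR_def)
  finally have "emeasure (N x) AR = (SUP n. emeasure (N x) (AR \<inter> F n))" ..
  also have "\<dots> \<le> ennreal (- ln p)"
  proof (rule SUP_least)
    fix n
    have Fn: "F n \<in> sets SA" "emeasure (N x) (F n) < \<infinity>"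
      using F(1,3) by (auto simp: sets_N[OF x] less_top)
    have "emeasure (N x) (AR \<inter> F n) \<le> emeasure (N x) (F n)"
      using Fn by (intro emeasure_mono) (auto simp: sets_N[OF x])
    then have "emeasure (N x) (AR \<inter> F n) = ennreal (measure (N x) (AR \<inter> F n))"
      using Fn(2) by (intro emeasure_eq_ennreal_measure) (auto simp: top_unique)
    then show "emeasure (N x) (AR \<inter> F n) \<le> ennreal (- ln p)"
      using le[OF Fn] by (simp add: ennreal_leI)
  qed
  finally show fin: "emeasure (N x) {X \<in> super_paths E. \<exists>t\<in>R. mass t X \<noteq> 0} < \<infinity>"
    unfolding AR_def by (rule le_less_trans) simp
  show "measure (PP (return (borel_on E) x)) {X \<in> super_paths E. \<forall>t\<in>R. mass t X = 0} =
      exp (- measure (N x) {X \<in> super_paths E. \<exists>t\<in>R. mass t X \<noteq> 0})"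
    using poisson_void(1)[OF Q cyl_sets[OF AR]] fin Qp
    unfolding AR_def[symmetric] p_def[symmetric] by (simp add: emeasure_cyl[OF x AR] measure_cyl[OF x AR])
qed

lemma extinction_positive:
  assumes "x \<in> E" "t > 0"
  shows "measure (PP (return (borel_on E) x)) {X \<in> super_paths E. mass t X = 0} > 0"
proof -
  have "E \<noteq> {}" using assms(1) by auto
  from extinction_lower[OF return_finite_measures[OF assms(1)] assms(2) this]
  show ?thesis by (rule less_le_trans[OF exp_gt_zero])
qed

text \<open>The extinction probability from a Dirac start is computed twice, as a limit of exp (-
  un) and as a void probability; taking logarithms compares the exponents.\<close>

lemma canonical_survival:
  assumes x: "x \<in> E" and t: "t > 0"
  shows "emeasure (N x) {X \<in> super_paths E. mass t X \<noteq> 0} < \<infinity>"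
    and "(\<lambda>n. un n t x) \<longlonglongrightarrow> measure (N x) {X \<in> super_paths E. mass t X \<noteq> 0}"
proof -
  let ?p = "measure (PP (return (borel_on E) x)) {X \<in> super_paths E. mass t X = 0}"
  let ?U = "measure (N x) {X \<in> super_paths E. mass t X \<noteq> 0}"
  have p: "?p > 0" by (rule extinction_positive[OF x t])
  note v = canonical_void[OF x, of "{t}"]
  show "emeasure (N x) {X \<in> super_paths E. mass t X \<noteq> 0} < \<infinity>" using v(1) p t by simp
  have pU: "?p = exp (- ?U)" using v(2) p t by simp
  have "(\<integral>y. un n t y \<partial>return (borel_on E) x) = un n t x" for n
    using integral_return[of x "borel_on E" "un n t"] un_measurable[of t n] x t by simp
  then have "(\<lambda>n. exp (- un n t x)) \<longlonglongrightarrow> ?p"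
    using extinction_limit[OF return_finite_measures[OF x], of t] t by simp
  then have "(\<lambda>n. ln (exp (- un n t x))) \<longlonglongrightarrow> ln ?p" using p by (intro tendsto_ln) auto
  then have "(\<lambda>n. - un n t x) \<longlonglongrightarrow> - ?U" by (simp only: pU ln_exp)
  then show "(\<lambda>n. un n t x) \<longlonglongrightarrow> ?U" by (rule tendsto_minus_cancel)
qed

text \<open>By the Markov property at s, since \<open>survival_bound\<close> vanishes for an initial
  measure of mass zero.\<close>

lemma absorption_PP:
  assumes \<nu>: "\<nu> \<in> finite_measures E" and s: "s \<ge> 0" "s < t" and E: "E \<noteq> {}"
  shows "emeasure (PP \<nu>) {X \<in> super_paths E. mass s X = 0 \<and> mass t X \<noteq> 0} = 0"
proof -
  define A1 where "A1 = {X \<in> super_paths E. mass s X = 0}"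
  define B1 where "B1 = {X \<in> super_paths E. mass (t - s) X \<noteq> 0}"
  have A1: "A1 \<in> sets (super_algebra E {0..s})"
    using mass_sets[of s "{0..s}" "{0}" E] s by (simp add: A1_def)
  have B1: "B1 \<in> sets SA" unfolding B1_def using s by (intro mass_sets') auto
  have "{X \<in> super_paths E. mass s X = 0 \<and> mass t X \<noteq> 0} = {X \<in> A1. path_shift s X \<in> B1}"
    using s shift_in_super_paths[OF _ s(1), of _ E] by (auto simp: A1_def B1_def path_shift_super)
  then have "emeasure (PP \<nu>) {X \<in> super_paths E. mass s X = 0 \<and> mass t X \<noteq> 0} =
      (\<integral>\<^sup>+X\<in>A1. emeasure (PP (X s)) B1 \<partial>PP \<nu>)"
    using super_markov[OF \<nu> s(1) A1 B1] by simp
  also have "\<dots> \<le> (\<integral>\<^sup>+X. 0 \<partial>PP \<nu>)"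
  proof (rule nn_integral_mono)
    fix X assume "X \<in> space (PP \<nu>)"
    then have X: "X \<in> super_paths E" by (simp add: space_PP[OF \<nu>])
    show "emeasure (PP (X s)) B1 * indicator A1 X \<le> 0"
    proof (cases "X \<in> A1")
      case True
      have "emeasure (PP (X s)) B1 \<le> ennreal (ubound (t - s)) * mass s X"
        unfolding B1_def using s by (intro survival_bound[OF super_paths_finite_measures[OF X s(1)] _ E]) auto
      then show ?thesis using True by (simp add: A1_def)
    qed simp
  qed
  finally show ?thesis by simp
qed

text \<open>Under \<open>PP\<close> extinction at s and extinction at both s and t have the same
  probability. As void probabilities these determine the finite canonical masses of the nested sets
  S1 and S2, which therefore agree, and the difference is null.\<close>

lemma absorption_N:
  assumes x: "x \<in> E" and s: "0 < s" "s < t"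
  shows "{X \<in> super_paths E. mass s X = 0 \<and> mass t X \<noteq> 0} \<in> null_sets (N x)"
proof -
  let ?\<nu> = "return (borel_on E) x"
  have \<nu>: "?\<nu> \<in> finite_measures E" by (rule return_finite_measures[OF x])
  interpret prob_space "PP ?\<nu>" by (rule prob_space_PP[OF \<nu>])
  define S1 where "S1 = {X \<in> super_paths E. \<exists>r\<in>{s}. mass r X \<noteq> 0}"
  define S2 where "S2 = {X \<in> super_paths E. \<exists>r\<in>{s, t}. mass r X \<noteq> 0}"
  have sets: "{X \<in> super_paths E. mass s X = 0} \<in> sets SA" "{X \<in> super_paths E. mass t X \<noteq> 0} \<in> sets SA"
      "{X \<in> super_paths E. mass s X \<noteq> 0} \<in> sets SA" "{X \<in> super_paths E. mass t X = 0} \<in> sets SA"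
    using s by (auto intro: mass_sets')
  have S1: "S1 = {X \<in> super_paths E. mass s X \<noteq> 0}" and
      S2: "S2 = {X \<in> super_paths E. mass s X \<noteq> 0} \<union> {X \<in> super_paths E. mass t X \<noteq> 0}"
    by (auto simp: S1_def S2_def)
  have S: "S1 \<in> sets (N x)" "S2 \<in> sets (N x)" unfolding S1 S2 sets_N[OF x] using sets by auto
  have bad: "{X \<in> super_paths E. mass s X = 0 \<and> mass t X \<noteq> 0} = S2 - S1" by (auto simp: S1_def S2_def)
  have e1: "{X \<in> super_paths E. \<forall>r\<in>{s}. mass r X = 0} = {X \<in> super_paths E. mass s X = 0}" by auto
  have e2: "{X \<in> super_paths E. \<forall>r\<in>{s, t}. mass r X = 0} = {X \<in> super_paths E. mass s X = 0} \<inter> {X \<in> super_paths E. mass t X = 0}" by auto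
  have "prob {X \<in> super_paths E. \<forall>r\<in>{s}. mass r X = 0} =
      prob {X \<in> super_paths E. \<forall>r\<in>{s, t}. mass r X = 0} + prob {X \<in> super_paths E. mass s X = 0 \<and> mass t X \<noteq> 0}"
    unfolding e1 e2 using sets by (subst finite_measure_Union[symmetric])
      (auto simp: sets_PP[OF \<nu>] bad S1 S2 intro!: arg_cong[where f = prob])
  moreover have "prob {X \<in> super_paths E. mass s X = 0 \<and> mass t X \<noteq> 0} = 0"
  proof -
    have "E \<noteq> {}" using x by auto
    from absorption_PP[OF \<nu> _ s(2) this] s(1) show ?thesis by (simp add: measure_def)
  qed
  ultimately have eq: "prob {X \<in> super_paths E. \<forall>r\<in>{s}. mass r X = 0} = prob {X \<in> super_paths E. \<forall>r\<in>{s, t}. mass r X = 0}"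
    by simp
  have p: "prob {X \<in> super_paths E. \<forall>r\<in>{s}. mass r X = 0} > 0"
    unfolding e1 by (rule extinction_positive[OF x s(1)])
  have v1: "emeasure (N x) S1 < \<infinity>" "prob {X \<in> super_paths E. \<forall>r\<in>{s}. mass r X = 0} = exp (- measure (N x) S1)"
    using canonical_void[OF x, of "{s}"] p s unfolding S1_def by auto
  have v2: "emeasure (N x) S2 < \<infinity>" "prob {X \<in> super_paths E. \<forall>r\<in>{s, t}. mass r X = 0} = exp (- measure (N x) S2)"
    using canonical_void[OF x, of "{s, t}"] p s unfolding S2_def eq by auto
  have "measure (N x) S1 = measure (N x) S2" using eq v1(2) v2(2) by simp
  then have "emeasure (N x) S1 = emeasure (N x) S2"
    using v1(1) v2(1) by (simp add: emeasure_eq_ennreal_measure less_top)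
  then have "emeasure (N x) (S2 - S1) = 0"
    using S v1(1) by (subst emeasure_Diff) (auto simp: S1_def S2_def less_top)
  then show ?thesis unfolding bad using S by (intro null_setsI) auto
qed

text \<open>A countable substitute for the event that the mass vanishes somewhere before T although
  the path is alive at T: for continuous mass, a zero shows up as arbitrarily small values along a
  dense set D.\<close>

definition touch :: "real set \<Rightarrow> real \<Rightarrow> 'a measure path set" where
  "touch D T = {X \<in> super_paths E. mass T X \<noteq> 0 \<and> (\<forall>n. \<exists>q\<in>D. mass q X < ennreal (1 / real (Suc n)))}"

lemma touch_sets:
  assumes "countable D" "D \<subseteq> {0..}" "T \<ge> 0"
  shows "touch D T \<in> sets SA"
proof -
  have "{X \<in> super_paths E. mass T X \<noteq> 0} \<inter> (\<Inter>n. {X \<in> super_paths E. \<exists>q\<in>D. mass q X < ennreal (1 / real (Suc n))}) \<in> sets SA"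
    using assms by (intro sets.Int mass_sets' sets.countable_INT image_subsetI finite_exists_mass_sets) auto
  also have "{X \<in> super_paths E. mass T X \<noteq> 0} \<inter> (\<Inter>n. {X \<in> super_paths E. \<exists>q\<in>D. mass q X < ennreal (1 / real (Suc n))}) = touch D T"
    by (auto simp: touch_def)
  finally show ?thesis .
qed

text \<open>For finite subsets of D \<open>survival_after_small_mass\<close> gives a bound linear in
  the level c and free of the number of times. D is exhausted by finite subsets first; then c = 1 /
  (n + 1) tends to 0.\<close>

lemma touch_PP:
  assumes \<nu>: "\<nu> \<in> finite_measures E" and E: "E \<noteq> {}" and D: "countable D" "D \<subseteq> {0..T - \<delta>}"
    and \<delta>: "\<delta> > 0" and T: "T \<ge> 0"
  shows "emeasure (PP \<nu>) (touch D T) = 0"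
proof (cases "D = {}")
  case True
  then show ?thesis by (simp add: touch_def)
next
  case False
  interpret prob_space "PP \<nu>" by (rule prob_space_PP[OF \<nu>])
  let ?d = "from_nat_into D"
  have d: "range ?d = D" using D(1) False by (rule range_from_nat_into[rotated])
  have dD: "?d i \<in> D" for i using False by (rule from_nat_into)
  have D0: "D \<subseteq> {0..}" using D(2) by auto
  have d\<delta>: "0 \<le> ?d i \<and> ?d i + \<delta> \<le> T" for i using subsetD[OF D(2) dD[of i]] by simp
  have bound: "emeasure (PP \<nu>) (touch D T) \<le> ennreal (ubound \<delta>) * c n" if c: "c n = ennreal (1 / real (Suc n))" for c n
  proof -
    let ?A = "\<lambda>k. {X \<in> super_paths E. mass T X \<noteq> 0 \<and> (\<exists>q\<in>?d ` {..k}. mass q X < c n)}"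
    have A: "?A k \<in> sets (PP \<nu>)" for k
    proof -
      have "?A k = {X \<in> super_paths E. mass T X \<noteq> 0} \<inter> {X \<in> super_paths E. \<exists>q\<in>?d ` {..k}. mass q X < c n}" by auto
      also have "\<dots> \<in> sets SA"
        using T D0 dD by (intro sets.Int mass_sets' finite_exists_mass_sets) auto
      finally show ?thesis by (simp add: sets_PP[OF \<nu>])
    qed
    have le: "emeasure (PP \<nu>) (?A k) \<le> ennreal (ubound \<delta>) * c n" for k
    proof -
      let ?qs = "sorted_list_of_set (?d ` {..k})"
      have "emeasure (PP \<nu>) {X \<in> super_paths E. mass T X \<noteq> 0 \<and> (\<exists>q\<in>set ?qs. mass q X < c n)} \<le> ennreal (ubound \<delta>) * c n"
        using d\<delta> by (intro survival_after_small_mass[OF E \<delta> \<nu>]) auto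
      then show ?thesis by simp
    qed
    have "touch D T \<subseteq> (\<Union>k. ?A k)"
    proof
      fix X assume X: "X \<in> touch D T"
      then have "\<exists>q\<in>D. mass q X < c n" unfolding c touch_def by blast
      then obtain q where q: "q \<in> D" "mass q X < c n" by blast
      then obtain i where "q = ?d i" using d by (metis imageE)
      then have "X \<in> ?A i" using X q by (auto simp: touch_def)
      then show "X \<in> (\<Union>k. ?A k)" by blast
    qed
    then have "emeasure (PP \<nu>) (touch D T) \<le> emeasure (PP \<nu>) (\<Union>k. ?A k)"
      using A by (intro emeasure_mono) auto
    also have "\<dots> = (SUP k. emeasure (PP \<nu>) (?A k))"
      using A by (intro SUP_emeasure_incseq[symmetric]) (auto simp: incseq_def intro: order_trans)
    also have "\<dots> \<le> ennreal (ubound \<delta>) * c n" by (rule SUP_least) (rule le)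
    finally show ?thesis .
  qed
  obtain x where "x \<in> E" using E by auto
  then have ub: "ubound \<delta> \<ge> 0" using ubound_nonneg \<delta> by simp
  have "(\<lambda>n. ennreal (ubound \<delta> * (1 / real (Suc n)))) \<longlonglongrightarrow> ennreal (ubound \<delta> * 0)"
    by (intro tendsto_ennrealI tendsto_intros LIMSEQ_inverse_real_of_nat[unfolded inverse_eq_divide])
  moreover have "emeasure (PP \<nu>) (touch D T) \<le> ennreal (ubound \<delta> * (1 / real (Suc n)))" for n
    using bound[of "\<lambda>n. ennreal (1 / real (Suc n))" n] ub by (subst ennreal_mult) auto
  ultimately have "emeasure (PP \<nu>) (touch D T) \<le> ennreal (ubound \<delta> * 0)"
    by (intro LIMSEQ_le_const) auto
  then show ?thesis by simp
qed

text \<open>If the only path of the Poissonian superposition that is alive at time \<open>s0\<close> belongs to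
  \<open>touch D T\<close>, then so does the superposition, for which \<open>touch D T\<close> is a null event.\<close>

lemma touch_N:
  assumes x: "x \<in> E" and s0: "s0 > 0" and \<delta>: "\<delta> > 0" and D: "countable D" "D \<subseteq> {s0..T - \<delta>}"
  shows "touch D T \<in> null_sets (N x)"
proof (cases "D = {}")
  case True
  then show ?thesis by (simp add: touch_def)
next
  case False
  then have T: "T > s0" using D \<delta> by (auto simp: subset_eq ex_in_conv[symmetric])
  let ?\<nu> = "return (borel_on E) x"
  have \<nu>: "?\<nu> \<in> finite_measures E" by (rule return_finite_measures[OF x])
  have E: "E \<noteq> {}" using x by auto
  obtain Q where Q: "poisson_law (mI x) Q" and law: "\<And>\<Phi>. \<Phi> \<in> sets (PiM {0<..} (\<lambda>_. borel)) \<Longrightarrow>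
      emeasure Q {\<eta> \<in> space Q. (\<lambda>t\<in>{0<..}. tmass t \<eta>) \<in> \<Phi>} =
      emeasure (PP (return (borel_on E) x)) {X \<in> super_paths E. (\<lambda>t\<in>{0<..}. mass t X) \<in> \<Phi>}"
    by (rule poisson_superposition[OF x]) (rule that, assumption)
  interpret Q: prob_space Q using Q by (simp add: poisson_law_def)
  define I where "I = {q \<in> insert T D. s0 < q}"
  \<comment> \<open>Paths dead at s0 but alive at one of the countably many later times in question.
    Outside this null set only atoms alive at s0 contribute to the masses at those times.\<close>
  define Z where "Z = (\<Union>q\<in>I. {X \<in> super_paths E. mass s0 X = 0 \<and> mass q X \<noteq> 0})"
  have I: "countable I" using D(1) by (auto simp: I_def intro: countable_subset[of _ "insert T D"])
  have Z: "Z \<in> null_sets (N x)"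
    unfolding Z_def using I by (intro null_sets_UN' absorption_N[OF x s0]) (auto simp: I_def)
  then have Zs: "Z \<in> sets SA" using sets_N[OF x] by auto
  define A0 where "A0 = {X \<in> super_paths E. mass s0 X \<noteq> 0}"
  define B where "B = touch D T"
  have A0: "A0 \<in> sets SA" unfolding A0_def using s0 by (intro mass_sets') auto
  have B: "B \<in> sets SA" unfolding B_def using D s0 T by (intro touch_sets) auto
  have A0f: "emeasure (N x) A0 < \<infinity>" unfolding A0_def by (rule canonical_survival[OF x s0])
  have fin: "emeasure (N x) (A0 \<inter> B) < \<infinity>" "emeasure (N x) (A0 - B) < \<infinity>"
    using A0 B A0f emeasure_mono[of "A0 \<inter> B" A0 "N x"] emeasure_mono[of "A0 - B" A0 "N x"]
    by (auto simp: sets_N[OF x] intro: le_less_trans)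
  have AB: "A0 \<inter> B \<in> sets SA" "A0 - B \<in> sets SA" using A0 B by auto
  \<comment> \<open>Exactly one atom is alive at s0, and it belongs to \<open>touch D T\<close>. The
    intensities are finite because \<open>A0\<close> has finite canonical mass at the positive time
    s0, and independence makes the probability explicit.\<close>
  define Ev where "Ev = {\<eta> \<in> space Q. emeasure \<eta> (E \<times> (A0 \<inter> B)) = 1 \<and> emeasure \<eta> (E \<times> (A0 - B)) = 0}"
  have prEv: "measure Q Ev = measure (N x) (A0 \<inter> B) * exp (- measure (N x) (A0 \<inter> B)) * exp (- measure (N x) (A0 - B))"
    using poisson_one_zero[OF Q cyl_sets[OF AB(1)] _ cyl_sets[OF AB(2)]] fin
    by (auto simp: Ev_def emeasure_cyl[OF x AB(1)] emeasure_cyl[OF x AB(2)] measure_cyl[OF x AB(1)] measure_cyl[OF x AB(2)])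
  let ?\<Phi> = "{f \<in> space (PiM {0<..} (\<lambda>_. borel :: ennreal measure)). f T \<in> - {0} \<and>
      (\<forall>n. \<exists>q\<in>D. f q \<in> {..<ennreal (1 / real (Suc n))})}"
  have \<Phi>: "?\<Phi> \<in> sets (PiM {0<..} (\<lambda>_. borel))"
    using D s0 T
    by (intro sets.sets_Collect_conj sets.sets_Collect_countable_All sets.sets_Collect_countable_Ex' PiM_coord_sets) auto
  have mem: "(\<lambda>t\<in>{0<..}. h t) \<in> ?\<Phi> \<longleftrightarrow> h T \<noteq> 0 \<and> (\<forall>n. \<exists>q\<in>D. h q < ennreal (1 / real (Suc n)))" for h :: "real \<Rightarrow> ennreal"
  proof -
    have "q > 0" if "q \<in> D" for q using that D(2) s0 by auto
    then show ?thesis using T s0 by (auto simp: space_PiM)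
  qed
  have touch: "{X \<in> super_paths E. (\<lambda>t\<in>{0<..}. mass t X) \<in> ?\<Phi>} = touch D T"
    unfolding mem touch_def by simp
  have D0: "D \<subseteq> {0..T - \<delta>}" by (rule subset_trans[OF D(2)]) (use s0 in auto)
  have Q0: "emeasure Q {\<eta> \<in> space Q. (\<lambda>t\<in>{0<..}. tmass t \<eta>) \<in> ?\<Phi>} = 0"
    unfolding law[OF \<Phi>] touch by (rule touch_PP[OF \<nu> E D(1) D0 \<delta>]) (use s0 T in auto)
  have Q0m: "{\<eta> \<in> space Q. (\<lambda>t\<in>{0<..}. tmass t \<eta>) \<in> ?\<Phi>} \<in> sets Q"
  proof -
    have "(\<lambda>\<eta>. \<lambda>t\<in>{0<..}. tmass t \<eta>) \<in> Q \<rightarrow>\<^sub>M PiM {0<..} (\<lambda>_. borel)"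
      unfolding tmass_def by (intro measurable_restrict poisson_integral_measurable[OF Q] emass_measurable) auto
    from measurable_sets[OF this \<Phi>] show ?thesis by (simp add: vimage_def Int_def conj_commute)
  qed
  have QZm: "{\<eta> \<in> space Q. emeasure \<eta> (E \<times> Z) = 0} \<in> sets Q"
  proof -
    have "(\<lambda>\<eta>. emeasure \<eta> (E \<times> Z)) -` {0} \<inter> space Q \<in> sets Q"
      by (rule measurable_sets[OF poisson_law_measurable[OF Q cyl_sets[OF Zs]]]) simp
    then show ?thesis by (simp add: vimage_def Int_def conj_commute)
  qed
  have QZ: "Q.prob {\<eta> \<in> space Q. emeasure \<eta> (E \<times> Z) = 0} = 1"
    using poisson_void(1)[OF Q cyl_sets[OF Zs]] Z
    by (simp add: emeasure_cyl[OF x Zs] measure_cyl[OF x Zs] null_setsD1 measure_eq_0_null_sets)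
  then have AEZ: "AE \<eta> in Q. emeasure \<eta> (E \<times> Z) = 0"
    using Q.AE_prob_1[OF QZ] by (auto elim!: eventually_mono)
  have AE\<Phi>: "AE \<eta> in Q. (\<lambda>t\<in>{0<..}. tmass t \<eta>) \<notin> ?\<Phi>"
    using AE_not_in[OF null_setsI[OF Q0 Q0m]] by (auto elim!: eventually_mono)
  have incl: "(\<lambda>t\<in>{0<..}. tmass t \<eta>) \<in> ?\<Phi>" if \<eta>: "\<eta> \<in> Ev" and 0: "emeasure \<eta> (E \<times> Z) = 0" for \<eta>
  proof -
    have \<eta>': "\<eta> \<in> point_measures (mI x)" using Q \<eta> by (simp add: poisson_law_def Ev_def)
    have one: "emeasure \<eta> (E \<times> (A0 \<inter> B)) = 1" and zero: "emeasure \<eta> (E \<times> (A0 - B)) = 0"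
      using \<eta> by (auto simp: Ev_def)
    obtain p where p: "p \<in> E \<times> (A0 \<inter> B)"
      and pg: "\<forall>g\<in>borel_measurable (mI x). (\<integral>\<^sup>+q. g q * indicator (E \<times> (A0 \<inter> B)) q \<partial>\<eta>) = g p"
      using point_measure_single_atom[OF \<eta>' cyl_sets[OF AB(1)] one] by blast
    have n1: "E \<times> (A0 - B) \<in> null_sets \<eta>" "E \<times> Z \<in> null_sets \<eta>"
      using zero 0 cyl_sets[OF AB(2)] cyl_sets[OF Zs] by (auto intro!: null_setsI simp: point_measures_sets[OF \<eta>'])
    \<comment> \<open>All atoms except p are dead at s0 and, off Z, stay dead, so the superposition
      has the mass of p at each of these times.\<close>
    have tm: "tmass q \<eta> = mass q (snd p)" if q: "q \<in> insert T D" for q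
    proof -
      have q0: "q \<ge> 0" "q \<ge> s0" using q D(2) s0 T by auto
      have mE: "emeasure (X q) E = mass q X" if "X \<in> super_paths E" for X
        using super_paths_space[OF that q0(1)] by simp
      have "tmass q \<eta> = (\<integral>\<^sup>+p. emeasure (snd p q) E * indicator (E \<times> (A0 \<inter> B)) p \<partial>\<eta>)"
        unfolding tmass_def
      proof (rule nn_integral_cong_AE)
        show "AE p in \<eta>. emeasure (snd p q) E = emeasure (snd p q) E * indicator (E \<times> (A0 \<inter> B)) p"
          using AE_not_in[OF n1(1)] AE_not_in[OF n1(2)] AE_space
        proof eventually_elim
          case (elim p)
          then have p: "fst p \<in> E" "snd p \<in> super_paths E"
            by (auto simp: point_measures_space[OF \<eta>'] space_mI)
          show ?case
          proof (cases "snd p \<in> A0")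
            case True
            then have "snd p \<in> B" using elim(1) p by (cases p) auto
            then show ?thesis using True p by (cases p) (simp add: indicator_def)
          next
            case False
            then have s00: "mass s0 (snd p) = 0" using p by (simp add: A0_def)
            have "snd p \<notin> Z" using elim(2) p by (cases p) auto
            then have "mass q (snd p) = 0"
            proof (cases "q = s0")
              case False
              then have "q \<in> I" using q q0(2) by (auto simp: I_def)
              then show ?thesis using \<open>snd p \<notin> Z\<close> s00 p unfolding Z_def by blast
            qed (use s00 in simp)
            then show ?thesis using mE[OF p(2)] by simp
          qed
        qed
      qed
      also have "\<dots> = emeasure (snd p q) E" by (rule bspec[OF pg emass_measurable[OF q0(1)]])
      also have "\<dots> = mass q (snd p)" using p by (intro mE) (auto simp: A0_def)
      finally show ?thesis .
    qed
    have "snd p \<in> touch D T" using p by (auto simp: B_def)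
    then show ?thesis unfolding mem by (simp add: touch_def tm cong: bex_cong)
  qed
  have "AE \<eta> in Q. \<eta> \<notin> Ev"
    using AEZ AE\<Phi> by eventually_elim (use incl in blast)
  moreover have "Ev \<in> sets Q"
  proof -
    have "(\<lambda>\<eta>. emeasure \<eta> (E \<times> (A0 \<inter> B))) -` {1} \<inter> space Q \<inter> ((\<lambda>\<eta>. emeasure \<eta> (E \<times> (A0 - B))) -` {0} \<inter> space Q) \<in> sets Q"
      by (intro sets.Int measurable_sets[OF poisson_law_measurable[OF Q cyl_sets[OF AB(1)]]]
        measurable_sets[OF poisson_law_measurable[OF Q cyl_sets[OF AB(2)]]]) auto
    moreover have "(\<lambda>\<eta>. emeasure \<eta> (E \<times> (A0 \<inter> B))) -` {1} \<inter> space Q \<inter> ((\<lambda>\<eta>. emeasure \<eta> (E \<times> (A0 - B))) -` {0} \<inter> space Q) = Ev"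
      by (auto simp: Ev_def)
    ultimately show ?thesis by simp
  qed
  \<comment> \<open>The probability of \<open>Ev\<close> is the canonical mass of
    \<open>A0 \<inter> B\<close> times positive exponentials, so it can vanish only together with
    that mass.\<close>
  ultimately have "measure Q Ev = 0" using Q.prob_eq_0 by simp
  then have "measure (N x) (A0 \<inter> B) = 0" using prEv by simp
  then have "A0 \<inter> B \<in> null_sets (N x)"
    using fin(1) AB by (intro null_setsI) (auto simp: sets_N[OF x] measure_def enn2real_eq_0_iff)
  from null_sets.Un[OF this Z] have "(A0 \<inter> B) \<union> Z \<in> null_sets (N x)" .
  \<comment> \<open>A path in B is alive at T, so if it is dead at s0 it belongs to Z; this is why T
    was inserted into the index set.\<close>
  moreover have "B \<subseteq> (A0 \<inter> B) \<union> Z"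
    using T by (auto simp: A0_def B_def Z_def I_def touch_def)
  ultimately show ?thesis using B null_sets_subset[of "(A0 \<inter> B) \<union> Z" "N x" B] by (auto simp: sets_N[OF x] B_def)
qed

text \<open>Rational times away from both ends: away from 0 because finiteness of the canonical mass
  is known at positive times only, away from t because \<open>touch_N\<close> needs a margin
  \<delta> > 0. Countably many such grids exhaust the open interval.\<close>

abbreviation tgrid :: "real \<Rightarrow> nat \<Rightarrow> nat \<Rightarrow> real set" where
  "tgrid t k j \<equiv> \<rat> \<inter> {1 / real (Suc k)..t - 1 / real (Suc j)}"

text \<open>Continuity of the mass reduces the infimum over all times to countably many conditions,
  which makes survival beyond t a measurable event and exhibits its difference from being alive at
  t.\<close>

lemma H_max_greater_iff:
  assumes X: "X \<in> super_paths E" and t: "t > 0"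
  shows "ereal t < H_max E X \<longleftrightarrow> mass t X \<noteq> 0 \<and> (\<forall>k j. X \<notin> touch (tgrid t k j) t)"
proof -
  define ms where "ms r = measure (X r) (space (X r))" for r
  have fin: "finite_measure (X r)" if "r \<ge> 0" for r using super_paths_finite[OF X that] .
  have mass: "mass r X = ennreal (ms r)" if "r \<ge> 0" for r
    using finite_measure.emeasure_eq_measure[OF fin[OF that]] by (simp add: ms_def)
  have ms0: "ms r \<ge> 0" for r by (simp add: ms_def)
  have null: "X r = null_measure (borel_on E) \<longleftrightarrow> ms r = 0" if r: "r \<ge> 0" for r
  proof
    assume "ms r = 0"
    then have 0: "mass r X = 0" using mass[OF r] by simp
    show "X r = null_measure (borel_on E)"
    proof (rule measure_eqI)
      fix A
      have "emeasure (X r) A \<le> mass r X" by (rule emeasure_space)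
      then show "emeasure (X r) A = emeasure (null_measure (borel_on E)) A" using 0 by simp
    qed (use super_paths_sets[OF X r] in simp)
  qed (simp add: ms_def measure_def)
  have cont: "continuous_on {0..} ms"
  proof -
    have "(\<lambda>_. 1) \<in> C_b E" by (auto simp: C_b_def bounded_iff)
    then have "continuous_on {0..} (\<lambda>r. \<integral>y. (1 :: real) \<partial>X r)" using X by (auto simp: super_paths_def)
    then show ?thesis unfolding ms_def[abs_def] by simp
  qed
  have H: "H_max E X = Inf {ereal r | r. 0 < r \<and> ms r = 0}"
    unfolding H_max_def using null by (intro arg_cong[where f = Inf]) auto
  show ?thesis
  proof
    assume lt: "ereal t < H_max E X"
    have pos: "ms s > 0" if "0 < s" "s \<le> t" for s
    proof (rule ccontr)
      assume "\<not> 0 < ms s"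
      then have "ms s = 0" using ms0[of s] by linarith
      then have "H_max E X \<le> ereal s" unfolding H using that by (intro Inf_lower) auto
      then have "ereal t < ereal s" using lt by (rule less_le_trans[rotated])
      then show False using that by simp
    qed
    \<comment> \<open>The continuous mass attains a positive minimum on the compact interval spanned
      by the grid, which excludes arbitrarily small values there.\<close>
    have "X \<notin> touch (tgrid t k j) t" for k j
    proof
      assume to: "X \<in> touch (tgrid t k j) t"
      let ?p = "1 / real (Suc k)" and ?q = "t - 1 / real (Suc j)"
      obtain r0 where "r0 \<in> tgrid t k j" using to by (auto simp: touch_def)
      then have pq: "?p \<le> ?q" by auto
      have p0: "0 < ?p" by simp
      have "continuous_on {?p..?q} ms" by (rule continuous_on_subset[OF cont]) (use p0 in \<open>auto intro: order_trans[OF less_imp_le]\<close>)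
      then obtain s where s: "s \<in> {?p..?q}" and smin: "\<And>r. r \<in> {?p..?q} \<Longrightarrow> ms s \<le> ms r"
        using continuous_attains_inf[of "{?p..?q}" ms] pq by auto
      have "?q \<le> t" by simp
      moreover have "?p \<le> s" "s \<le> ?q" using s by (simp_all only: atLeastAtMost_iff)
      ultimately have "ms s > 0" by (intro pos less_le_trans[OF p0]) (auto intro: order_trans)
      then obtain n where n: "inverse (real (Suc n)) < ms s" using reals_Archimedean by blast
      obtain r where r: "r \<in> tgrid t k j" "mass r X < ennreal (1 / real (Suc n))"
        using to unfolding touch_def by blast
      have "?p \<le> r" using r(1) by (simp_all only: atLeastAtMost_iff Int_iff)
      then have "r \<ge> 0" by (rule order_trans[OF less_imp_le[OF p0]])
      then have "ms r < 1 / real (Suc n)" using r(2) ms0[of r] by (simp add: mass ennreal_less_iff)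
      moreover have "ms s \<le> ms r" using r(1) by (intro smin) auto
      ultimately show False using n by (simp add: inverse_eq_divide)
    qed
    then show "mass t X \<noteq> 0 \<and> (\<forall>k j. X \<notin> touch (tgrid t k j) t)"
      using pos[of t] t mass[of t] by auto
  next
    assume *: "mass t X \<noteq> 0 \<and> (\<forall>k j. X \<notin> touch (tgrid t k j) t)"
    then have mst: "ms t > 0" using mass[of t] t ms0[of t] by (auto simp: less_le)
    \<comment> \<open>A neighbourhood of t on which the mass is positive. It pushes the infimum to t
      + d at least, which gives the strict inequality.\<close>
    then obtain d where d: "d > 0" "\<And>r. r \<ge> 0 \<Longrightarrow> dist r t < d \<Longrightarrow> dist (ms r) (ms t) < ms t"
      using cont t unfolding continuous_on_iff by (meson atLeast_iff less_imp_le)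
    have "t + d \<le> r" if r: "0 < r" "ms r = 0" for r
    proof (rule ccontr)
      assume "\<not> t + d \<le> r"
      then have "r < t" using d(2)[of r] r mst by (cases "r < t") (auto simp: dist_real_def)
      \<comment> \<open>The choice of k and j places the zero r strictly inside a grid interval, so
        rational times just to the right of r lie in the grid and carry small mass.\<close>
      obtain k where k: "inverse (real (Suc k)) < r" using reals_Archimedean r(1) by blast
      obtain j where j: "inverse (real (Suc j)) < t - r" using reals_Archimedean[of "t - r"] \<open>r < t\<close> by auto
      have "\<exists>q\<in>tgrid t k j. mass q X < ennreal (1 / real (Suc n))" for n
      proof -
        have "1 / real (Suc n) > 0" by simp
        then obtain e where e: "e > 0" "\<And>q. q \<ge> 0 \<Longrightarrow> dist q r < e \<Longrightarrow> dist (ms q) (ms r) < 1 / real (Suc n)"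
          using cont r unfolding continuous_on_iff by (meson atLeast_iff less_imp_le)
        have "r < min (t - 1 / real (Suc j)) (r + e)" using j e(1) by (simp add: inverse_eq_divide)
        then obtain q where q: "q \<in> \<rat>" "r < q" "q < min (t - 1 / real (Suc j)) (r + e)"
          using Rats_dense_in_real by blast
        have "ms q < 1 / real (Suc n)" using e(2)[of q] q r by (auto simp: dist_real_def)
        then have "mass q X < ennreal (1 / real (Suc n))" using q r ms0[of q] by (simp add: mass ennreal_less_iff)
        moreover have "q \<in> tgrid t k j" using q k by (auto simp: inverse_eq_divide)
        ultimately show ?thesis by blast
      qed
      then have "X \<in> touch (tgrid t k j) t" using X * by (simp add: touch_def)
      then show False using * by blast
    qed
    then have "ereal (t + d) \<le> H_max E X" unfolding H by (intro Inf_greatest) auto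
    then show "ereal t < H_max E X" using d(1) by (auto intro: less_le_trans[rotated])
  qed
qed

section \<open>The survival function\<close>

abbreviation v :: "real \<Rightarrow> 'a \<Rightarrow> real" where "v \<equiv> vfun E N"

text \<open>The event differs from being alive at t by a countable union of \<open>touch\<close>
  sets. These are null, so measurability, finiteness and the value of v all come from the event at
  the single time t.\<close>

lemma
  assumes x: "x \<in> E" and t: "t > 0"
  shows survival_sets: "{X \<in> space (N x). ereal t < H_max E X} \<in> sets (N x)"
    and survival_finite: "emeasure (N x) {X \<in> space (N x). ereal t < H_max E X} < \<infinity>"
    and v_eq: "v t x = measure (N x) {X \<in> super_paths E. mass t X \<noteq> 0}"
proof -
  let ?A = "{X \<in> super_paths E. mass t X \<noteq> 0}"
  let ?B = "\<Union>k j. touch (tgrid t k j) t"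
  have A: "?A \<in> sets (N x)" using mass_sets'(2)[of t E] t by (simp add: sets_N[OF x])
  have "touch (tgrid t k j) t \<in> null_sets (N x)" for k j
    by (rule touch_N[OF x, of "1 / real (Suc k)" "1 / real (Suc j)"]) (auto intro: countable_Int1 countable_rat)
  then have B: "?B \<in> null_sets (N x)" by (intro null_sets_UN)
  have eq: "{X \<in> space (N x). ereal t < H_max E X} = ?A - ?B"
    using H_max_greater_iff[OF _ t] by (auto simp: space_N[OF x])
  show "{X \<in> space (N x). ereal t < H_max E X} \<in> sets (N x)" unfolding eq using A B by auto
  have "emeasure (N x) {X \<in> space (N x). ereal t < H_max E X} = emeasure (N x) ?A"
    unfolding eq using A B by (intro emeasure_Diff_null_set)
  then show "emeasure (N x) {X \<in> space (N x). ereal t < H_max E X} < \<infinity>"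
    "v t x = measure (N x) {X \<in> super_paths E. mass t X \<noteq> 0}"
    using canonical_survival(1)[OF x t] by (simp_all add: vfun_def measure_def)
qed

lemma v_limit: "x \<in> E \<Longrightarrow> t > 0 \<Longrightarrow> (\<lambda>n. un n t x) \<longlonglongrightarrow> v t x"
  using canonical_survival(2) v_eq by simp

lemma v_nonneg: "0 \<le> v t x"
  by (simp add: vfun_def)

lemma v_le_ubound: "x \<in> E \<Longrightarrow> t > 0 \<Longrightarrow> v t x \<le> ubound t"
  using un_bounds by (intro LIMSEQ_le_const2[OF v_limit]) auto

lemma v_antimono:
  assumes "x \<in> E" "0 < s" "s \<le> t"
  shows "v t x \<le> v s x"
  unfolding vfun_def
proof (rule measure_mono_fmeasurable)
  show "{X \<in> space (N x). ereal t < H_max E X} \<subseteq> {X \<in> space (N x). ereal s < H_max E X}"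
    using assms(3) by (auto intro: le_less_trans[of "ereal s" "ereal t"])
  show "{X \<in> space (N x). ereal t < H_max E X} \<in> sets (N x)" using assms by (intro survival_sets) auto
  show "{X \<in> space (N x). ereal s < H_max E X} \<in> fmeasurable (N x)"
    using survival_sets[OF assms(1,2)] survival_finite[OF assms(1,2)] by (simp add: fmeasurable_def)
qed

text \<open>The factor of e that remains in \<open>log_laplace_Lipschitz\<close> when the initial
  value tends to infinity.\<close>

definition Lip :: "real \<Rightarrow> real" where
  "Lip t = A * K\<^sup>2 / a\<^sup>2 * exp (K * t) / (1 - exp (- K * t))\<^sup>2"

lemma v_Lipschitz:
  assumes x: "x \<in> E" and t: "t > 0" and e: "e \<ge> 0"
  shows "v t x - v (t + e) x \<le> Lip t * e"
proof -
  have "(\<lambda>n. A * K\<^sup>2 / a\<^sup>2 * (e + 1 / (real (Suc n) * a)) * exp (K * t) / (1 - exp (- K * t))\<^sup>2) \<longlonglongrightarrow>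
      A * K\<^sup>2 / a\<^sup>2 * (e + 0 * (1 / a)) * exp (K * t) / (1 - exp (- K * t))\<^sup>2"
  proof -
    have "(\<lambda>n. 1 / real (Suc n) * (1 / a)) \<longlonglongrightarrow> 0 * (1 / a)"
      by (intro tendsto_mult tendsto_const LIMSEQ_inverse_real_of_nat[unfolded inverse_eq_divide])
    moreover have "1 - exp (- K * t) \<noteq> 0" using K(1) t by simp
    ultimately show ?thesis by (intro tendsto_intros) (simp_all add: divide_inverse)
  qed
  moreover have "(\<lambda>n. un n t x - un n (t + e) x) \<longlonglongrightarrow> v t x - v (t + e) x"
    using x t e by (intro tendsto_diff v_limit) auto
  ultimately have "v t x - v (t + e) x \<le> A * K\<^sup>2 / a\<^sup>2 * (e + 0 * (1 / a)) * exp (K * t) / (1 - exp (- K * t))\<^sup>2"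
    using log_laplace_Lipschitz[OF un _ t e x] by (intro LIMSEQ_le[of "\<lambda>n. un n t x - un n (t + e) x"]) auto
  then show ?thesis by (simp add: Lip_def mult.commute mult.left_commute)
qed

text \<open>Where \<open>v\<close> is not differentiable, \<open>deriv\<close> is one fixed junk value, which does not affect boundedness.\<close>

lemma deriv_v_bounded:
  assumes t: "t > 0"
  shows "\<exists>M. \<forall>x\<in>E. \<bar>deriv (\<lambda>r. v r x) t\<bar> \<le> M"
proof (intro exI ballI)
  fix x assume x: "x \<in> E"
  let ?junk = "SOME D :: real. False"
  show "\<bar>deriv (\<lambda>r. v r x) t\<bar> \<le> max (\<bar>Lip t\<bar>) \<bar>?junk\<bar>"
  proof (cases "\<exists>D. ((\<lambda>r. v r x) has_field_derivative D) (at t)")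
    case True
    then obtain D where D: "((\<lambda>r. v r x) has_field_derivative D) (at t)" by blast
    have lim: "((\<lambda>h. (v (t + h) x - v t x) / h) \<longlongrightarrow> D) (at_right 0)"
      using D unfolding DERIV_def by (rule filterlim_mono) (auto simp: at_le)
    have "D \<le> 0"
    proof (rule tendsto_upperbound[OF lim])
      show "\<forall>\<^sub>F h in at_right 0. (v (t + h) x - v t x) / h \<le> 0"
        using v_antimono[OF x t] by (auto simp: eventually_at_right_field divide_nonpos_pos intro!: exI[of _ 1])
    qed simp
    moreover have "- Lip t \<le> D"
    proof (rule tendsto_lowerbound[OF lim])
      show "\<forall>\<^sub>F h in at_right 0. - Lip t \<le> (v (t + h) x - v t x) / h"
        using v_Lipschitz[OF x t] by (auto simp: eventually_at_right_field pos_le_divide_eq algebra_simps intro!: exI[of _ 1])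
    qed simp
    ultimately have "\<bar>D\<bar> \<le> \<bar>Lip t\<bar>" by linarith
    then show ?thesis using DERIV_imp_deriv[OF D] by simp
  next
    case False
    then have "deriv (\<lambda>r. v r x) t = ?junk" by (simp add: deriv_def)
    then show ?thesis by simp
  qed
qed

text \<open>Joint measurability is inherited from the approximating solutions. The bound
  \<open>ubound\<close> degenerates as time approaches 0, hence the shift by e > 0.\<close>

lemma jmeas_v:
  assumes e: "e > 0" and T: "T \<ge> 0"
  shows "jmeas E T (\<lambda>r. v (e + r))"
proof -
  have un: "jmeas E T (\<lambda>r. un n (e + r))" for n
    using log_laplace_mild[OF un[of n], of "e + T"] e T
    by (intro jmeas_shift[of E "e + T"]) (auto simp: mild_def)
  have "(\<lambda>p. v (e + fst p) (snd p)) \<in> borel_measurable (restrict_space borel {0..T} \<Otimes>\<^sub>M borel_on E)"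
  proof (rule borel_measurable_LIMSEQ_metric)
    show "(\<lambda>p. un n (e + fst p) (snd p)) \<in> borel_measurable (restrict_space borel {0..T} \<Otimes>\<^sub>M borel_on E)" for n
      using un[of n] by (simp add: jmeas_def case_prod_unfold)
    show "(\<lambda>n. un n (e + fst p) (snd p)) \<longlonglongrightarrow> v (e + fst p) (snd p)"
      if "p \<in> space (restrict_space borel {0..T} \<Otimes>\<^sub>M borel_on E)" for p
      using that e by (intro v_limit) (auto simp: space_pair_measure)
  qed
  moreover have "\<bar>v (e + t) x\<bar> \<le> ubound e" if "t \<in> {0..T}" "x \<in> E" for t x
  proof -
    have "v (e + t) x \<le> v e x" using that e by (intro v_antimono) auto
    also have "\<dots> \<le> ubound e" by (rule v_le_ubound[OF that(2) e])
    finally show ?thesis using v_nonneg[of "e + t" x] by simp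
  qed
  ultimately show ?thesis unfolding jmeas_def by (auto simp: case_prod_beta intro!: exI[of _ "ubound e"])
qed

end

section \<open>Spine laws\<close>

lemma deriv_psi: "deriv (psi \<alpha> \<beta> y) l = \<beta> y + 2 * \<alpha> y * l"
proof (rule DERIV_imp_deriv)
  show "(psi \<alpha> \<beta> y has_real_derivative \<beta> y + 2 * \<alpha> y * l) (at l)"
    unfolding psi_def[abs_def] by (auto intro!: derivative_eq_intros)
qed

text \<open>A density on a sub-\<sigma>-field determines the measure there only, so both measures
  are restricted to F before they are compared.\<close>

lemma has_density_on_nn_integral:
  assumes d: "has_density_on F M Q Z" and M: "subalgebra M F" and Q: "subalgebra Q F"
    and X: "X \<in> borel_measurable F"
  shows "(\<integral>\<^sup>+\<omega>. X \<omega> \<partial>Q) = (\<integral>\<^sup>+\<omega>. ennreal (Z \<omega>) * X \<omega> \<partial>M)"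
proof -
  have Z: "Z \<in> borel_measurable F" and eq: "\<And>A. A \<in> sets F \<Longrightarrow> emeasure Q A = (\<integral>\<^sup>+\<omega>\<in>A. ennreal (Z \<omega>) \<partial>M)"
    using d by (auto simp: has_density_on_def)
  have Z': "(\<lambda>\<omega>. ennreal (Z \<omega>)) \<in> borel_measurable M"
    using measurable_from_subalg[OF M Z] by measurable
  define D where "D = density M (\<lambda>\<omega>. ennreal (Z \<omega>))"
  have D: "subalgebra D F" using M by (simp add: D_def subalgebra_def)
  have "restr_to_subalg Q F = restr_to_subalg D F"
  proof (rule measure_eqI)
    fix A assume "A \<in> sets (restr_to_subalg Q F)"
    then have A: "A \<in> sets F" by (simp add: sets_restr_to_subalg[OF Q])
    then have "A \<in> sets M" using M by (auto simp: subalgebra_def)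
    then show "emeasure (restr_to_subalg Q F) A = emeasure (restr_to_subalg D F) A"
      using Z' unfolding emeasure_restr_to_subalg[OF Q A] emeasure_restr_to_subalg[OF D A] eq[OF A]
      by (simp add: D_def emeasure_density)
  qed (simp add: sets_restr_to_subalg[OF Q] sets_restr_to_subalg[OF D])
  then have "(\<integral>\<^sup>+\<omega>. X \<omega> \<partial>Q) = (\<integral>\<^sup>+\<omega>. X \<omega> \<partial>D)"
    using nn_integral_subalgebra2[OF Q X] nn_integral_subalgebra2[OF D X] by simp
  then show ?thesis
    using Z' measurable_from_subalg[OF M X] by (simp add: D_def nn_integral_density)
qed

lemma skorokhod_const: "y \<in> E \<Longrightarrow> (\<lambda>_\<in>T. y) \<in> skorokhod E T"
proof -
  assume y: "y \<in> E"
  have "((\<lambda>_\<in>T. y) \<longlongrightarrow> y) (at t within T \<inter> B)" for t B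
    by (rule Lim_transform_eventually[OF tendsto_const]) (auto simp: eventually_at_filter)
  then show ?thesis using y by (auto simp: skorokhod_def)
qed

lemma jmeas_path_integrable:
  fixes E :: "'a::euclidean_space set"
  assumes G: "jmeas E T G" and t: "0 \<le> t" "t \<le> T" and \<omega>: "\<omega> \<in> skorokhod E {0..}"
  shows "integrable (leb t) (\<lambda>s. G (t - s) (\<omega> s))"
proof -
  obtain B where B: "\<forall>t\<in>{0..T}. \<forall>x\<in>E. \<bar>G t x\<bar> \<le> B" using jmeas_bound[OF G] by auto
  have i: "(\<lambda>s. s) \<in> borel_measurable (leb t)" by (rule measurable_restrict_space1) simp
  have w: "(\<lambda>_. \<omega>) \<in> leb t \<rightarrow>\<^sub>M path_space E {0..}" using \<omega> by (intro measurable_const) simp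
  show ?thesis
  proof (rule integrable_bounded[OF finite_leb])
    show "(\<lambda>s. G (t - s) (\<omega> s)) \<in> borel_measurable (leb t)"
      using t by (intro jmeas_measurable[OF G] measurable_path_eval[OF w i] borel_measurable_diff borel_measurable_const i) auto
    show "\<bar>G (t - s) (\<omega> s)\<bar> \<le> B" if "s \<in> space (leb t)" for s
      using that B t skorokhod_in[OF \<omega>, of s] by auto
  qed
qed

locale spine_motion = superprocess_motion E P \<alpha> \<beta> \<phi>0 L\<phi> L\<alpha> lam0 a A Bb C1 C2 K PP N
  for E :: "'a::euclidean_space set" and P \<alpha> \<beta> \<phi>0 L\<phi> L\<alpha> lam0 a A Bb C1 C2 K PP N +
  fixes P_phi S
  assumes P_phi: "locally_abs_continuous E P P_phi (phi_density \<beta> lam0 \<phi>0)"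
    and S: "\<And>h x. h > 0 \<Longrightarrow> x \<in> E \<Longrightarrow> spine_law E P \<alpha> \<beta> (vfun E N) h x (S h x)"
begin

definition d :: "real \<Rightarrow> 'a \<Rightarrow> real" where
  "d h x = deriv (\<lambda>r. v r x) h"

definition expo :: "real \<Rightarrow> real \<Rightarrow> 'a path \<Rightarrow> real" where
  "expo h t \<omega> = (\<integral>s. \<beta> (\<omega> s) + 2 * \<alpha> (\<omega> s) * v (h - s) (\<omega> s) \<partial>leb t)"

text \<open>The spine density without its normalisation \<open>d h x\<close>, the only part that
  depends on the start. What remains is multiplicative under the time shift.\<close>

definition Nn :: "real \<Rightarrow> real \<Rightarrow> 'a path \<Rightarrow> real" where
  "Nn h t \<omega> = d (h - t) (\<omega> t) * exp (- expo h t \<omega>)"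

lemma spine_density_eq: "spine_density \<alpha> \<beta> v h x t \<omega> = Nn h t \<omega> / d h x"
  unfolding spine_density_def Nn_def d_def expo_def deriv_psi integral_leb_set by simp

lemma
  assumes "h > 0" "x \<in> E"
  shows prob_space_S: "prob_space (S h x)" and sets_S: "sets (S h x) = sets (filt E (ennreal h))"
    and space_S: "space (S h x) = skorokhod E {0..}"
  using S[OF assms] sets_eq_imp_space_eq[of "S h x" "filt E (ennreal h)"] by (auto simp: spine_law_def)

lemma S_density:
  "h > 0 \<Longrightarrow> x \<in> E \<Longrightarrow> 0 \<le> t \<Longrightarrow> t < h \<Longrightarrow>
    has_density_on (filt E (ennreal t)) (P x) (S h x) (\<lambda>\<omega>. Nn h t \<omega> / d h x)"
  using S[of h x] by (simp add: spine_law_def spine_density_eq[abs_def] spine_density_eq)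

lemma sub_P: "x \<in> E \<Longrightarrow> subalgebra (P x) (filt E t)"
  by (rule subalgebra_filt[OF sets_P])

lemma sub_S: "h > 0 \<Longrightarrow> x \<in> E \<Longrightarrow> t \<le> ennreal h \<Longrightarrow> subalgebra (S h x) (filt E t)"
  using sets_filt_mono[of t "ennreal h" E] by (simp add: subalgebra_def sets_S space_S)

text \<open>Division by zero yields 0, so with \<open>d h x = 0\<close> the density at time 0 would
  vanish identically, although it integrates to 1.\<close>

lemma d_nonzero:
  assumes h: "h > 0" and x: "x \<in> E"
  shows "d h x \<noteq> 0"
proof
  assume 0: "d h x = 0"
  interpret prob_space "S h x" by (rule prob_space_S[OF h x])
  have "(\<integral>\<^sup>+\<omega>. 1 \<partial>S h x) = (\<integral>\<^sup>+\<omega>. ennreal (Nn h 0 \<omega> / d h x) * 1 \<partial>P x)"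
    using h x by (intro has_density_on_nn_integral[OF S_density sub_P sub_S]) auto
  then show False using 0 emeasure_space_1 by simp
qed

lemma measurable_Nn:
  assumes h: "h > 0" and t: "0 \<le> t" "t < h"
  shows "Nn h t \<in> borel_measurable (filt E (ennreal t))"
proof (cases "E = {}")
  case True
  then have "space (filt E (ennreal t)) = {}" by (auto simp: skorokhod_def)
  then show ?thesis by (auto simp: measurable_def)
next
  case False
  then obtain x where x: "x \<in> E" by auto
  have "(\<lambda>\<omega>. Nn h t \<omega> / d h x) \<in> borel_measurable (filt E (ennreal t))"
    using S_density[OF h x t] by (simp add: has_density_on_def)
  then have "(\<lambda>\<omega>. (Nn h t \<omega> / d h x) * d h x) \<in> borel_measurable (filt E (ennreal t))" by measurable
  then show ?thesis using d_nonzero[OF h x] by simp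
qed

text \<open>At time 0 along a constant path \<open>Nn\<close> reduces to \<open>d\<close>, so the
  measurability contained in the existence of a spine density passes to the derivative of v.\<close>

lemma d_measurable:
  assumes h: "h > 0"
  shows "d h \<in> borel_measurable (borel_on E)"
proof -
  have "(\<lambda>y. \<lambda>_\<in>{0..}. y) \<in> borel_on E \<rightarrow>\<^sub>M path_space E {0..}"
    by (rule measurable_coord_algebraI) (auto simp: skorokhod_const intro: measurable_restrict_space1)
  from measurable_compose[OF this measurable_filt_path[OF measurable_Nn[OF h order_refl h]]]
  have "(\<lambda>y. Nn h 0 (\<lambda>_\<in>{0..}. y)) \<in> borel_measurable (borel_on E)" .
  moreover have "expo h 0 \<omega> = 0" for \<omega>
    unfolding expo_def integral_leb_set using set_integral_singleton[of 0] by simp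
  ultimately show ?thesis by (simp add: Nn_def)
qed

text \<open>Obtained as the quotient of \<open>Nn (r + T) r\<close> by
  \<open>d T (\<omega> r)\<close>, which makes sense because the derivative of v does not vanish at
  T > 0.\<close>

lemma measurable_exp_expo:
  assumes r: "0 \<le> r" and T: "T > 0"
  shows "(\<lambda>\<omega>. exp (- expo (r + T) r \<omega>)) \<in> borel_measurable (filt E (ennreal r))"
proof -
  have "(\<lambda>\<omega>. d T (\<omega> r)) \<in> borel_measurable (filt E (ennreal r))"
    using r by (intro measurable_compose[OF measurable_coord_filt[OF coord_measurable] d_measurable[OF T]]) auto
  moreover have "Nn (r + T) r \<in> borel_measurable (filt E (ennreal r))"
    using r T by (intro measurable_Nn) auto
  ultimately have "(\<lambda>\<omega>. Nn (r + T) r \<omega> / d T (\<omega> r)) \<in> borel_measurable (filt E (ennreal r))" by measurable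
  then show ?thesis
  proof (rule measurable_cong[THEN iffD1, rotated])
    fix \<omega> assume "\<omega> \<in> space (filt E (ennreal r))"
    then have "\<omega> r \<in> E" using skorokhod_in[of \<omega> E "{0..}" r] r by simp
    then show "Nn (r + T) r \<omega> / d T (\<omega> r) = exp (- expo (r + T) r \<omega>)"
      using d_nonzero[OF T] by (simp add: Nn_def)
  qed
qed

lemma jmeas_potential:
  assumes "e > 0" "T \<ge> 0"
  shows "jmeas E T (\<lambda>\<tau> y. \<beta> y + 2 * \<alpha> y * v (e + \<tau>) y)"
  using jmeas_add[OF jmeas_\<beta> jmeas_mult[OF jmeas_cmult[OF jmeas_\<alpha>, of _ 2] jmeas_v[OF assms]]] by simp

lemma expo_shift:
  assumes \<omega>: "\<omega> \<in> skorokhod E {0..}" and r: "0 \<le> r" and u: "0 \<le> u" "u < T"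
  shows "expo (r + T) (r + u) \<omega> = expo (r + T) r \<omega> + expo T u (path_shift r \<omega>)"
proof -
  let ?g = "\<lambda>s. \<beta> (\<omega> s) + 2 * \<alpha> (\<omega> s) * v (r + T - s) (\<omega> s)"
  \<comment> \<open>The remaining lifetime is written as (T - u) + (r + u - s) with T - u > 0, so
    that v stays away from time 0 and \<open>jmeas_potential\<close> applies.\<close>
  have "integrable (leb (r + u)) (\<lambda>s. \<beta> (\<omega> s) + 2 * \<alpha> (\<omega> s) * v ((T - u) + (r + u - s)) (\<omega> s))"
    using r u by (intro jmeas_path_integrable[OF jmeas_potential _ order_refl \<omega>]) auto
  then have i: "integrable (leb (r + u)) ?g" by (simp add: algebra_simps)
  have "expo (r + T) (r + u) \<omega> = (\<integral>s. ?g s \<partial>leb r) + (\<integral>s. ?g (r + s) \<partial>leb (r + u - r))"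
    unfolding expo_def using r u by (intro integral_leb_split(1)[OF _ _ i]) auto
  also have "(\<integral>s. ?g (r + s) \<partial>leb (r + u - r)) = expo T u (path_shift r \<omega>)"
    unfolding expo_def by (intro Bochner_Integration.integral_cong) (auto simp: path_shift_def algebra_simps)
  finally show ?thesis by (simp add: expo_def)
qed

lemma Nn_shift:
  assumes \<omega>: "\<omega> \<in> skorokhod E {0..}" and r: "0 \<le> r" and u: "0 \<le> u" "u < T"
  shows "Nn (r + T) (r + u) \<omega> = exp (- expo (r + T) r \<omega>) * Nn T u (path_shift r \<omega>)"
proof -
  have "path_shift r \<omega> u = \<omega> (r + u)" "r + T - (r + u) = T - u" using u by (auto simp: path_shift_def)
  then show ?thesis by (simp only: Nn_def expo_shift[OF assms] minus_add_distrib exp_add mult_ac)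
qed

text \<open>Times before the lifetime at which the terminal density is approached. The minimum keeps
  h - ep h n nonnegative, and eventually the sequence is the same for all lifetimes, as the passage
  from r + T to T requires.\<close>

definition ep :: "real \<Rightarrow> nat \<Rightarrow> real" where "ep h n = min h (1 / real (Suc n))"

text \<open>The terminal value of the unnormalised density as one function of the path, valid for
  all starts at once, whereas the limit in \<open>spine_law\<close> is chosen for each start up to
  null sets. Absolute values are taken since the sign of the derivative of v only cancels after
  normalisation.\<close>

definition NL :: "real \<Rightarrow> 'a path \<Rightarrow> real" where
  "NL h \<omega> = lim (\<lambda>n. \<bar>Nn h (h - ep h n) \<omega>\<bar>)"

lemma ep: "h > 0 \<Longrightarrow> 0 < ep h n" "ep h n \<le> h"
  by (auto simp: ep_def)

lemma ep_LIMSEQ: "h > 0 \<Longrightarrow> ep h \<longlonglongrightarrow> 0"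
  using tendsto_min[OF tendsto_const[of h] LIMSEQ_inverse_real_of_nat[unfolded inverse_eq_divide]]
  by (simp add: ep_def[abs_def])

lemma ep_eventually:
  assumes "T > 0" "r \<ge> 0"
  shows "\<forall>\<^sub>F n in sequentially. ep (r + T) n = ep T n"
proof -
  have "\<forall>\<^sub>F n in sequentially. 1 / real (Suc n) < T"
    using LIMSEQ_inverse_real_of_nat[unfolded inverse_eq_divide] assms(1) by (rule order_tendstoD(2))
  then show ?thesis by eventually_elim (use assms in \<open>auto simp: ep_def\<close>)
qed

lemma measurable_NL:
  assumes h: "h > 0"
  shows "NL h \<in> borel_measurable (path_space E {0..})"
proof -
  have "Nn h (h - ep h n) \<in> borel_measurable (path_space E {0..})" for n
    using ep[of h n] h by (intro measurable_filt_path[OF measurable_Nn[OF h]]) auto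
  then show ?thesis unfolding NL_def[abs_def] by (intro borel_measurable_lim_metric borel_measurable_abs)
qed

lemma spine_limit:
  assumes h: "h > 0" and x: "x \<in> E"
  obtains M where "has_density_on (filt E (ennreal h)) (P x) (S h x) M"
    "AE \<omega> in P x. (\<lambda>n. \<bar>Nn h (h - ep h n) \<omega>\<bar>) \<longlonglongrightarrow> \<bar>d h x\<bar> * M \<omega>"
    "AE \<omega> in P x. NL h \<omega> = \<bar>d h x\<bar> * M \<omega>"
proof -
  obtain M where M: "AE \<omega> in P x. ((\<lambda>t. Nn h t \<omega> / d h x) \<longlongrightarrow> M \<omega>) (at_left h)"
      "has_density_on (filt E (ennreal h)) (P x) (S h x) M"
    using S[OF h x] unfolding spine_law_def spine_density_eq by auto
  have pos: "AE \<omega> in P x. 0 \<le> M \<omega>" using M(2) by (simp add: has_density_on_def)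
  have "filterlim (\<lambda>n. h - ep h n) (at_left h) sequentially"
  proof -
    have "(\<lambda>n. h - ep h n) \<longlonglongrightarrow> h - 0" by (intro tendsto_intros ep_LIMSEQ[OF h])
    moreover have "h - ep h n < h \<and> h - ep h n \<noteq> h" for n using ep(1)[OF h, of n] by simp
    ultimately show ?thesis by (simp add: filterlim_at)
  qed
  note fl = this
  have 1: "AE \<omega> in P x. (\<lambda>n. \<bar>Nn h (h - ep h n) \<omega>\<bar>) \<longlonglongrightarrow> \<bar>d h x\<bar> * M \<omega>"
    using M(1) pos
  proof eventually_elim
    case (elim \<omega>)
    have "(\<lambda>n. \<bar>d h x\<bar> * \<bar>Nn h (h - ep h n) \<omega> / d h x\<bar>) \<longlonglongrightarrow> \<bar>d h x\<bar> * \<bar>M \<omega>\<bar>"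
      by (intro tendsto_intros filterlim_compose[OF elim(1) fl])
    then show ?case using elim(2) d_nonzero[OF h x] by (simp add: abs_divide)
  qed
  then have "AE \<omega> in P x. NL h \<omega> = \<bar>d h x\<bar> * M \<omega>"
    by eventually_elim (simp add: NL_def limI)
  with M(2) 1 show ?thesis by (rule that)
qed

lemma S_nn_integral:
  assumes h: "h > 0" and x: "x \<in> E" and F: "F \<in> borel_measurable (filt E (ennreal h))"
  shows "(\<integral>\<^sup>+\<omega>. ennreal (NL h \<omega>) * F \<omega> \<partial>P x) = ennreal \<bar>d h x\<bar> * (\<integral>\<^sup>+\<omega>. F \<omega> \<partial>S h x)"
proof -
  obtain M where M: "has_density_on (filt E (ennreal h)) (P x) (S h x) M"
    "AE \<omega> in P x. NL h \<omega> = \<bar>d h x\<bar> * M \<omega>"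
    by (rule spine_limit[OF h x]) (rule that)
  have Mm: "M \<in> borel_measurable (P x)"
    using M(1) measurable_filt_path unfolding measurable_P[OF x] has_density_on_def by blast
  have Fm: "F \<in> borel_measurable (P x)"
    using measurable_filt_path[OF F] unfolding measurable_P[OF x] .
  have "(\<integral>\<^sup>+\<omega>. ennreal (NL h \<omega>) * F \<omega> \<partial>P x) = (\<integral>\<^sup>+\<omega>. ennreal \<bar>d h x\<bar> * (ennreal (M \<omega>) * F \<omega>) \<partial>P x)"
    using M(2) by (intro nn_integral_cong_AE) (auto elim!: eventually_mono simp: ennreal_mult' mult.assoc)
  also have "\<dots> = ennreal \<bar>d h x\<bar> * (\<integral>\<^sup>+\<omega>. ennreal (M \<omega>) * F \<omega> \<partial>P x)"
    using Mm Fm by (intro nn_integral_cmult) measurable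
  also have "(\<integral>\<^sup>+\<omega>. ennreal (M \<omega>) * F \<omega> \<partial>P x) = (\<integral>\<^sup>+\<omega>. F \<omega> \<partial>S h x)"
    by (rule has_density_on_nn_integral[OF M(1) sub_P[OF x] sub_S[OF h x order_refl] F, symmetric])
  finally show ?thesis .
qed

text \<open>The unnormalised terminal density of lifetime r + T is the exponential weight up to r
  times that of the shifted path with lifetime T. The Markov property of the underlying motion then
  separates the two factors.\<close>

lemma spine_markov:
  assumes r: "0 \<le> r" and T: "T > 0" and x: "x \<in> E"
    and F: "F \<in> borel_measurable (filt E (ennreal T))"
    and Fh: "F' \<in> borel_measurable (filt E (ennreal (r + T)))"
    and FF: "\<And>\<omega>. \<omega> \<in> skorokhod E {0..} \<Longrightarrow> F' \<omega> = F (path_shift r \<omega>)"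
  shows "ennreal \<bar>d (r + T) x\<bar> * (\<integral>\<^sup>+\<omega>. F' \<omega> \<partial>S (r + T) x) =
    (\<integral>\<^sup>+\<omega>. ennreal (exp (- expo (r + T) r \<omega>)) * (ennreal \<bar>d T (\<omega> r)\<bar> * (\<integral>\<^sup>+\<eta>. F \<eta> \<partial>S T (\<omega> r))) \<partial>P x)"
proof -
  let ?h = "r + T"
  have h: "?h > 0" using r T by simp
  obtain M where M: "AE \<omega> in P x. (\<lambda>n. \<bar>Nn ?h (?h - ep ?h n) \<omega>\<bar>) \<longlonglongrightarrow> \<bar>d ?h x\<bar> * M \<omega>"
    "AE \<omega> in P x. NL ?h \<omega> = \<bar>d ?h x\<bar> * M \<omega>"
    by (rule spine_limit[OF h x]) (rule that)
  have NLs: "AE \<omega> in P x. NL ?h \<omega> = exp (- expo ?h r \<omega>) * NL T (path_shift r \<omega>)"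
    using M AE_space
  proof eventually_elim
    case (elim \<omega>)
    have \<omega>: "\<omega> \<in> skorokhod E {0..}" using elim(3) by (simp add: space_P[OF x])
    let ?c = "exp (- expo ?h r \<omega>)"
    have "\<forall>\<^sub>F n in sequentially. \<bar>Nn ?h (?h - ep ?h n) \<omega>\<bar> = ?c * \<bar>Nn T (T - ep T n) (path_shift r \<omega>)\<bar>"
      using ep_eventually[OF T r]
    proof eventually_elim
      case (elim n)
      have "Nn ?h (?h - ep ?h n) \<omega> = ?c * Nn T (T - ep T n) (path_shift r \<omega>)"
        using Nn_shift[OF \<omega> r, of "T - ep T n" T] ep[of T n] T unfolding elim by (simp add: add_diff_eq)
      then show ?case unfolding abs_mult by (simp add: abs_mult)
    qed
    then have "(\<lambda>n. ?c * \<bar>Nn T (T - ep T n) (path_shift r \<omega>)\<bar>) \<longlonglongrightarrow> \<bar>d ?h x\<bar> * M \<omega>"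
      using elim(1) by (rule Lim_transform_eventually[rotated])
    \<comment> \<open>\<open>NL T\<close> is a \<open>lim\<close> and has the intended value only
      once the shifted sequence converges. Convergence is inherited from the long lifetime by
      dividing by the positive weight.\<close>
    then have "(\<lambda>n. (1 / ?c) * (?c * \<bar>Nn T (T - ep T n) (path_shift r \<omega>)\<bar>)) \<longlonglongrightarrow> (1 / ?c) * (\<bar>d ?h x\<bar> * M \<omega>)"
      by (rule tendsto_mult[OF tendsto_const])
    then have "(\<lambda>n. \<bar>Nn T (T - ep T n) (path_shift r \<omega>)\<bar>) \<longlonglongrightarrow> (1 / ?c) * (\<bar>d ?h x\<bar> * M \<omega>)" by simp
    then have "NL T (path_shift r \<omega>) = (1 / ?c) * NL ?h \<omega>" unfolding NL_def[of T] elim(2) by (rule limI)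
    then show ?case by simp
  qed
  have Fp: "F \<in> borel_measurable (path_space E {0..})" by (rule measurable_filt_path[OF F])
  have "ennreal \<bar>d ?h x\<bar> * (\<integral>\<^sup>+\<omega>. F' \<omega> \<partial>S ?h x) = (\<integral>\<^sup>+\<omega>. ennreal (NL ?h \<omega>) * F' \<omega> \<partial>P x)"
    by (rule S_nn_integral[OF h x Fh, symmetric])
  also have "\<dots> = (\<integral>\<^sup>+\<omega>. ennreal (exp (- expo ?h r \<omega>)) * (\<lambda>\<eta>. ennreal (NL T \<eta>) * F \<eta>) (path_shift r \<omega>) \<partial>P x)"
    using NLs AE_space
    by (intro nn_integral_cong_AE, eventually_elim) (simp add: FF space_P[OF x] ennreal_mult' mult.assoc)
  also have "\<dots> = (\<integral>\<^sup>+\<omega>. ennreal (exp (- expo ?h r \<omega>)) * (\<integral>\<^sup>+\<eta>. ennreal (NL T \<eta>) * F \<eta> \<partial>P (\<omega> r)) \<partial>P x)"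
  proof -
    have m1: "(\<lambda>\<omega>. ennreal (exp (- expo ?h r \<omega>))) \<in> borel_measurable (filt E (ennreal r))"
      by (rule measurable_compose[OF measurable_exp_expo[OF r T] measurable_ennreal])
    have m2: "(\<lambda>\<eta>. ennreal (NL T \<eta>) * F \<eta>) \<in> borel_measurable (path_space E {0..})"
      by (intro borel_measurable_times_ennreal measurable_compose[OF measurable_NL[OF T] measurable_ennreal] Fp)
    show ?thesis by (rule markov_nn_integral[OF x r m1 m2])
  qed
  also have "\<dots> = (\<integral>\<^sup>+\<omega>. ennreal (exp (- expo ?h r \<omega>)) * (ennreal \<bar>d T (\<omega> r)\<bar> * (\<integral>\<^sup>+\<eta>. F \<eta> \<partial>S T (\<omega> r))) \<partial>P x)"
    by (intro nn_integral_cong) (simp add: S_nn_integral[OF T path_in[OF x _ r] F])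
  finally show ?thesis .
qed

text \<open>\<open>spine_law\<close> treats each start separately. Measurability in the start comes
  from writing the expectation as one under the kernel P, with the common functional
  \<open>NL T\<close>, divided by the derivative of v.\<close>

lemma S_kernel_measurable:
  assumes T: "T > 0" and F: "F \<in> borel_measurable (filt E (ennreal T))"
  shows "(\<lambda>y. \<integral>\<^sup>+\<eta>. F \<eta> \<partial>S T y) \<in> borel_measurable (borel_on E)"
proof -
  have "(\<lambda>y. \<integral>\<^sup>+\<eta>. ennreal (NL T \<eta>) * F \<eta> \<partial>P y) \<in> borel_measurable (borel_on E)"
    using measurable_NL[OF T] measurable_filt_path[OF F]
    by (intro measurable_compose[OF P_subprob nn_integral_measurable_subprob_algebra]) measurable
  then have "(\<lambda>y. (\<integral>\<^sup>+\<eta>. ennreal (NL T \<eta>) * F \<eta> \<partial>P y) / ennreal \<bar>d T y\<bar>) \<in> borel_measurable (borel_on E)"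
    using d_measurable[OF T] by measurable
  then show ?thesis
  proof (rule measurable_cong[THEN iffD1, rotated])
    fix y assume "y \<in> space (borel_on E)"
    then have y: "y \<in> E" by simp
    have "\<bar>d T y\<bar> > 0" using d_nonzero[OF T y] by simp
    then show "(\<integral>\<^sup>+\<eta>. ennreal (NL T \<eta>) * F \<eta> \<partial>P y) / ennreal \<bar>d T y\<bar> = (\<integral>\<^sup>+\<eta>. F \<eta> \<partial>S T y)"
      unfolding S_nn_integral[OF T y F]
      by (subst mult.commute, intro ennreal_mult_divide_eq) auto
  qed
qed

text \<open>The integral of 2 A times the exponential bound ubound T * exp (- lam0 (u - T)) over u
  in [T, \<infinity>).\<close>

definition alive_bound :: "real \<Rightarrow> real" where "alive_bound T = 2 * A / lam0 * ubound T"

lemma ubound_decay: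
  assumes "E \<noteq> {}" "0 < T" "T \<le> u"
  shows "ubound u \<le> ubound T * exp (- lam0 * (u - T))"
proof -
  define c where "c = C2 * (lam0 / (a * C1))"
  have c: "c \<ge> 0" using C2_pos[OF assms(1)] lam0 a C1 by (simp add: c_def)
  have e: "exp (lam0 * T) > 1" using lam0 assms by simp
  have eu: "exp (lam0 * u) > 1" using lam0 assms by simp
  have "exp (lam0 * u) = exp (lam0 * (u - T)) * exp (lam0 * T)" by (simp add: exp_add[symmetric] algebra_simps)
  moreover have "exp (lam0 * (u - T)) \<ge> 1" using lam0 assms by simp
  ultimately have "exp (lam0 * (u - T)) * (exp (lam0 * T) - 1) \<le> exp (lam0 * u) - 1" by (simp add: algebra_simps)
  then have "c / (exp (lam0 * u) - 1) \<le> c / (exp (lam0 * (u - T)) * (exp (lam0 * T) - 1))"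
    using c e eu by (intro divide_left_mono mult_pos_pos) auto
  also have "\<dots> = c / (exp (lam0 * T) - 1) * exp (- lam0 * (u - T))"
    by (simp add: exp_minus divide_inverse mult_ac)
  finally show ?thesis by (simp add: ubound_def c_def)
qed

text \<open>The two sides differ by the integral of 2 \<alpha> v at remaining lifetimes at least T.
  It is nonnegative, and the exponential decay of \<open>ubound\<close> keeps it below a constant
  that does not depend on r.\<close>

lemma expo_bounds:
  assumes \<omega>: "\<omega> \<in> skorokhod E {0..}" and r: "0 \<le> r" and T: "T > 0"
  shows "(\<integral>s. \<beta> (\<omega> s) \<partial>leb r) \<le> expo (r + T) r \<omega>"
    and "expo (r + T) r \<omega> \<le> (\<integral>s. \<beta> (\<omega> s) \<partial>leb r) + alive_bound T"
proof -
  have E: "E \<noteq> {}" using skorokhod_in[OF \<omega>, of 0] by auto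
  have i1: "integrable (leb r) (\<lambda>s. \<beta> (\<omega> s))"
    by (rule jmeas_path_integrable[OF jmeas_\<beta> r order_refl \<omega>])
  have jv: "jmeas E r (\<lambda>\<tau> y. 2 * \<alpha> y * v (T + \<tau>) y)"
    by (rule jmeas_mult[OF jmeas_cmult[OF jmeas_\<alpha>] jmeas_v[OF T r]])
  have "integrable (leb r) (\<lambda>s. 2 * \<alpha> (\<omega> s) * v (T + (r - s)) (\<omega> s))"
    by (rule jmeas_path_integrable[OF jv r order_refl \<omega>])
  then have i2: "integrable (leb r) (\<lambda>s. 2 * \<alpha> (\<omega> s) * v (r + T - s) (\<omega> s))" by (simp add: algebra_simps)
  have eq: "expo (r + T) r \<omega> = (\<integral>s. \<beta> (\<omega> s) \<partial>leb r) + (\<integral>s. 2 * \<alpha> (\<omega> s) * v (r + T - s) (\<omega> s) \<partial>leb r)"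
    unfolding expo_def by (rule Bochner_Integration.integral_add[OF i1 i2])
  have in_E: "\<omega> s \<in> E" if "s \<in> {0..r}" for s using skorokhod_in[OF \<omega>, of s] that by simp
  have "0 \<le> (\<integral>s. 2 * \<alpha> (\<omega> s) * v (r + T - s) (\<omega> s) \<partial>leb r)"
  proof (rule Bochner_Integration.integral_nonneg)
    fix s assume "s \<in> space (leb r)"
    then have "\<alpha> (\<omega> s) > 0" by (intro \<alpha>_pos in_E) simp
    then show "0 \<le> 2 * \<alpha> (\<omega> s) * v (r + T - s) (\<omega> s)" by (intro mult_nonneg_nonneg v_nonneg) auto
  qed
  then show "(\<integral>s. \<beta> (\<omega> s) \<partial>leb r) \<le> expo (r + T) r \<omega>" unfolding eq by simp
  let ?g = "\<lambda>s. 2 * A * ubound T * exp (- lam0 * (r - s))"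
  have cg: "continuous_on {0..r} ?g" by (intro continuous_intros)
  have ig: "integrable (leb r) ?g"
    using borel_integrable_compact[OF _ cg] by (subst integrable_restrict_space) (auto simp: mult.commute)
  obtain y where y: "y \<in> E" using E by auto
  have A0: "A \<ge> 0" using \<alpha>_pos[OF y] A[OF y] by linarith
  have "(\<integral>s. 2 * \<alpha> (\<omega> s) * v (r + T - s) (\<omega> s) \<partial>leb r) \<le> (\<integral>s. ?g s \<partial>leb r)"
  proof (rule integral_mono[OF i2 ig])
    fix s assume s: "s \<in> space (leb r)"
    have "v (r + T - s) (\<omega> s) \<le> ubound (r + T - s)" using s T in_E by (intro v_le_ubound) auto
    also have "\<dots> \<le> ubound T * exp (- lam0 * ((r + T - s) - T))" using s T E by (intro ubound_decay) auto
    finally have vb: "v (r + T - s) (\<omega> s) \<le> ubound T * exp (- lam0 * (r - s))" by (simp add: algebra_simps)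
    have "\<alpha> (\<omega> s) * v (r + T - s) (\<omega> s) \<le> A * (ubound T * exp (- lam0 * (r - s)))"
      using A in_E s A0 v_nonneg by (intro mult_mono vb) auto
    then show "2 * \<alpha> (\<omega> s) * v (r + T - s) (\<omega> s) \<le> ?g s" by (simp add: algebra_simps)
  qed
  also have "\<dots> = (\<integral>s. 2 * A * ubound T * exp (- lam0 * s) \<partial>leb r)"
    using integral_leb_reflect[of r "\<lambda>s. 2 * A * ubound T * exp (- lam0 * s)"] by simp
  also have "\<dots> = (- (2 * A * ubound T / lam0) * exp (- lam0 * r)) - (- (2 * A * ubound T / lam0) * exp (- lam0 * 0))"
    using lam0 by (intro integral_leb_FTC r) (auto intro!: derivative_eq_intros continuous_intros)
  also have "\<dots> \<le> alive_bound T"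
    using lam0 A0 ubound_nonneg[OF y T] by (simp add: alive_bound_def)
  finally show "expo (r + T) r \<omega> \<le> (\<integral>s. \<beta> (\<omega> s) \<partial>leb r) + alive_bound T" unfolding eq by simp
qed

end

section \<open>Convergence of the reversed spine\<close>

text \<open>Numerator D e and denominator D are each known up to a factor in [exp (- c), 1] relative
  to \<Lambda> p and \<Lambda> q. In the quotient D and \<Lambda> cancel, so e lies between exp (-
  c) p / q and exp c p / q, and p / q \<le> 1 makes the error absolute.\<close>

lemma ratio_bound:
  fixes e p q D \<Lambda> c :: real
  assumes c: "c \<ge> 0" and \<Lambda>: "\<Lambda> > 0" and D: "D > 0" and pq: "0 \<le> p" "p \<le> q"
    and 1: "D * e \<le> \<Lambda> * p" "exp (- c) * (\<Lambda> * p) \<le> D * e"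
    and 2: "D \<le> \<Lambda> * q" "exp (- c) * (\<Lambda> * q) \<le> D"
  shows "\<bar>e - p / q\<bar> \<le> exp c - 1"
proof -
  have q: "q > 0"
  proof (rule ccontr)
    assume "\<not> q > 0"
    then have "\<Lambda> * q \<le> 0" using \<Lambda> by (simp add: mult_le_0_iff)
    then show False using 2(1) D by simp
  qed
  define \<rho> where "\<rho> = p / q"
  have \<rho>: "0 \<le> \<rho>" "\<rho> \<le> 1" "p = \<rho> * q" using pq q by (auto simp: \<rho>_def)
  have "\<Lambda> * q = exp c * (exp (- c) * (\<Lambda> * q))" by (simp add: mult.assoc[symmetric] exp_add[symmetric])
  also have "\<dots> \<le> exp c * D" using 2(2) by (intro mult_left_mono) auto
  finally have "\<Lambda> * q \<le> exp c * D" .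
  then have "\<Lambda> * p \<le> \<rho> * (exp c * D)"
    using mult_left_mono[of "\<Lambda> * q" "exp c * D" \<rho>] \<rho> by (simp add: mult_ac)
  then have "D * e \<le> D * (\<rho> * exp c)" using 1(1) by (simp add: mult_ac)
  then have up: "e \<le> \<rho> * exp c" using D by simp
  have "\<rho> * D \<le> \<Lambda> * p" using mult_left_mono[OF 2(1) \<rho>(1)] \<rho>(3) by (simp add: mult_ac)
  then have "exp (- c) * (\<rho> * D) \<le> exp (- c) * (\<Lambda> * p)" by (intro mult_left_mono) auto
  from order_trans[OF this 1(2)] have "D * (exp (- c) * \<rho>) \<le> D * e" by (simp add: mult_ac)
  then have lo: "exp (- c) * \<rho> \<le> e" using D by simp
  have "1 \<le> exp c" using c by simp
  then have "e - \<rho> \<le> exp c - 1"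
    using up mult_right_mono[OF \<rho>(2), of "exp c - 1"] by (simp add: algebra_simps)
  moreover have "\<rho> - e \<le> exp c - 1"
  proof -
    have "\<rho> - e \<le> (1 - exp (- c)) * \<rho>" using lo by (simp add: algebra_simps)
    also have "\<dots> \<le> (1 - exp (- c)) * 1" using c \<rho>(2) by (intro mult_left_mono) auto
    also have "\<dots> \<le> c" using exp_ge_add_one_self[of "- c"] by simp
    also have "\<dots> \<le> exp c - 1" using exp_ge_add_one_self[of c] by (simp only: le_diff_eq add.commute)
    finally show ?thesis .
  qed
  ultimately show ?thesis unfolding \<rho>_def by linarith
qed

section \<open>The transform by the eigenfunction\<close>

context spine_motion
begin

lemma
  assumes x: "x \<in> E"
  shows prob_space_phi: "prob_space (P_phi x)" and sets_phi: "sets (P_phi x) = sets (path_space E {0..})"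
    and space_phi: "space (P_phi x) = skorokhod E {0..}"
    and phi_has_density: "0 \<le> r \<Longrightarrow>
      has_density_on (filt E (ennreal r)) (P x) (P_phi x) (phi_density \<beta> lam0 \<phi>0 x r)"
  using P_phi x sets_eq_imp_space_eq[of "P_phi x" "path_space E {0..}"]
  by (auto simp: locally_abs_continuous_def)

definition Qt :: "real \<Rightarrow> ('a \<Rightarrow> real) \<Rightarrow> 'a \<Rightarrow> real" where
  "Qt r F x = (\<integral>\<omega>. F (\<omega> r) \<partial>P_phi x)"

lemma \<phi>0_measurable: "\<phi>0 \<in> borel_measurable (borel_on E)"
  using L\<phi>(1) by (auto simp: has_generator_def intro: C_b_measurable)

lemma coord_filt: "0 \<le> r \<Longrightarrow> (\<lambda>\<omega>. \<omega> r) \<in> filt E (ennreal r) \<rightarrow>\<^sub>M borel_on E"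
  by (intro measurable_coord_filt coord_measurable) auto

text \<open>The change of measure solved for the Feynman-Kac functional with potential \<beta>: the
  factor \<phi>0 at time r is compensated by dividing H, and lam0 and the initial value leave a
  deterministic prefactor.\<close>

lemma phi_nn_integral:
  assumes r: "0 \<le> r" and x: "x \<in> E" and H: "H \<in> borel_measurable (borel_on E)" "\<And>y. y \<in> E \<Longrightarrow> 0 \<le> H y"
  shows "ennreal (\<phi>0 x * exp (- lam0 * r)) * (\<integral>\<^sup>+\<omega>. ennreal (H (\<omega> r) / \<phi>0 (\<omega> r)) \<partial>P_phi x) =
    (\<integral>\<^sup>+\<omega>. ennreal (exp (- (\<integral>s. \<beta> (\<omega> s) \<partial>leb r))) * ennreal (H (\<omega> r)) \<partial>P x)"
proof -
  let ?X = "\<lambda>\<omega>. ennreal (H (\<omega> r) / \<phi>0 (\<omega> r))"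
  have X: "?X \<in> borel_measurable (filt E (ennreal r))"
    by (intro measurable_compose[OF _ measurable_ennreal] borel_measurable_divide
        measurable_compose[OF coord_filt[OF r] H(1)] measurable_compose[OF coord_filt[OF r] \<phi>0_measurable])
  note dens = phi_has_density[OF x r]
  have Zm: "phi_density \<beta> lam0 \<phi>0 x r \<in> borel_measurable (P x)"
    using dens measurable_filt_path unfolding measurable_P[OF x] has_density_on_def by blast
  have Xm: "?X \<in> borel_measurable (P x)"
    using measurable_filt_path[OF X] unfolding measurable_P[OF x] .
  have sub: "subalgebra (P_phi x) (filt E (ennreal r))" by (rule subalgebra_filt[OF sets_phi[OF x]])
  have "ennreal (\<phi>0 x * exp (- lam0 * r)) * (\<integral>\<^sup>+\<omega>. ?X \<omega> \<partial>P_phi x) =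
      (\<integral>\<^sup>+\<omega>. ennreal (\<phi>0 x * exp (- lam0 * r)) * (ennreal (phi_density \<beta> lam0 \<phi>0 x r \<omega>) * ?X \<omega>) \<partial>P x)"
    unfolding has_density_on_nn_integral[OF dens sub_P[OF x] sub X]
    by (rule nn_integral_cmult[symmetric]) (use Zm Xm in measurable)
  also have "\<dots> = (\<integral>\<^sup>+\<omega>. ennreal (exp (- (\<integral>s. \<beta> (\<omega> s) \<partial>leb r))) * ennreal (H (\<omega> r)) \<partial>P x)"
  proof (rule nn_integral_cong_AE)
    show "AE \<omega> in P x. ennreal (\<phi>0 x * exp (- lam0 * r)) * (ennreal (phi_density \<beta> lam0 \<phi>0 x r \<omega>) * ?X \<omega>) =
        ennreal (exp (- (\<integral>s. \<beta> (\<omega> s) \<partial>leb r))) * ennreal (H (\<omega> r))"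
      \<comment> \<open>\<open>phi_density\<close> divides by \<phi>0 at the position of the path at
        time 0, which equals x only almost surely.\<close>
      using AE_start[OF x] AE_space
    proof eventually_elim
      case (elim \<omega>)
      have \<omega>: "\<omega> \<in> skorokhod E {0..}" using elim(2) by (simp add: space_P[OF x])
      have y: "\<omega> r \<in> E" using path_in[OF x elim(2) r] .
      have "(\<integral>s. \<beta> (\<omega> s) - lam0 \<partial>leb r) = (\<integral>s. \<beta> (\<omega> s) \<partial>leb r) - (\<integral>s. lam0 \<partial>leb r)"
        by (rule Bochner_Integration.integral_diff[OF jmeas_path_integrable[OF jmeas_\<beta> r order_refl \<omega>]
            finite_measure.integrable_const[OF finite_leb]])
      also have "(\<integral>s. lam0 \<partial>leb r) = lam0 * r" using r by (rule integral_leb_const)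
      finally have pd: "phi_density \<beta> lam0 \<phi>0 x r \<omega> = \<phi>0 (\<omega> r) / \<phi>0 x * (exp (- (\<integral>s. \<beta> (\<omega> s) \<partial>leb r)) * exp (lam0 * r))"
        unfolding phi_density_def integral_leb_set[symmetric] elim(1)
        by (simp add: exp_add[symmetric])
      have p: "\<phi>0 (\<omega> r) > 0" "\<phi>0 x > 0" using \<phi>0_pos y x by auto
      have "exp (- lam0 * r) * exp (lam0 * r) = 1" by (simp add: exp_add[symmetric])
      then have "\<phi>0 x * exp (- lam0 * r) * (phi_density \<beta> lam0 \<phi>0 x r \<omega> * (H (\<omega> r) / \<phi>0 (\<omega> r))) =
          exp (- (\<integral>s. \<beta> (\<omega> s) \<partial>leb r)) * H (\<omega> r)"
        unfolding pd using p by (simp add: field_simps)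
      moreover have "phi_density \<beta> lam0 \<phi>0 x r \<omega> \<ge> 0" unfolding pd using p by simp
      ultimately show ?case
        using p H(2)[OF y] by (simp add: ennreal_mult[symmetric] del: ennreal_mult_eq_top_iff)
    qed
  qed
  finally show ?thesis .
qed

lemma phi_integral_nn:
  assumes r: "0 \<le> r" and x: "x \<in> E" and G: "G \<in> borel_measurable (borel_on E)" "\<And>y. y \<in> E \<Longrightarrow> 0 \<le> G y \<and> G y \<le> B"
  shows "(\<integral>\<^sup>+\<omega>. ennreal (G (\<omega> r)) \<partial>P_phi x) = ennreal (Qt r G x)" and "0 \<le> Qt r G x"
    and "integrable (P_phi x) (\<lambda>\<omega>. G (\<omega> r))"
proof -
  interpret prob_space "P_phi x" by (rule prob_space_phi[OF x])
  have in_E: "\<omega> r \<in> E" if "\<omega> \<in> space (P_phi x)" for \<omega>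
    using skorokhod_in[of \<omega> E "{0..}" r] that r by (simp add: space_phi[OF x])
  have m: "(\<lambda>\<omega>. G (\<omega> r)) \<in> borel_measurable (P_phi x)"
    using measurable_compose[OF coord_path[OF r] G(1)] by (simp cong: measurable_cong_sets add: sets_phi[OF x])
  show i: "integrable (P_phi x) (\<lambda>\<omega>. G (\<omega> r))"
    by (rule integrable_bounded[OF finite_measure_axioms m, where B = B]) (use G(2)[OF in_E] in force)
  have nn: "AE \<omega> in P_phi x. 0 \<le> G (\<omega> r)" using G(2)[OF in_E] by (intro AE_I2) auto
  show "(\<integral>\<^sup>+\<omega>. ennreal (G (\<omega> r)) \<partial>P_phi x) = ennreal (Qt r G x)"
    unfolding Qt_def by (rule nn_integral_eq_integral[OF i nn])
  show "0 \<le> Qt r G x" unfolding Qt_def by (rule integral_nonneg_AE[OF nn])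
qed

end

text \<open>Values in [0, 1] permit nonnegative integrals throughout and make the constant 1 an
  instance, which later supplies the normalisation.\<close>

locale reversed_spine_functional = spine_motion +
  fixes f :: "'a path \<Rightarrow> real" and t0 :: real and \<pi> :: "'a measure"
  assumes t0: "t0 \<ge> 0" and f: "f \<in> borel_measurable (path_space E {-t0..0})"
    and f01: "\<And>\<omega>. \<omega> \<in> skorokhod E {-t0..0} \<Longrightarrow> 0 \<le> f \<omega> \<and> f \<omega> \<le> 1"
    and \<pi>: "prob_space \<pi>" "sets \<pi> = sets (borel_on E)"
    and erg: "tv_ergodic E P_phi \<pi>"
begin

definition Fh :: "real \<Rightarrow> 'a path \<Rightarrow> real" where
  "Fh h \<omega> = f (\<lambda>s\<in>{-t0..0}. \<omega> (h + s))"

definition ee :: "real \<Rightarrow> 'a \<Rightarrow> real" where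
  "ee h x = (\<integral>\<omega>. Fh h \<omega> \<partial>S h x)"

lemma window_measurable:
  assumes h: "h \<ge> s" "s \<ge> 0"
  shows "(\<lambda>\<omega>. \<lambda>u\<in>{-s..0}. \<omega> (h + u)) \<in> filt E (ennreal h) \<rightarrow>\<^sub>M path_space E {-s..0}"
proof (rule measurable_coord_algebraI)
  show "(\<lambda>\<omega>. \<lambda>u\<in>{-s..0}. \<omega> (h + u)) \<in> space (filt E (ennreal h)) \<rightarrow> skorokhod E {-s..0}"
    using h skorokhod_shift[of _ E "{0..}" "{-s..0}" h] by auto
  fix r assume r: "r \<in> {-s..0}"
  have "(\<lambda>\<omega>. \<omega> (h + r)) \<in> filt E (ennreal h) \<rightarrow>\<^sub>M borel_on E"
    using r h by (intro measurable_coord_filt coord_measurable) auto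
  then show "(\<lambda>\<omega>. (\<lambda>u\<in>{-s..0}. \<omega> (h + u)) r) \<in> filt E (ennreal h) \<rightarrow>\<^sub>M borel"
    using r by (simp add: measurable_restrict_space2_iff)
qed

lemma Fh_measurable: "h \<ge> t0 \<Longrightarrow> Fh h \<in> borel_measurable (filt E (ennreal h))"
  unfolding Fh_def[abs_def] by (rule measurable_compose[OF window_measurable[OF _ t0] f])

lemma Fh_bounds: "h \<ge> t0 \<Longrightarrow> \<omega> \<in> skorokhod E {0..} \<Longrightarrow> 0 \<le> Fh h \<omega> \<and> Fh h \<omega> \<le> 1"
  unfolding Fh_def by (intro f01 skorokhod_shift) auto

lemma Fh_shift: "0 \<le> r \<Longrightarrow> T \<ge> t0 \<Longrightarrow> Fh (r + T) \<omega> = Fh T (path_shift r \<omega>)"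
  unfolding Fh_def by (intro arg_cong[where f = f]) (auto simp: path_shift_def restrict_def fun_eq_iff add.assoc)

lemma ee_nn:
  assumes h: "h \<ge> t0" "h > 0" and x: "x \<in> E"
  shows "(\<integral>\<^sup>+\<omega>. ennreal (Fh h \<omega>) \<partial>S h x) = ennreal (ee h x)" and "0 \<le> ee h x" and "ee h x \<le> 1"
proof -
  interpret prob_space "S h x" by (rule prob_space_S[OF h(2) x])
  have m: "Fh h \<in> borel_measurable (S h x)"
    using Fh_measurable[OF h(1)] by (simp cong: measurable_cong_sets add: sets_S[OF h(2) x])
  have b: "0 \<le> Fh h \<omega>" "Fh h \<omega> \<le> 1" if "\<omega> \<in> space (S h x)" for \<omega>
    using Fh_bounds[OF h(1)] that by (auto simp: space_S[OF h(2) x])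
  have i: "integrable (S h x) (Fh h)"
    by (rule integrable_bounded[OF finite_measure_axioms m, where B = 1]) (use b in force)
  show "(\<integral>\<^sup>+\<omega>. ennreal (Fh h \<omega>) \<partial>S h x) = ennreal (ee h x)"
    unfolding ee_def using b by (intro nn_integral_eq_integral[OF i] AE_I2) auto
  show "0 \<le> ee h x" unfolding ee_def using b by (intro integral_nonneg_AE AE_I2) auto
  show "ee h x \<le> 1" unfolding ee_def using b by (intro integral_le_const[OF i] AE_I2) auto
qed

lemma ee_measurable:
  assumes h: "h \<ge> t0" "h > 0"
  shows "ee h \<in> borel_measurable (borel_on E)"
proof -
  have "(\<lambda>\<omega>. ennreal (Fh h \<omega>)) \<in> borel_measurable (filt E (ennreal h))"
    by (rule measurable_compose[OF Fh_measurable[OF h(1)] measurable_ennreal])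
  from S_kernel_measurable[OF h(2) this]
  have "(\<lambda>y. enn2real (\<integral>\<^sup>+\<omega>. ennreal (Fh h \<omega>) \<partial>S h y)) \<in> borel_measurable (borel_on E)" by measurable
  then show ?thesis
    by (rule measurable_cong[THEN iffD1, rotated]) (simp add: ee_nn[OF h])
qed

definition \<rho> :: "real \<Rightarrow> 'a \<Rightarrow> real" where "\<rho> T y = \<bar>d T y\<bar> / \<phi>0 y"

lemma \<rho>_pos: "T > 0 \<Longrightarrow> y \<in> E \<Longrightarrow> \<rho> T y > 0"
  using d_nonzero \<phi>0_pos by (simp add: \<rho>_def)

lemma \<rho>_measurable: "T > 0 \<Longrightarrow> \<rho> T \<in> borel_measurable (borel_on E)"
  unfolding \<rho>_def[abs_def] by (intro borel_measurable_divide borel_measurable_abs d_measurable \<phi>0_measurable)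

lemma \<rho>_bounded:
  assumes "T > 0"
  obtains M where "M > 0" "\<And>y. y \<in> E \<Longrightarrow> \<rho> T y \<le> M"
proof -
  obtain M where M: "\<forall>x\<in>E. \<bar>d T x\<bar> \<le> M" using deriv_v_bounded[OF assms] by (auto simp: d_def)
  have "\<rho> T y \<le> max M 1 / C1" if y: "y \<in> E" for y
    unfolding \<rho>_def using M y C1(1) C1(2)[OF y] by (intro frac_le) auto
  then show ?thesis using C1(1) by (intro that[of "max M 1 / C1"]) auto
qed

text \<open>\<open>spine_markov\<close> is an exact identity with weight \<open>expo\<close>.
  Replacing \<open>expo\<close> by the integral of \<beta> costs a pathwise factor in
  [exp (- \<open>alive_bound T\<close>), 1], so both inequalities hold under the integral, and
  \<open>phi_nn_integral\<close> evaluates the result.\<close>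

lemma sandwich:
  assumes r: "0 \<le> r" and T: "T > 0" "T \<ge> t0" and x: "x \<in> E"
  shows "\<bar>d (r + T) x\<bar> * ee (r + T) x \<le> \<phi>0 x * exp (- lam0 * r) * Qt r (\<lambda>y. \<rho> T y * ee T y) x"
    and "exp (- alive_bound T) * (\<phi>0 x * exp (- lam0 * r) * Qt r (\<lambda>y. \<rho> T y * ee T y) x) \<le> \<bar>d (r + T) x\<bar> * ee (r + T) x"
    and "0 \<le> Qt r (\<lambda>y. \<rho> T y * ee T y) x"
proof -
  let ?h = "r + T"
  let ?H = "\<lambda>y. \<bar>d T y\<bar> * ee T y"
  let ?G = "\<lambda>y. \<rho> T y * ee T y"
  let ?\<Lambda> = "\<phi>0 x * exp (- lam0 * r)"
  let ?I = "\<integral>\<^sup>+\<omega>. ennreal (exp (- (\<integral>s. \<beta> (\<omega> s) \<partial>leb r))) * ennreal (?H (\<omega> r)) \<partial>P x"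
  have h: "?h > 0" "?h \<ge> t0" using r T by auto
  obtain M where M: "M > 0" "\<And>y. y \<in> E \<Longrightarrow> \<rho> T y \<le> M" using \<rho>_bounded[OF T(1)] by blast
  have Hm: "?H \<in> borel_measurable (borel_on E)"
    by (intro borel_measurable_times borel_measurable_abs d_measurable[OF T(1)] ee_measurable[OF T(2,1)])
  have Gm: "?G \<in> borel_measurable (borel_on E)"
    by (intro borel_measurable_times \<rho>_measurable[OF T(1)] ee_measurable[OF T(2,1)])
  have Gb: "0 \<le> ?G y \<and> ?G y \<le> M" if y: "y \<in> E" for y
  proof -
    have "?G y \<le> M * 1" using M(1) M(2)[OF y] \<rho>_pos[OF T(1) y] ee_nn[OF T(2,1) y] by (intro mult_mono) auto
    then show ?thesis using \<rho>_pos[OF T(1) y] ee_nn[OF T(2,1) y] by simp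
  qed
  note q = phi_integral_nn[OF r x Gm Gb]
  show "0 \<le> Qt r ?G x" by (rule q(2))
  have "ennreal ?\<Lambda> * ennreal (Qt r ?G x) = ?I"
    using phi_nn_integral[OF r x Hm] ee_nn(2)[OF T(2,1)] q(1) by (simp add: \<rho>_def)
  then have I: "?I = ennreal (?\<Lambda> * Qt r ?G x)"
    using \<phi>0_pos[OF x] q(2) by (simp add: ennreal_mult)
  have J: "ennreal (\<bar>d ?h x\<bar> * ee ?h x) =
      (\<integral>\<^sup>+\<omega>. ennreal (exp (- expo ?h r \<omega>)) * ennreal (?H (\<omega> r)) \<partial>P x)"
  proof -
    have "ennreal (\<bar>d ?h x\<bar> * ee ?h x) = ennreal \<bar>d ?h x\<bar> * (\<integral>\<^sup>+\<omega>. ennreal (Fh ?h \<omega>) \<partial>S ?h x)"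
      using ee_nn[OF h(2,1) x] by (simp add: ennreal_mult)
    also have "\<dots> = (\<integral>\<^sup>+\<omega>. ennreal (exp (- expo ?h r \<omega>)) *
        (ennreal \<bar>d T (\<omega> r)\<bar> * (\<integral>\<^sup>+\<eta>. ennreal (Fh T \<eta>) \<partial>S T (\<omega> r))) \<partial>P x)"
      by (rule spine_markov[OF r T(1) x measurable_compose[OF Fh_measurable[OF T(2)] measurable_ennreal]
            measurable_compose[OF Fh_measurable[OF h(2)] measurable_ennreal]]) (simp add: Fh_shift[OF r T(2)])
    also have "\<dots> = (\<integral>\<^sup>+\<omega>. ennreal (exp (- expo ?h r \<omega>)) * ennreal (?H (\<omega> r)) \<partial>P x)"
      by (intro nn_integral_cong) (simp add: ee_nn[OF T(2,1) path_in[OF x _ r]] ennreal_mult)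
    finally show ?thesis .
  qed
  have "ennreal (\<bar>d ?h x\<bar> * ee ?h x) \<le> ?I"
    unfolding J using expo_bounds(1)[OF _ r T(1)]
    by (intro nn_integral_mono mult_right_mono ennreal_leI) (auto simp: space_P[OF x])
  then show "\<bar>d ?h x\<bar> * ee ?h x \<le> ?\<Lambda> * Qt r ?G x"
    unfolding I using \<phi>0_pos[OF x] q(2) by (subst (asm) ennreal_le_iff) auto
  have Bm: "(\<lambda>\<omega>. ennreal (exp (- (\<integral>s. \<beta> (\<omega> s) \<partial>leb r))) * ennreal (?H (\<omega> r))) \<in> borel_measurable (P x)"
  proof -
    have "(\<lambda>\<omega>. \<integral>s. \<beta> (\<omega> s) \<partial>leb r) \<in> borel_measurable (P x)"
      using path_Fubini(2)[OF jmeas_\<beta> r order_refl x] by auto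
    moreover have "(\<lambda>\<omega>. ?H (\<omega> r)) \<in> borel_measurable (P x)"
      unfolding measurable_P[OF x] by (rule measurable_compose[OF coord_path[OF r] Hm])
    ultimately show ?thesis by measurable
  qed
  have "ennreal (exp (- alive_bound T)) * ?I =
      (\<integral>\<^sup>+\<omega>. ennreal (exp (- alive_bound T)) * (ennreal (exp (- (\<integral>s. \<beta> (\<omega> s) \<partial>leb r))) * ennreal (?H (\<omega> r))) \<partial>P x)"
    by (rule nn_integral_cmult[OF Bm, symmetric])
  also have "\<dots> \<le> ennreal (\<bar>d ?h x\<bar> * ee ?h x)"
    unfolding J
  proof (rule nn_integral_mono)
    fix \<omega> assume "\<omega> \<in> space (P x)"
    then have "\<omega> \<in> skorokhod E {0..}" by (simp add: space_P[OF x])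
    from expo_bounds(2)[OF this r T(1)]
    have "exp (- alive_bound T) * exp (- (\<integral>s. \<beta> (\<omega> s) \<partial>leb r)) \<le> exp (- expo ?h r \<omega>)"
      by (simp add: exp_add[symmetric])
    then have "ennreal (exp (- alive_bound T)) * ennreal (exp (- (\<integral>s. \<beta> (\<omega> s) \<partial>leb r))) \<le> ennreal (exp (- expo ?h r \<omega>))"
      by (simp add: ennreal_mult[symmetric])
    then show "ennreal (exp (- alive_bound T)) * (ennreal (exp (- (\<integral>s. \<beta> (\<omega> s) \<partial>leb r))) * ennreal (?H (\<omega> r)))
        \<le> ennreal (exp (- expo ?h r \<omega>)) * ennreal (?H (\<omega> r))"
      unfolding mult.assoc[symmetric] by (rule mult_right_mono) simp
  qed
  finally show "exp (- alive_bound T) * (?\<Lambda> * Qt r ?G x) \<le> \<bar>d ?h x\<bar> * ee ?h x"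
    unfolding I using \<phi>0_pos[OF x] q(2) ee_nn(2)[OF h(2,1) x]
    by (simp add: ennreal_mult[symmetric])
qed

text \<open>Total variation is a supremum over functions bounded by 1, so G is applied after
  division by M. The rate may depend on x; only convergence is retained.\<close>

lemma ergodic:
  assumes x: "x \<in> E" and G: "G \<in> borel_measurable (borel_on E)" "\<And>y. y \<in> E \<Longrightarrow> \<bar>G y\<bar> \<le> M" and M: "M > 0"
  shows "((\<lambda>r. Qt r G x) \<longlongrightarrow> (\<integral>y. G y \<partial>\<pi>)) at_top"
proof -
  interpret \<pi>: prob_space \<pi> by (rule \<pi>)
  interpret x: prob_space "P_phi x" by (rule prob_space_phi[OF x])
  have sp: "space \<pi> = E" using sets_eq_imp_space_eq[OF \<pi>(2)] by simp
  define \<D> where "\<D> = {f \<in> borel_measurable (borel_on E). \<forall>y\<in>E. \<bar>f y\<bar> \<le> (1::real)}"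
  define \<delta> where "\<delta> r = (SUP f\<in>\<D>. \<bar>Qt r f x - (\<integral>y. f y \<partial>\<pi>)\<bar>)" for r
  have \<delta>0: "(\<delta> \<longlongrightarrow> 0) at_top"
    using erg x unfolding tv_ergodic_def \<delta>_def[abs_def] \<D>_def Qt_def by blast
  let ?g = "\<lambda>y. G y / M"
  have g: "?g \<in> \<D>" using G M by (auto simp: \<D>_def)
  have le: "\<bar>Qt r ?g x - (\<integral>y. ?g y \<partial>\<pi>)\<bar> \<le> \<delta> r" if r: "r \<ge> 0" for r
    unfolding \<delta>_def
  proof (rule cSUP_upper[OF g])
    \<comment> \<open>A real supremum dominates its members only if the family is bounded above; 2
      is such a bound.\<close>
    have "\<bar>Qt r f x - (\<integral>y. f y \<partial>\<pi>)\<bar> \<le> 2" if f: "f \<in> \<D>" for f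
    proof -
      have fm: "f \<in> borel_measurable (borel_on E)" and fb: "\<And>y. y \<in> E \<Longrightarrow> \<bar>f y\<bar> \<le> 1" using f by (auto simp: \<D>_def)
      have in_E: "\<omega> r \<in> E" if "\<omega> \<in> space (P_phi x)" for \<omega>
        using skorokhod_in[of \<omega> E "{0..}" r] that r by (simp add: space_phi[OF x])
      have i1: "integrable (P_phi x) (\<lambda>\<omega>. f (\<omega> r))"
        using measurable_compose[OF coord_path[OF r] fm] fb[OF in_E]
        by (intro integrable_bounded[OF x.finite_measure_axioms, where B = 1])
          (simp_all cong: measurable_cong_sets add: sets_phi[OF x])
      have i2: "integrable \<pi> f"
        using fm fb by (intro integrable_bounded[OF \<pi>.finite_measure_axioms, where B = 1])
          (simp_all cong: measurable_cong_sets add: \<pi>(2) sp)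
      have "\<bar>Qt r f x\<bar> \<le> 1"
        unfolding Qt_def using fb[OF in_E]
        by (intro order_trans[OF integral_abs_bound] x.integral_le_const integrable_abs i1 AE_I2) auto
      moreover have "\<bar>\<integral>y. f y \<partial>\<pi>\<bar> \<le> 1"
        using fb by (intro order_trans[OF integral_abs_bound] \<pi>.integral_le_const integrable_abs i2 AE_I2) (auto simp: sp)
      ultimately show ?thesis by linarith
    qed
    then show "bdd_above ((\<lambda>f. \<bar>Qt r f x - (\<integral>y. f y \<partial>\<pi>)\<bar>) ` \<D>)" by (intro bdd_aboveI[of _ 2]) auto
  qed
  have "((\<lambda>r. Qt r ?g x - (\<integral>y. ?g y \<partial>\<pi>)) \<longlongrightarrow> 0) at_top"
  proof (rule Lim_null_comparison[OF _ \<delta>0])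
    show "\<forall>\<^sub>F r in at_top. norm (Qt r ?g x - (\<integral>y. ?g y \<partial>\<pi>)) \<le> \<delta> r"
      using eventually_ge_at_top[of 0] by eventually_elim (use le in simp)
  qed
  then have "((\<lambda>r. M * (Qt r ?g x - (\<integral>y. ?g y \<partial>\<pi>)) + (\<integral>y. G y \<partial>\<pi>)) \<longlongrightarrow> M * 0 + (\<integral>y. G y \<partial>\<pi>)) at_top"
    by (intro tendsto_intros)
  moreover have "M * (Qt r ?g x - (\<integral>y. ?g y \<partial>\<pi>)) + (\<integral>y. G y \<partial>\<pi>) = Qt r G x" for r
    using M by (simp add: Qt_def right_diff_distrib)
  ultimately show ?thesis by simp
qed

text \<open>Dividing the estimate of \<open>sandwich\<close> for f by the one for the constant 1
  cancels the derivative of v and the prefactor from the transform. The remaining quotient of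
  expectations converges by ergodicity to a quotient of \<pi>-integrals, in which x no longer
  appears.\<close>

lemma ee_approx:
  assumes T: "T > 0" "T \<ge> t0" and x0: "x0 \<in> E"
  obtains c where "\<And>x e. x \<in> E \<Longrightarrow> e > 0 \<Longrightarrow>
    \<forall>\<^sub>F h in at_top. \<bar>ee h x - c\<bar> \<le> exp (alive_bound T) - 1 + e"
proof
  interpret \<pi>: prob_space \<pi> by (rule \<pi>)
  have sp: "space \<pi> = E" using sets_eq_imp_space_eq[OF \<pi>(2)] by simp
  \<comment> \<open>The functional 1 has mean 1 under each spine law, so its instance of
    \<open>sandwich\<close> estimates the derivative of v itself.\<close>
  interpret one: reversed_spine_functional E P \<alpha> \<beta> \<phi>0 L\<phi> L\<alpha> lam0 a A Bb C1 C2 K PP N P_phi S "\<lambda>_. 1" t0 \<pi>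
    by unfold_locales (use t0 \<pi> erg in auto)
  let ?\<rho>e = "\<lambda>y. \<rho> T y * ee T y"
  let ?c = "(\<integral>y. ?\<rho>e y \<partial>\<pi>) / (\<integral>y. \<rho> T y \<partial>\<pi>)"
  obtain M where M: "M > 0" "\<And>y. y \<in> E \<Longrightarrow> \<rho> T y \<le> M" using \<rho>_bounded[OF T(1)] by blast
  have \<rho>m: "\<rho> T \<in> borel_measurable (borel_on E)" by (rule \<rho>_measurable[OF T(1)])
  have \<rho>b: "0 \<le> \<rho> T y \<and> \<rho> T y \<le> M" if "y \<in> E" for y
    using M(2)[OF that] \<rho>_pos[OF T(1) that] by simp
  have em: "?\<rho>e \<in> borel_measurable (borel_on E)"
    by (intro borel_measurable_times \<rho>m ee_measurable[OF T(2,1)])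
  have e\<rho>: "0 \<le> ?\<rho>e y \<and> ?\<rho>e y \<le> \<rho> T y" if "y \<in> E" for y
    using \<rho>b[OF that] ee_nn[OF T(2,1) that] by (auto intro: mult_left_le)
  have eb: "0 \<le> ?\<rho>e y \<and> ?\<rho>e y \<le> M" if "y \<in> E" for y
    using e\<rho>[OF that] \<rho>b[OF that] by linarith
  have i\<pi>: "integrable \<pi> (\<rho> T)"
    using \<rho>m \<rho>b by (intro integrable_bounded[OF \<pi>.finite_measure_axioms, where B = M])
      (simp_all cong: measurable_cong_sets add: \<pi>(2) sp)
  \<comment> \<open>The limit of the denominators must not vanish; it is the mean of a strictly
    positive function under a probability measure.\<close>
  have pos: "(\<integral>y. \<rho> T y \<partial>\<pi>) \<noteq> 0"
  proof
    assume "(\<integral>y. \<rho> T y \<partial>\<pi>) = 0"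
    then have "AE y in \<pi>. \<rho> T y = 0"
      using \<rho>b by (subst (asm) integral_nonneg_eq_0_iff_AE[OF i\<pi>]) (auto simp: sp intro!: AE_I2)
    then have "AE y in \<pi>. False"
      using AE_space by eventually_elim (use \<rho>_pos[OF T(1)] in \<open>force simp: sp\<close>)
    then show False using \<pi>.AE_False by simp
  qed
  fix x and e :: real assume x: "x \<in> E" and e: "e > 0"
  let ?R = "\<lambda>h. Qt (h - T) ?\<rho>e x / Qt (h - T) (\<rho> T) x"
  have sh: "filterlim (\<lambda>h. h - T) at_top at_top"
    unfolding filterlim_at_top
  proof
    fix Z show "\<forall>\<^sub>F h in at_top. Z \<le> h - T"
      using eventually_ge_at_top[of "Z + T"] by eventually_elim simp
  qed
  have "(?R \<longlongrightarrow> ?c) at_top"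
    using pos M(1) \<rho>b eb
    by (intro tendsto_divide filterlim_compose[OF ergodic[OF x em, of M] sh] filterlim_compose[OF ergodic[OF x \<rho>m, of M] sh])
      auto
  then have "\<forall>\<^sub>F h in at_top. \<bar>?R h - ?c\<bar> < e"
    using e tendstoD[of ?R ?c at_top e] by (simp add: dist_real_def)
  then show "\<forall>\<^sub>F h in at_top. \<bar>ee h x - ?c\<bar> \<le> exp (alive_bound T) - 1 + e"
    using eventually_ge_at_top[of T]
  proof eventually_elim
    case (elim h)
    have r: "0 \<le> h - T" "h - T + T = h" and h: "h > 0" using elim(2) T by auto
    have E: "E \<noteq> {}" using x by auto
    have one: "one.ee h y = 1" if "h > 0" "y \<in> E" for h y
    proof -
      interpret prob_space "S h y" by (rule prob_space_S[OF that])
      show ?thesis unfolding one.ee_def one.Fh_def by (simp add: prob_space)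
    qed
    have Q1: "Qt (h - T) (\<lambda>y. \<rho> T y * one.ee T y) x = Qt (h - T) (\<rho> T) x"
      unfolding Qt_def
    proof (rule Bochner_Integration.integral_cong)
      fix \<omega> assume "\<omega> \<in> space (P_phi x)"
      then have "\<omega> (h - T) \<in> E" using skorokhod_in[of \<omega> E "{0..}" "h - T"] r by (simp add: space_phi[OF x])
      then show "\<rho> T (\<omega> (h - T)) * one.ee T (\<omega> (h - T)) = \<rho> T (\<omega> (h - T))" using one[OF T(1)] by simp
    qed simp
    have le: "Qt (h - T) ?\<rho>e x \<le> Qt (h - T) (\<rho> T) x"
      unfolding Qt_def
    proof (rule integral_mono[OF phi_integral_nn(3)[OF r(1) x em eb] phi_integral_nn(3)[OF r(1) x \<rho>m \<rho>b]])
      fix \<omega> assume "\<omega> \<in> space (P_phi x)"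
      then have "\<omega> (h - T) \<in> E" using skorokhod_in[of \<omega> E "{0..}" "h - T"] r by (simp add: space_phi[OF x])
      then show "?\<rho>e (\<omega> (h - T)) \<le> \<rho> T (\<omega> (h - T))" using e\<rho> by blast
    qed
    have "0 \<le> A" using \<alpha>_pos[OF x] A[OF x] by linarith
    then have "alive_bound T \<ge> 0" using lam0 ubound_nonneg[OF x T(1)] by (simp add: alive_bound_def)
    moreover have "0 < \<bar>d h x\<bar>" using d_nonzero[OF h x] by simp
    moreover have "0 < \<phi>0 x * exp (- lam0 * (h - T))" using \<phi>0_pos[OF x] by simp
    ultimately have "\<bar>ee h x - ?R h\<bar> \<le> exp (alive_bound T) - 1"
      using sandwich[OF r(1) T x] one.sandwich[OF r(1) T x] one[OF h x] le unfolding Q1 r(2)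
      by (intro ratio_bound) auto
    then show ?case using elim(1) by linarith
  qed
qed

lemma alive_bound_small:
  assumes e: "e > 0" and E: "E \<noteq> {}"
  obtains T where "T > 0" "T \<ge> t0" "exp (alive_bound T) - 1 < e"
proof -
  obtain x where x: "x \<in> E" using E by auto
  have A0: "0 \<le> A" using \<alpha>_pos[OF x] A[OF x] by linarith
  define k where "k = 2 * A / lam0 * ubound 1"
  have k: "k \<ge> 0" using A0 lam0 ubound_nonneg[OF x, of 1] by (simp add: k_def)
  define \<delta> where "\<delta> = ln (1 + e)"
  have \<delta>: "\<delta> > 0" using e by (simp add: \<delta>_def)
  \<comment> \<open>Makes z = lam0 (T - 1) at least k / \<delta>, so that k exp (- z) \<le> k / (1 +
    z) < \<delta> = ln (1 + e). The leading 1 serves the decay estimate, which starts from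
    \<open>ubound 1\<close>.\<close>
  define T where "T = 1 + max t0 (k / (\<delta> * lam0))"
  have T: "T \<ge> 1" "T \<ge> t0" using t0 by (auto simp: T_def)
  define z where "z = lam0 * (T - 1)"
  have "k / \<delta> = lam0 * (k / (\<delta> * lam0))" using lam0 by simp
  also have "\<dots> \<le> z" unfolding z_def T_def using lam0 by (intro mult_left_mono) auto
  finally have z: "k \<le> \<delta> * z" using \<delta> by (simp add: field_simps)
  have z0: "z \<ge> 0" using lam0 T by (simp add: z_def)
  have "exp (- z) \<le> 1 / (1 + z)"
    using exp_ge_add_one_self[of z] z0 by (simp add: exp_minus inverse_eq_divide frac_le)
  then have "k * exp (- z) \<le> k * (1 / (1 + z))" using k by (intro mult_left_mono)
  also have "\<dots> < \<delta>" using z \<delta> z0 by (simp add: field_simps)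
  finally have "k * exp (- z) < \<delta>" .
  moreover have "alive_bound T \<le> k * exp (- z)"
  proof -
    have "ubound T \<le> ubound 1 * exp (- lam0 * (T - 1))" using T by (intro ubound_decay[OF E]) auto
    then have "2 * A / lam0 * ubound T \<le> 2 * A / lam0 * (ubound 1 * exp (- lam0 * (T - 1)))"
      using A0 lam0 by (intro mult_left_mono) auto
    then show ?thesis by (simp add: alive_bound_def k_def z_def)
  qed
  ultimately have "exp (alive_bound T) < exp \<delta>" by simp
  then have "exp (alive_bound T) - 1 < e" using e by (simp add: \<delta>_def)
  with T show ?thesis by (intro that[of T]) auto
qed

text \<open>For every start the spine functional is eventually close to a constant independent of the start,
  so its limit can be read off from the average over \<open>\<pi>\<close>.\<close>

lemma ee_limit:
  assumes I: "((\<lambda>h. \<integral>x. ee h x \<partial>\<pi>) \<longlongrightarrow> I) at_top" and x: "x \<in> E"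
  shows "((\<lambda>h. ee h x) \<longlongrightarrow> I) at_top"
proof (rule tendstoI)
  fix e :: real assume e: "e > 0"
  interpret \<pi>: prob_space \<pi> by (rule \<pi>)
  have sp: "space \<pi> = E" using sets_eq_imp_space_eq[OF \<pi>(2)] by simp
  obtain T where T: "T > 0" "T \<ge> t0" "exp (alive_bound T) - 1 < e / 4"
    using alive_bound_small[of "e / 4"] e x by auto
  define \<eta> where "\<eta> = exp (alive_bound T) - 1"
  obtain c where c: "\<And>x e. x \<in> E \<Longrightarrow> e > 0 \<Longrightarrow> \<forall>\<^sub>F h in at_top. \<bar>ee h x - c\<bar> \<le> \<eta> + e"
    using ee_approx[OF T(1,2) x] unfolding \<eta>_def by blast
  \<comment> \<open>The excess of the error over its guaranteed size \<eta>. It tends to 0 at every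
    y and is bounded, so dominated convergence applies; \<open>max h T\<close> makes the bounds on
    \<open>ee\<close> available for all h.\<close>
  define g where "g h y = max 0 (\<bar>ee (max h T) y - c\<bar> - \<eta>)" for h y
  have hT: "max h T \<ge> t0" "max h T > 0" for h using T by auto
  have eem: "ee (max h T) \<in> borel_measurable \<pi>" for h
    using ee_measurable[OF hT] by (simp cong: measurable_cong_sets add: \<pi>(2))
  have eeb: "0 \<le> ee (max h T) y" "ee (max h T) y \<le> 1" if "y \<in> E" for h y using ee_nn[OF hT that] by auto
  have eei: "integrable \<pi> (ee (max h T))" for h
    by (rule integrable_bounded[OF \<pi>.finite_measure_axioms eem, where B = 1]) (use eeb in \<open>force simp: sp\<close>)
  have gb: "\<bar>g h y\<bar> \<le> 1 + \<bar>c\<bar> + \<bar>\<eta>\<bar>" if "y \<in> E" for h y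
    using eeb[OF that, of h] by (auto simp: g_def max_def)
  have gm: "g h \<in> borel_measurable \<pi>" for h
    using eem[of h] unfolding g_def[abs_def] by measurable
  have gi: "integrable \<pi> (g h)" for h
    by (rule integrable_bounded[OF \<pi>.finite_measure_axioms gm]) (use gb in \<open>simp add: sp\<close>)
  have "((\<lambda>h. \<integral>y. g h y \<partial>\<pi>) \<longlongrightarrow> (\<integral>y. 0 \<partial>\<pi>)) at_top"
  proof (rule integral_dominated_convergence_at_top[where w = "\<lambda>_. 1 + \<bar>c\<bar> + \<bar>\<eta>\<bar>"])
    show "\<forall>\<^sub>F h in at_top. AE y in \<pi>. norm (g h y) \<le> 1 + \<bar>c\<bar> + \<bar>\<eta>\<bar>"
      using gb by (intro always_eventually allI AE_I2) (simp add: sp)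
    show "AE y in \<pi>. ((\<lambda>h. g h y) \<longlongrightarrow> 0) at_top"
    proof (rule AE_I2)
      fix y assume "y \<in> space \<pi>"
      then have y: "y \<in> E" by (simp add: sp)
      show "((\<lambda>h. g h y) \<longlongrightarrow> 0) at_top"
      proof (rule tendstoI)
        fix e' :: real assume e': "e' > 0"
        show "\<forall>\<^sub>F h in at_top. dist (g h y) 0 < e'"
          using c[OF y half_gt_zero[OF e']] eventually_ge_at_top[of T]
        proof eventually_elim
          case (elim h)
          then have "max h T = h" by simp
          then show ?case using elim(1) e' by (simp add: g_def)
        qed
      qed
    qed
  qed (use gm in auto)
  then have g0: "((\<lambda>h. \<eta> + (\<integral>y. g h y \<partial>\<pi>)) \<longlongrightarrow> \<eta> + 0) at_top" by (intro tendsto_intros) simp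
  \<comment> \<open>The pointwise bound by \<eta> survives averaging over \<pi>, so the limit I of
    the averages is within \<eta> of c. The constant c depends on T, but I does not.\<close>
  have Ic: "\<bar>I - c\<bar> \<le> \<eta>"
  proof -
    have "((\<lambda>h. \<bar>(\<integral>x. ee h x \<partial>\<pi>) - c\<bar>) \<longlongrightarrow> \<bar>I - c\<bar>) at_top" by (intro tendsto_intros I)
    moreover have "\<forall>\<^sub>F h in at_top. \<bar>(\<integral>x. ee h x \<partial>\<pi>) - c\<bar> \<le> \<eta> + (\<integral>y. g h y \<partial>\<pi>)"
      using eventually_ge_at_top[of T]
    proof eventually_elim
      case (elim h)
      then have h: "max h T = h" by simp
      have "(\<integral>x. ee h x \<partial>\<pi>) - c = (\<integral>x. ee h x - c \<partial>\<pi>)"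
        using eei[of h] unfolding h by (simp add: \<pi>.prob_space)
      also have "\<bar>\<dots>\<bar> \<le> (\<integral>x. \<bar>ee h x - c\<bar> \<partial>\<pi>)" by (rule integral_abs_bound)
      also have "\<dots> \<le> (\<integral>x. \<eta> + g h x \<partial>\<pi>)"
        using eei[of h] gi[of h] unfolding h by (intro integral_mono) (auto simp: g_def h)
      also have "\<dots> = \<eta> + (\<integral>y. g h y \<partial>\<pi>)" using gi[of h] by (simp add: \<pi>.prob_space)
      finally show ?case .
    qed
    ultimately have "\<bar>I - c\<bar> \<le> \<eta> + 0" by (intro tendsto_le[OF _ g0]) auto
    then show ?thesis by simp
  qed
  \<comment> \<open>The error splits into e / 4 from the eventual bound and \<eta> < e / 4 on each
    side of c.\<close>
  have "e / 4 > 0" using e by simp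
  from c[OF x this] show "\<forall>\<^sub>F h in at_top. dist (ee h x) I < e"
  proof eventually_elim
    case (elim h)
    then show ?case using Ic T(3) unfolding \<eta>_def dist_real_def by linarith
  qed
qed

text \<open>The functional read on paths over any interval containing the window, so that it can be
  integrated under the finite reversed spine, the stationary process and the limit law
  alike.\<close>

definition ff :: "'a path \<Rightarrow> real" where "ff \<omega> = f (restrict \<omega> {-t0..0})"

lemma ff_measurable:
  assumes "{-t0..0} \<subseteq> S'" "S' \<subseteq> T'"
  shows "ff \<in> borel_measurable (coord_algebra E T' S')"
  unfolding ff_def[abs_def] using assms
  by (intro measurable_compose[OF measurable_restrict_path f]) auto

lemma ff_bounds: "{-t0..0} \<subseteq> T' \<Longrightarrow> \<omega> \<in> skorokhod E T' \<Longrightarrow> 0 \<le> ff \<omega> \<and> ff \<omega> \<le> 1"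
  unfolding ff_def by (intro f01 skorokhod_restrict)

lemma window_S:
  assumes h: "h > 0" and x: "x \<in> E"
  shows "(\<lambda>\<omega>. \<lambda>s\<in>{-h..0}. \<omega> (h + s)) \<in> S h x \<rightarrow>\<^sub>M path_space E {-h..0}"
  using window_measurable[of h h] h by (simp cong: measurable_cong_sets add: sets_S[OF h x])

lemma prob_reversed: "h > 0 \<Longrightarrow> x \<in> E \<Longrightarrow> prob_space (reversed_spine E h (S h x))"
  unfolding reversed_spine_def by (intro prob_space.prob_space_distr prob_space_S window_S)

lemma ff_window: "h \<ge> t0 \<Longrightarrow> ff (\<lambda>s\<in>{-h..0}. \<omega> (h + s)) = Fh h \<omega>"
  unfolding ff_def Fh_def by (intro arg_cong[where f = f]) (auto simp: restrict_def fun_eq_iff)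

lemma reversed_integral:
  assumes h: "h \<ge> t0" "h > 0" and x: "x \<in> E"
  shows "(\<integral>\<eta>. ff \<eta> \<partial>reversed_spine E h (S h x)) = ee h x"
    and "(\<integral>\<^sup>+\<eta>. ennreal (ff \<eta>) \<partial>reversed_spine E h (S h x)) = ennreal (ee h x)"
proof -
  have m: "ff \<in> borel_measurable (path_space E {-h..0})" using h by (intro ff_measurable) auto
  show "(\<integral>\<eta>. ff \<eta> \<partial>reversed_spine E h (S h x)) = ee h x"
    unfolding reversed_spine_def ee_def using integral_distr[OF window_S[OF h(2) x] m] ff_window[OF h(1)] by simp
  have "(\<integral>\<^sup>+\<eta>. ennreal (ff \<eta>) \<partial>reversed_spine E h (S h x)) = (\<integral>\<^sup>+\<omega>. ennreal (Fh h \<omega>) \<partial>S h x)"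
    unfolding reversed_spine_def
    by (subst nn_integral_distr[OF window_S[OF h(2) x]]) (use m ff_window[OF h(1)] in simp_all)
  then show "(\<integral>\<^sup>+\<eta>. ennreal (ff \<eta>) \<partial>reversed_spine E h (S h x)) = ennreal (ee h x)"
    using ee_nn(1)[OF h x] by simp
qed

text \<open>Needed to evaluate integrals under the mixture over \<pi>; the measurability in the
  start is that of \<open>S_kernel_measurable\<close>.\<close>

lemma reversed_kernel:
  assumes h: "h > 0"
  shows "(\<lambda>x. reversed_spine E h (S h x)) \<in> borel_on E \<rightarrow>\<^sub>M subprob_algebra (path_space E {-h..0})"
proof -
  have "S h \<in> borel_on E \<rightarrow>\<^sub>M subprob_algebra (filt E (ennreal h))"
  proof (rule measurable_subprob_algebra)
    fix x assume "x \<in> space (borel_on E)"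
    then have x: "x \<in> E" by simp
    show "subprob_space (S h x)" by (rule prob_space_imp_subprob_space[OF prob_space_S[OF h x]])
    show "sets (S h x) = sets (filt E (ennreal h))" by (rule sets_S[OF h x])
  next
    fix D assume D: "D \<in> sets (filt E (ennreal h))"
    have "(\<lambda>x. \<integral>\<^sup>+\<omega>. indicator D \<omega> \<partial>S h x) \<in> borel_measurable (borel_on E)"
      using D by (intro S_kernel_measurable[OF h]) simp
    then show "(\<lambda>x. emeasure (S h x) D) \<in> borel_measurable (borel_on E)"
      by (rule measurable_cong[THEN iffD1, rotated]) (simp add: D sets_S[OF h])
  qed
  moreover have "(\<lambda>M. reversed_spine E h M) \<in> subprob_algebra (filt E (ennreal h)) \<rightarrow>\<^sub>M subprob_algebra (path_space E {-h..0})"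
    unfolding reversed_spine_def using h by (intro measurable_distr window_measurable) auto
  ultimately show ?thesis by (rule measurable_compose)
qed

text \<open>Convergence of the densities in mean identifies the limit of the \<pi>-averages of
  \<open>ee\<close>, and \<open>ee_limit\<close> passes from the average to a fixed start.\<close>

lemma reversed_limit:
  fixes Linf :: "'a path \<Rightarrow> real"
  assumes R: "prob_space R" "sets R = sets (path_space E UNIV)"
    and L: "spine_limit_density E R (\<lambda>h. \<pi> \<bind> (\<lambda>x. reversed_spine E h (S h x))) Linf" and x: "x \<in> E"
  shows "((\<lambda>h. \<integral>\<eta>. ff \<eta> \<partial>reversed_spine E h (S h x)) \<longlongrightarrow> (\<integral>\<eta>. ff \<eta> \<partial>weighted_law E {..0} R Linf)) at_top"
proof -
  interpret R: prob_space R by (rule R)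
  interpret \<pi>: prob_space \<pi> by (rule \<pi>)
  have sp\<pi>: "space \<pi> = E" using sets_eq_imp_space_eq[OF \<pi>(2)] by simp
  have spR: "space R = skorokhod E UNIV" using sets_eq_imp_space_eq[OF R(2)] by simp
  have Rm: "g \<in> R \<rightarrow>\<^sub>M M" if "g \<in> coord_algebra E UNIV S' \<rightarrow>\<^sub>M M" for g :: "'a path \<Rightarrow> 'z" and S' M
    using that sets_coord_algebra_mono[of S' UNIV E UNIV] by (auto simp: measurable_def R(2) spR)
  have Linfm: "Linf \<in> borel_measurable R" using L by (auto simp: spine_limit_density_def intro: Rm)
  obtain Lh where Lh: "\<And>h. h > 0 \<Longrightarrow> spine_RN_derivative E R h (\<pi> \<bind> (\<lambda>x. reversed_spine E h (S h x))) (Lh h)"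
      and as: "AE \<omega> in R. ((\<lambda>h. Lh h \<omega>) \<longlongrightarrow> Linf \<omega>) at_top"
      and L1: "((\<lambda>h. \<integral>\<^sup>+\<omega>. ennreal \<bar>Lh h \<omega> - Linf \<omega>\<bar> \<partial>R) \<longlongrightarrow> 0) at_top"
    using L unfolding spine_limit_density_def by blast
  have Lm: "Lh h \<in> borel_measurable R" if "h > 0" for h
    using Lh[OF that] by (auto simp: spine_RN_derivative_def intro: Rm)
  have Lpos: "AE \<omega> in R. 0 \<le> Lh h \<omega>" if "h > 0" for h
    using Lh[OF that] by (simp add: spine_RN_derivative_def)
  \<comment> \<open>Nonnegativity of \<open>Lh h\<close> holds off a null set depending on h, so the
    limit is taken along integers, where countably many null sets suffice.\<close>
  have Linfpos: "AE \<omega> in R. 0 \<le> Linf \<omega>"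
  proof -
    have "AE \<omega> in R. \<forall>n. 0 \<le> Lh (real (Suc n)) \<omega>" using Lpos by (subst AE_all_countable) auto
    with as show ?thesis
    proof eventually_elim
      case (elim \<omega>)
      have "(\<lambda>n. Lh (real (Suc n)) \<omega>) \<longlonglongrightarrow> Linf \<omega>"
        by (rule filterlim_compose[OF elim(1) filterlim_compose[OF filterlim_real_sequentially filterlim_Suc]])
      then show ?case using elim(2) by (intro LIMSEQ_le_const) auto
    qed
  qed
  have ffR: "ff \<in> borel_measurable R" by (rule Rm[OF ff_measurable[of UNIV UNIV]]) auto
  have ffb: "0 \<le> ff \<omega> \<and> ff \<omega> \<le> 1" if "\<omega> \<in> space R" for \<omega> using ff_bounds[of UNIV \<omega>] that by (simp add: spR)
  have weighted_nn: "(\<integral>\<^sup>+\<omega>. ennreal (Lh h \<omega>) * g (restrict \<omega> {-h..0}) \<partial>R) = (\<integral>\<^sup>+y. (\<integral>\<^sup>+\<eta>. g \<eta> \<partial>reversed_spine E h (S h y)) \<partial>\<pi>)"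
    if h: "h > 0" and g: "g \<in> borel_measurable (path_space E {-h..0})" for h and g :: "'a path \<Rightarrow> ennreal"
  proof -
    have rm: "(\<lambda>\<omega>. restrict \<omega> {-h..0}) \<in> R \<rightarrow>\<^sub>M path_space E {-h..0}"
      by (rule Rm[OF measurable_restrict_path[where S = UNIV]]) auto
    have "(\<integral>\<^sup>+\<eta>. g \<eta> \<partial>weighted_law E {-h..0} R (Lh h)) = (\<integral>\<^sup>+\<omega>. ennreal (Lh h \<omega>) * g (restrict \<omega> {-h..0}) \<partial>R)"
      unfolding weighted_law_def using rm g Lm[OF h] measurable_compose[OF rm g]
      by (simp add: nn_integral_distr nn_integral_density)
    moreover have "weighted_law E {-h..0} R (Lh h) = \<pi> \<bind> (\<lambda>x. reversed_spine E h (S h x))"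
      using Lh[OF h] by (simp add: spine_RN_derivative_def)
    moreover have "(\<lambda>x. reversed_spine E h (S h x)) \<in> \<pi> \<rightarrow>\<^sub>M subprob_algebra (path_space E {-h..0})"
      using reversed_kernel[OF h] by (simp cong: measurable_cong_sets add: \<pi>(2))
    note nn_integral_bind[OF g this]
    ultimately show ?thesis by simp
  qed
  have Lh1: "(\<integral>\<^sup>+\<omega>. ennreal (Lh h \<omega>) \<partial>R) = 1" if h: "h > 0" for h
  proof -
    have "(\<integral>\<^sup>+\<omega>. ennreal (Lh h \<omega>) \<partial>R) = (\<integral>\<^sup>+y. (\<integral>\<^sup>+\<eta>. 1 \<partial>reversed_spine E h (S h y)) \<partial>\<pi>)"
      using weighted_nn[OF h, of "\<lambda>_. 1"] by simp
    also have "\<dots> = (\<integral>\<^sup>+y. 1 \<partial>\<pi>)"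
      using prob_space.emeasure_space_1[OF prob_reversed[OF h]] by (intro nn_integral_cong) (simp add: sp\<pi>)
    finally show ?thesis using \<pi>.emeasure_space_1 by simp
  qed
  have Lint: "integrable R (Lh h)" if h: "h > 0" for h
    using Lh1[OF h] Lm[OF h] Lpos[OF h] by (intro integrableI_nonneg) auto
  have ffL: "(\<integral>\<omega>. Lh h \<omega> * ff \<omega> \<partial>R) = (\<integral>y. ee h y \<partial>\<pi>)" if h: "h \<ge> t0" "h > 0" for h
  proof -
    have res: "ff (restrict \<omega> {-h..0}) = ff \<omega>" for \<omega>
      unfolding ff_def using h by (intro arg_cong[where f = f]) (auto simp: restrict_def fun_eq_iff)
    have "(\<lambda>\<omega>. ennreal (ff \<omega>)) \<in> borel_measurable (path_space E {-h..0})"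
      using h by (intro measurable_compose[OF ff_measurable measurable_ennreal]) auto
    from weighted_nn[OF h(2) this]
    have "(\<integral>\<^sup>+\<omega>. ennreal (Lh h \<omega>) * ennreal (ff \<omega>) \<partial>R) = (\<integral>\<^sup>+y. ennreal (ee h y) \<partial>\<pi>)"
      unfolding res by (rule trans) (intro nn_integral_cong, simp add: reversed_integral(2)[OF h] sp\<pi>)
    moreover have "(\<integral>\<^sup>+\<omega>. ennreal (Lh h \<omega>) * ennreal (ff \<omega>) \<partial>R) = (\<integral>\<^sup>+\<omega>. ennreal (Lh h \<omega> * ff \<omega>) \<partial>R)"
      using Lpos[OF h(2)] AE_space
      by (intro nn_integral_cong_AE, eventually_elim) (use ffb in \<open>simp add: ennreal_mult\<close>)
    ultimately have eq: "(\<integral>\<^sup>+\<omega>. ennreal (Lh h \<omega> * ff \<omega>) \<partial>R) = (\<integral>\<^sup>+y. ennreal (ee h y) \<partial>\<pi>)" by simp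
    have eem: "ee h \<in> borel_measurable \<pi>"
      using ee_measurable[OF h] by (simp cong: measurable_cong_sets add: \<pi>(2))
    have "(\<integral>\<omega>. Lh h \<omega> * ff \<omega> \<partial>R) = enn2real (\<integral>\<^sup>+\<omega>. ennreal (Lh h \<omega> * ff \<omega>) \<partial>R)"
    proof (rule integral_eq_nn_integral)
      show "AE \<omega> in R. 0 \<le> Lh h \<omega> * ff \<omega>"
        using Lpos[OF h(2)] AE_space by eventually_elim (use ffb in simp)
    qed (use Lm[OF h(2)] ffR in measurable)
    also have "\<dots> = (\<integral>y. ee h y \<partial>\<pi>)"
      unfolding eq using ee_nn(2)[OF h] by (intro integral_eq_nn_integral[OF eem, symmetric] AE_I2) (simp add: sp\<pi>)
    finally show ?thesis .
  qed
  \<comment> \<open>A finite distance in mean for a single h, together with integrability of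
    \<open>Lh h\<close>, gives the integrability of \<open>Linf\<close> that
    \<open>spine_limit_density\<close> leaves implicit.\<close>
  have nn_fin: "\<forall>\<^sub>F h in at_top. (\<integral>\<^sup>+\<omega>. ennreal \<bar>Lh h \<omega> - Linf \<omega>\<bar> \<partial>R) < 1"
    by (rule order_tendstoD(2)[OF L1]) simp
  have dint: "integrable R (\<lambda>\<omega>. Lh h \<omega> - Linf \<omega>)"
    if "h > 0" "(\<integral>\<^sup>+\<omega>. ennreal \<bar>Lh h \<omega> - Linf \<omega>\<bar> \<partial>R) < 1" for h
    using that Lm[OF that(1)] Linfm by (intro integrableI_bounded) (auto intro: less_trans)
  obtain h0 where h0: "h0 > 0" "(\<integral>\<^sup>+\<omega>. ennreal \<bar>Lh h0 \<omega> - Linf \<omega>\<bar> \<partial>R) < 1"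
    using eventually_happens[OF eventually_conj[OF nn_fin eventually_gt_at_top[of 0]]] by auto
  have Linfint: "integrable R Linf"
    using Bochner_Integration.integrable_diff[OF Lint[OF h0(1)] dint[OF h0]] by simp
  have bint: "integrable R (\<lambda>\<omega>. g \<omega> * ff \<omega>)" if "integrable R g" for g
    using that ffR ffb
    by (intro Bochner_Integration.integrable_bound[OF that]) (auto simp: abs_mult intro!: AE_I2 mult_left_le)
  have "((\<lambda>h. (\<integral>\<omega>. Lh h \<omega> * ff \<omega> \<partial>R) - (\<integral>\<omega>. Linf \<omega> * ff \<omega> \<partial>R)) \<longlongrightarrow> 0) at_top"
  proof (rule Lim_null_comparison)
    show "((\<lambda>h. enn2real (\<integral>\<^sup>+\<omega>. ennreal \<bar>Lh h \<omega> - Linf \<omega>\<bar> \<partial>R)) \<longlongrightarrow> 0) at_top"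
      using tendsto_enn2real[OF L1[unfolded ennreal_0[symmetric]]] by simp
    show "\<forall>\<^sub>F h in at_top. norm ((\<integral>\<omega>. Lh h \<omega> * ff \<omega> \<partial>R) - (\<integral>\<omega>. Linf \<omega> * ff \<omega> \<partial>R))
        \<le> enn2real (\<integral>\<^sup>+\<omega>. ennreal \<bar>Lh h \<omega> - Linf \<omega>\<bar> \<partial>R)"
      using nn_fin eventually_gt_at_top[of 0]
    proof eventually_elim
      case (elim h)
      have "(\<integral>\<omega>. Lh h \<omega> * ff \<omega> \<partial>R) - (\<integral>\<omega>. Linf \<omega> * ff \<omega> \<partial>R) = (\<integral>\<omega>. (Lh h \<omega> - Linf \<omega>) * ff \<omega> \<partial>R)"
        using bint[OF Lint[OF elim(2)]] bint[OF Linfint] by (simp add: left_diff_distrib)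
      also have "\<bar>\<dots>\<bar> \<le> (\<integral>\<omega>. \<bar>(Lh h \<omega> - Linf \<omega>) * ff \<omega>\<bar> \<partial>R)" by (rule integral_abs_bound)
      also have "\<dots> \<le> (\<integral>\<omega>. \<bar>Lh h \<omega> - Linf \<omega>\<bar> \<partial>R)"
        using bint[OF dint[OF elim(2,1)]] dint[OF elim(2,1)] ffb
        by (intro integral_mono integrable_abs) (auto simp: abs_mult intro!: mult_left_le)
      also have "\<dots> = enn2real (\<integral>\<^sup>+\<omega>. ennreal \<bar>Lh h \<omega> - Linf \<omega>\<bar> \<partial>R)"
        using Lm[OF elim(2)] Linfm by (intro integral_eq_nn_integral) auto
      finally show ?case by simp
    qed
  qed
  then have "((\<lambda>h. (\<integral>\<omega>. Lh h \<omega> * ff \<omega> \<partial>R)) \<longlongrightarrow> (\<integral>\<omega>. Linf \<omega> * ff \<omega> \<partial>R)) at_top"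
    by (rule LIM_zero_cancel)
  moreover have ev: "\<forall>\<^sub>F h in at_top. h \<ge> t0 \<and> h > 0"
    using eventually_conj[OF eventually_ge_at_top[of t0] eventually_gt_at_top[of 0]] .
  ultimately have "((\<lambda>h. \<integral>y. ee h y \<partial>\<pi>) \<longlongrightarrow> (\<integral>\<omega>. Linf \<omega> * ff \<omega> \<partial>R)) at_top"
    using ffL by (elim Lim_transform_eventually) (auto elim!: eventually_mono)
  from ee_limit[OF this x]
  have "((\<lambda>h. \<integral>\<eta>. ff \<eta> \<partial>reversed_spine E h (S h x)) \<longlongrightarrow> (\<integral>\<omega>. Linf \<omega> * ff \<omega> \<partial>R)) at_top"
    by (rule Lim_transform_eventually) (use ev reversed_integral(1)[OF _ _ x] in \<open>auto elim!: eventually_mono\<close>)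
  also have "(\<integral>\<omega>. Linf \<omega> * ff \<omega> \<partial>R) = (\<integral>\<eta>. ff \<eta> \<partial>weighted_law E {..0} R Linf)"
  proof -
    have rm: "(\<lambda>\<omega>. restrict \<omega> {..0}) \<in> R \<rightarrow>\<^sub>M path_space E {..0}"
      by (rule Rm[OF measurable_restrict_path[where S = UNIV]]) auto
    have fm: "ff \<in> borel_measurable (path_space E {..0})" by (rule ff_measurable) auto
    have res: "ff (restrict \<omega> {..0}) = ff \<omega>" for \<omega>
      unfolding ff_def by (intro arg_cong[where f = f]) (auto simp: restrict_def fun_eq_iff)
    have "(\<integral>\<eta>. ff \<eta> \<partial>weighted_law E {..0} R Linf) = (\<integral>\<omega>. ff (restrict \<omega> {..0}) \<partial>density R (\<lambda>\<omega>. ennreal (Linf \<omega>)))"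
      unfolding weighted_law_def by (rule integral_distr[OF _ fm]) (use rm in simp)
    also have "\<dots> = (\<integral>\<omega>. Linf \<omega> * ff \<omega> \<partial>R)"
      unfolding res using integral_density[OF ffR Linfm Linfpos] by simp
    finally show ?thesis ..
  qed
  finally show ?thesis .
qed

end

theorem proposition6p12:
  fixes E :: "'a::euclidean_space set"
    and P P_tilde P_phi :: "'a \<Rightarrow> 'a path measure"
    and \<alpha> \<beta> \<phi>0 :: "'a \<Rightarrow> real" and lam0 :: real
    and PP :: "'a measure \<Rightarrow> 'a measure path measure"
    and N :: "'a \<Rightarrow> 'a measure path measure"
    and \<pi> :: "'a measure" and P_phi_\<pi> :: "'a path measure"
    and P_spine :: "real \<Rightarrow> 'a \<Rightarrow> 'a path measure"
    and Linf :: "'a path \<Rightarrow> real"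
  assumes markov: "strong_markov_process E P" "Cb_semigroup E P"
    and motion: "finite_irreducible_chain E P \<or> diffusion E P"
    and alpha: "\<alpha> \<in> C_b E" "\<exists>c>0. \<forall>x\<in>E. c \<le> \<alpha> x"
    and beta: "\<beta> \<in> C_b E"
    and superprocess: "superprocess E P \<alpha> \<beta> PP"
    and canonical: "canonical_measures E PP N"
    and lambda0: "ereal lam0 = gen_eigenvalue E P \<beta>"
    and phi0_pos: "\<forall>x\<in>E. 0 < \<phi>0 x"
    and phi0: "\<And>u. positive_harmonic E P (\<lambda>x. \<beta> x - lam0) u \<longleftrightarrow> (\<exists>c>0. \<forall>x\<in>E. u x = c * \<phi>0 x)"
    and lambda0_pos: "lam0 > 0"
    and H2: "(\<lambda>x. 1 / \<alpha> x) \<in> gen_dom E P"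
    and P_tilde: "locally_abs_continuous E P P_tilde (tilde_density E P \<alpha> \<beta>)"
    and H3: "beta_tilde E P \<alpha> \<beta> \<in> gen_dom E P_tilde"
    and H8: "\<phi>0 \<in> gen_dom E P" "\<exists>C1>0. \<exists>C2>0. \<forall>x\<in>E. C1 \<le> \<phi>0 x \<and> \<phi>0 x \<le> C2"
    and P_phi: "locally_abs_continuous E P P_phi (phi_density \<beta> lam0 \<phi>0)"
    and H9: "stationary_measure E P_phi \<pi>" "tv_ergodic E P_phi \<pi>"
    and P_phi_\<pi>: "stationary_version E P_phi \<pi> P_phi_\<pi>"
    and P_spine: "\<And>h x. h > 0 \<Longrightarrow> x \<in> E \<Longrightarrow> spine_law E P \<alpha> \<beta> (vfun E N) h x (P_spine h x)"
    and Linf: "spine_limit_density E P_phi_\<pi> (\<lambda>h. \<pi> \<bind> (\<lambda>x. reversed_spine E h (P_spine h x))) Linf"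
  shows "\<forall>x\<in>E. \<forall>t\<ge>0. \<forall>f. f \<in> borel_measurable (path_space E {-t..0}) \<longrightarrow>
           bounded (f ` skorokhod E {-t..0}) \<longrightarrow>
           ((\<lambda>h. \<integral>\<omega>. f (restrict \<omega> {-t..0}) \<partial>reversed_spine E h (P_spine h x)) \<longlongrightarrow>
             (\<integral>\<omega>. (f (restrict \<omega> {-t..0}) :: real) \<partial>weighted_law E {..0} P_phi_\<pi> Linf)) at_top"
proof (intro ballI allI impI)
  fix x t and f :: "'a path \<Rightarrow> real"
  assume x: "x \<in> E" and t: "t \<ge> 0" and fm: "f \<in> borel_measurable (path_space E {-t..0})"
    and fb: "bounded (f ` skorokhod E {-t..0})"
  define L\<phi> where "L\<phi> = gen E P \<phi>0"
  define L\<alpha> where "L\<alpha> = gen E P (\<lambda>x. 1 / \<alpha> x)"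
  have gen: "has_generator E P u (gen E P u)" if "u \<in> gen_dom E P" for u
  proof -
    have "\<exists>g. has_generator E P u g" using that by (simp add: gen_dom_def)
    then show ?thesis unfolding gen_def by (rule someI_ex)
  qed
  have L\<phi>: "has_generator E P \<phi>0 L\<phi>" unfolding L\<phi>_def by (rule gen[OF H8(1)])
  have L\<alpha>: "has_generator E P (\<lambda>x. 1 / \<alpha> x) L\<alpha>" unfolding L\<alpha>_def by (rule gen[OF H2])
  have "positive_harmonic E P (\<lambda>x. \<beta> x - lam0) \<phi>0"
    by (rule phi0[THEN iffD2]) (auto intro!: exI[of _ 1])
  then have L\<phi>_eq: "L\<phi> y = (\<beta> y - lam0) * \<phi>0 y" if "y \<in> E" for y
    using that by (simp add: positive_harmonic_def L\<phi>_def)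
  obtain a where a: "a > 0" "\<forall>x\<in>E. a \<le> \<alpha> x" using alpha(2) by blast
  obtain A where A: "\<forall>x\<in>E. \<bar>\<alpha> x\<bar> \<le> A" using C_b_bounded[OF alpha(1)] by blast
  obtain Bb where Bb: "\<forall>x\<in>E. \<bar>\<beta> x\<bar> \<le> Bb" using C_b_bounded[OF beta] by blast
  obtain C1 C2 where C: "C1 > 0" "\<forall>x\<in>E. C1 \<le> \<phi>0 x \<and> \<phi>0 x \<le> C2" using H8(2) by blast
  have "L\<alpha> \<in> C_b E" using L\<alpha> by (simp add: has_generator_def)
  then obtain D where D: "D > 0" "\<forall>x\<in>E. \<bar>L\<alpha> x\<bar> \<le> D" using C_b_bounded by blast
  \<comment> \<open>The summand 1 makes the constant positive, as the rate in
    \<open>logistic_derivative\<close> has to be.\<close>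
  have K: "\<bar>\<beta> y - \<alpha> y * L\<alpha> y\<bar> \<le> \<bar>Bb\<bar> + \<bar>A\<bar> * D + 1" if y: "y \<in> E" for y
  proof -
    have "\<bar>\<alpha> y * L\<alpha> y\<bar> \<le> \<bar>A\<bar> * D"
      unfolding abs_mult using A D y by (intro mult_mono) (auto intro: order_trans)
    moreover have "\<bar>\<beta> y\<bar> \<le> \<bar>Bb\<bar>" using Bb y by (auto intro: order_trans)
    ultimately show ?thesis by linarith
  qed
  have K0: "\<bar>Bb\<bar> + \<bar>A\<bar> * D + 1 > 0" using D(1) by (simp add: add_nonneg_pos)
  have R: "prob_space P_phi_\<pi>" "sets P_phi_\<pi> = sets (path_space E UNIV)"
    using P_phi_\<pi> by (auto simp: stationary_version_def)
  have "spine_motion E P \<alpha> \<beta> \<phi>0 L\<phi> L\<alpha> lam0 a A Bb C1 C2 (\<bar>Bb\<bar> + \<bar>A\<bar> * D + 1) PP N P_phi P_spine"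
  proof unfold_locales
    show "strong_markov_process E P" "\<alpha> \<in> C_b E" "\<beta> \<in> C_b E" "0 < lam0" "0 < a" "0 < C1"
      "has_generator E P \<phi>0 L\<phi>" "has_generator E P (\<lambda>x. 1 / \<alpha> x) L\<alpha>" "0 < \<bar>Bb\<bar> + \<bar>A\<bar> * D + 1"
      "superprocess E P \<alpha> \<beta> PP" "canonical_measures E PP N"
      "locally_abs_continuous E P P_phi (phi_density \<beta> lam0 \<phi>0)"
      by fact+
    show "a \<le> \<alpha> y" "\<bar>\<beta> y\<bar> \<le> Bb" "C1 \<le> \<phi>0 y" "\<phi>0 y \<le> C2" if "y \<in> E" for y
      using that a(2) Bb C(2) by simp_all
    show "\<alpha> y \<le> A" if "y \<in> E" for y using bspec[OF A that] by linarith
    show "L\<phi> y = (\<beta> y - lam0) * \<phi>0 y" if "y \<in> E" for y by (rule L\<phi>_eq[OF that])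
    show "\<bar>\<beta> y - \<alpha> y * L\<alpha> y\<bar> \<le> \<bar>Bb\<bar> + \<bar>A\<bar> * D + 1" if "y \<in> E" for y by (rule K[OF that])
    show "spine_law E P \<alpha> \<beta> (vfun E N) h y (P_spine h y)" if "h > 0" "y \<in> E" for h y by (rule P_spine[OF that])
  qed
  then interpret spine_motion E P \<alpha> \<beta> \<phi>0 L\<phi> L\<alpha> lam0 a A Bb C1 C2 "\<bar>Bb\<bar> + \<bar>A\<bar> * D + 1" PP N P_phi P_spine .
  have limit: "((\<lambda>h. \<integral>\<omega>. g (restrict \<omega> {-t..0}) \<partial>reversed_spine E h (P_spine h x)) \<longlongrightarrow>
      (\<integral>\<omega>. g (restrict \<omega> {-t..0}) \<partial>weighted_law E {..0} P_phi_\<pi> Linf)) at_top"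
    and prob_rev: "\<And>h. h > 0 \<Longrightarrow> prob_space (reversed_spine E h (P_spine h x))"
    if g: "g \<in> borel_measurable (path_space E {-t..0})" and g01: "\<And>\<omega>. \<omega> \<in> skorokhod E {-t..0} \<Longrightarrow> 0 \<le> g \<omega> \<and> g \<omega> \<le> 1" for g :: "'a path \<Rightarrow> real"
  proof -
    interpret reversed_spine_functional E P \<alpha> \<beta> \<phi>0 L\<phi> L\<alpha> lam0 a A Bb C1 C2 "\<bar>Bb\<bar> + \<bar>A\<bar> * D + 1" PP N P_phi P_spine g t \<pi>
    proof (intro reversed_spine_functional.intro reversed_spine_functional_axioms.intro spine_motion_axioms)
      show "t \<ge> 0" "g \<in> borel_measurable (path_space E {-t..0})" "tv_ergodic E P_phi \<pi>" by fact+
      show "0 \<le> g \<omega> \<and> g \<omega> \<le> 1" if "\<omega> \<in> skorokhod E {-t..0}" for \<omega> by (rule g01[OF that])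
      show "prob_space \<pi>" "sets \<pi> = sets (borel_on E)" using H9(1) by (simp_all add: stationary_measure_def)
    qed
    show "((\<lambda>h. \<integral>\<omega>. g (restrict \<omega> {-t..0}) \<partial>reversed_spine E h (P_spine h x)) \<longlongrightarrow>
      (\<integral>\<omega>. g (restrict \<omega> {-t..0}) \<partial>weighted_law E {..0} P_phi_\<pi> Linf)) at_top"
      using reversed_limit[OF R Linf x] by (simp add: ff_def)
    show "\<And>h. h > 0 \<Longrightarrow> prob_space (reversed_spine E h (P_spine h x))" by (rule prob_reversed[OF _ x])
  qed
  let ?W = "weighted_law E {..0} P_phi_\<pi> Linf"
  have ev: "\<forall>\<^sub>F h in at_top. h \<ge> t \<and> h > 0"
    using eventually_conj[OF eventually_ge_at_top[of t] eventually_gt_at_top[of 0]] .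
  have prob_rev: "prob_space (reversed_spine E h (P_spine h x))" if "h > 0" for h
    by (rule prob_rev[of "\<lambda>_. 1"]) (use that in auto)
  \<comment> \<open>The limit statement for the constant 1 shows that the limit law has total mass
    1.\<close>
  have "((\<lambda>h. \<integral>\<omega>. 1 \<partial>reversed_spine E h (P_spine h x)) \<longlongrightarrow> (\<integral>\<omega>. (1 :: real) \<partial>?W)) at_top"
    by (rule limit[of "\<lambda>_. 1"]) auto
  moreover have "((\<lambda>h. \<integral>\<omega>. 1 \<partial>reversed_spine E h (P_spine h x)) \<longlongrightarrow> (1 :: real)) at_top"
    by (rule Lim_transform_eventually[OF tendsto_const])
      (use ev prob_space.prob_space[OF prob_rev] in \<open>auto elim!: eventually_mono\<close>)
  ultimately have "(\<integral>\<omega>. (1 :: real) \<partial>?W) = 1" by (rule tendsto_unique[rotated]) simp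
  then have mW: "measure ?W (space ?W) = 1" by simp
  \<comment> \<open>\<open>measure\<close> would be 0 if the total mass were infinite.\<close>
  then have "emeasure ?W (space ?W) \<noteq> \<top>" by (auto simp: measure_def)
  then have W: "prob_space ?W"
    using mW by (intro prob_spaceI) (simp add: emeasure_eq_ennreal_measure)
  obtain B where B: "B > 0" "\<And>\<omega>. \<omega> \<in> skorokhod E {-t..0} \<Longrightarrow> \<bar>f \<omega>\<bar> \<le> B"
    using fb unfolding bounded_pos by (auto simp: image_iff)
  \<comment> \<open>The affine map from [-B, B] onto [0, 1]. Undoing it under an integral uses total
    mass 1 for the reversed spine laws as well as for the limit law.\<close>
  define g where "g \<omega> = (f \<omega> + B) / (2 * B)" for \<omega>
  have gm: "g \<in> borel_measurable (path_space E {-t..0})" unfolding g_def[abs_def] using fm by measurable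
  have gb: "0 \<le> g \<omega> \<and> g \<omega> \<le> 1" if "\<omega> \<in> skorokhod E {-t..0}" for \<omega>
    using B(2)[OF that] B(1) by (simp add: g_def abs_le_iff)
  have lin: "(\<integral>\<omega>. f (restrict \<omega> {-t..0}) \<partial>M) = 2 * B * (\<integral>\<omega>. g (restrict \<omega> {-t..0}) \<partial>M) - B"
    if M: "prob_space M" "sets M = sets (path_space E T')" and T': "{-t..0} \<subseteq> T'" for M T'
  proof -
    interpret M: prob_space M by (rule M)
    have sp: "space M = skorokhod E T'" using sets_eq_imp_space_eq[OF M(2)] by simp
    have "(\<lambda>\<omega>. g (restrict \<omega> {-t..0})) \<in> borel_measurable (path_space E T')"
      using T' by (intro measurable_compose[OF measurable_restrict_path gm]) auto
    then have "integrable M (\<lambda>\<omega>. g (restrict \<omega> {-t..0}))"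
      using gb[OF skorokhod_restrict[OF _ T']]
      by (intro integrable_bounded[OF M.finite_measure_axioms, where B = 1])
        (simp_all cong: measurable_cong_sets add: M(2) sp)
    then have "(\<integral>\<omega>. 2 * B * g (restrict \<omega> {-t..0}) - B \<partial>M) = 2 * B * (\<integral>\<omega>. g (restrict \<omega> {-t..0}) \<partial>M) - B"
      by (simp add: M.prob_space)
    then show ?thesis using B(1) by (simp add: g_def)
  qed
  have "((\<lambda>h. 2 * B * (\<integral>\<omega>. g (restrict \<omega> {-t..0}) \<partial>reversed_spine E h (P_spine h x)) - B) \<longlongrightarrow>
      2 * B * (\<integral>\<omega>. g (restrict \<omega> {-t..0}) \<partial>?W) - B) at_top"
    by (intro tendsto_intros limit gm gb)
  moreover have "2 * B * (\<integral>\<omega>. g (restrict \<omega> {-t..0}) \<partial>?W) - B = (\<integral>\<omega>. f (restrict \<omega> {-t..0}) \<partial>?W)"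
    by (rule lin[OF W, symmetric]) (auto simp: weighted_law_def)
  moreover have "\<forall>\<^sub>F h in at_top. 2 * B * (\<integral>\<omega>. g (restrict \<omega> {-t..0}) \<partial>reversed_spine E h (P_spine h x)) - B =
      (\<integral>\<omega>. f (restrict \<omega> {-t..0}) \<partial>reversed_spine E h (P_spine h x))"
    using ev
  proof eventually_elim
    case (elim h)
    then show ?case by (intro lin[OF prob_rev, symmetric]) (auto simp: reversed_spine_def)
  qed
  ultimately show "((\<lambda>h. \<integral>\<omega>. f (restrict \<omega> {-t..0}) \<partial>reversed_spine E h (P_spine h x)) \<longlongrightarrow>
      (\<integral>\<omega>. f (restrict \<omega> {-t..0}) \<partial>?W)) at_top"
    by (auto elim: Lim_transform_eventually)
qed

end
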